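(* For every integer $q\ge 1$ there exist constants $c_q,C_q>0$ depending only on $q$ such that the following holds. Let $m,d_1,d_2\ge 1$ be integers, $d=\max\{d_1,d_2\}$, let $h$ be a real random variable with zero mean, and let $$Y=\sum_{i_1,\ldots,i_q\in[m]} h^{(1)}_{i_1}\cdots h^{(q)}_{i_q}\,A_{i_1,\ldots,i_q}$$ be a decoupled matrix chaos of order $q$, where $A_{i_1,\ldots,i_q}$ are deterministic real $d_1\times d_2$ matrices and the $h^{(t)}_i$ ($t\in[q]$, $i\in[m]$) are i.i.d. copies of $h$. Then $$c_q\,\|h\|_{L^1}^q\,\sigma(\mathcal A)\;\le\;\mathbb E\|Y\|\;\le\; C_q\,\|h\|_{\psi_2}^q\,\log(d+m)^{\frac q2}\,\sigma(\mathcal A).$$ Alternatively, the upper bound remains valid if $\|h\|_{\psi_2}$ is replaced by $\|h\|_{L^{\log m}}$.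
   Context: $[m]=\{1,\dots,m\}$; $\|\cdot\|$ is the operator (spectral) norm of a matrix; $\|h\|_{L^p}=(\mathbb E|h|^p)^{1/p}$; $\|h\|_{\psi_2}=\inf\{t>0:\mathbb E\exp(h^2/t^2)\le 2\}$ is the subgaussian constant. Coefficient tensor: $\mathcal A$ is the tensor of order $q+2$ with entries $\mathcal A_{i_1,\ldots,i_q,i_{q+1},i_{q+2}}=(A_{i_1,\ldots,i_q})_{i_{q+1},i_{q+2}}$, $i_1,\dots,i_q\in[m]$, $i_{q+1}\in[d_1]$, $i_{q+2}\in[d_2]$. Flattenings: for $R,C\subseteq[q+2]$, $$\mathcal A_{[R|C]}=\sum_{i_1,\ldots,i_{q+2}}\Big(\bigotimes_{t\in R}e_{i_t}\Big)\otimes\Big(\bigotimes_{t\in C}e_{i_t}^\top\Big)\,\mathcal A_{i_1,\ldots,i_{q+2}},$$ where $e_i$ are standard basis column vectors. (When $C=[q+2]\setminus R$, this is the matrix with rows indexed by $(i_t)_{t\in R}$, columns by $(i_t)_{t\in C}$, and entries $\mathcal A_{i_1,\ldots,i_{q+2}}$.) $$\sigma(\mathcal A)=\max\{\|\mathcal A_{[R|C]}\| : R=[q+2]\setminus C,\ q+1\in R,\ q+2\in C\}.$$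
   Formalization: L^{log m} is read as L^{max(1, log m)}: for m=1 L^0 is undefined, and for m=2 the bound with exponent log 2 < 1 is false. Random variables live on probability spaces over one fixed carrier set; since only joint laws matter, the claim for all spaces follows. *)

theory Defs
  imports "HOL-Probability.Probability"
begin

text \<open>
  The sizes \<open>m\<close>, \<open>d\<^sub>1\<close>, \<open>d\<^sub>2\<close> are quantified after the constants that depend on \<open>q\<close> only, so they
  cannot be types. A matrix is a function of a row and a column index, together with finite
  index sets \<open>I\<close> (rows) and \<open>J\<close> (columns); values outside \<open>I \<times> J\<close> are irrelevant. Multi-indices
  \<open>(i\<^sub>t)\<close> with \<open>t \<in> T\<close> are the elements of a dependent product \<open>PiE T\<close>.
\<close>

definition op_norm :: "'r set \<Rightarrow> 'c set \<Rightarrow> ('r \<Rightarrow> 'c \<Rightarrow> real) \<Rightarrow> real" where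
  "op_norm I J B = (SUP x\<in>{x. L2_set x J \<le> 1}. L2_set (\<lambda>r. \<Sum>c\<in>J. B r c * x c) I)"

definition mode_range :: "nat \<Rightarrow> nat \<Rightarrow> nat \<Rightarrow> nat \<Rightarrow> nat \<Rightarrow> nat set" where
  "mode_range q m d1 d2 t = (if t \<le> q then {1..m} else if t = q + 1 then {1..d1} else {1..d2})"

definition coeff_tensor ::
    "nat \<Rightarrow> ((nat \<Rightarrow> nat) \<Rightarrow> nat \<Rightarrow> nat \<Rightarrow> real) \<Rightarrow> (nat \<Rightarrow> nat) \<Rightarrow> real" where
  "coeff_tensor q A i = A (restrict i {1..q}) (i (q + 1)) (i (q + 2))"

text \<open>
  Entry of the flattening at the row multi-index \<open>r\<close> and the column multi-index \<open>c\<close>. The factor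
  \<open>(\<Otimes>t\<in>R. e(i t)) \<otimes> (\<Otimes>t\<in>C. e(i t)\<^sup>T)\<close> has there the entry 1 if \<open>i\<close> restricts
  to \<open>r\<close> on \<open>R\<close> and to \<open>c\<close> on \<open>C\<close>, and 0 otherwise.
\<close>

definition flattening ::
    "nat set \<Rightarrow> (nat \<Rightarrow> nat set) \<Rightarrow> ((nat \<Rightarrow> nat) \<Rightarrow> real) \<Rightarrow> nat set \<Rightarrow> nat set
      \<Rightarrow> (nat \<Rightarrow> nat) \<Rightarrow> (nat \<Rightarrow> nat) \<Rightarrow> real" where
  "flattening T n \<A> R C r c = (\<Sum>i\<in>{i \<in> PiE T n. restrict i R = r \<and> restrict i C = c}. \<A> i)"

lemma flattening_complement:
  assumes "C \<subseteq> T" "R = T - C" "r \<in> PiE R n" "c \<in> PiE C n"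
  shows "flattening T n \<A> R C r c = \<A> (merge R C (r, c))"
proof -
  have "{i \<in> PiE T n. restrict i R = r \<and> restrict i C = c} = {merge R C (r, c)}"
    using assms by (fastforce simp: PiE_iff merge_def extensional_def fun_eq_iff restrict_def)
  then show ?thesis by (simp add: flattening_def)
qed

definition sigma_param ::
    "nat \<Rightarrow> nat \<Rightarrow> nat \<Rightarrow> nat \<Rightarrow> ((nat \<Rightarrow> nat) \<Rightarrow> nat \<Rightarrow> nat \<Rightarrow> real) \<Rightarrow> real" where
  "sigma_param q m d1 d2 A =
     Max {op_norm (PiE R (mode_range q m d1 d2)) (PiE C (mode_range q m d1 d2))
            (flattening {1..q + 2} (mode_range q m d1 d2) (coeff_tensor q A) R C) | R C.
          C \<subseteq> {1..q + 2} \<and> R = {1..q + 2} - C \<and> q + 1 \<in> R \<and> q + 2 \<in> C}"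

definition chaos ::
    "nat \<Rightarrow> nat \<Rightarrow> ((nat \<Rightarrow> nat) \<Rightarrow> nat \<Rightarrow> nat \<Rightarrow> real) \<Rightarrow> (nat \<Rightarrow> nat \<Rightarrow> 'w \<Rightarrow> real)
      \<Rightarrow> 'w \<Rightarrow> nat \<Rightarrow> nat \<Rightarrow> real" where
  "chaos q m A H \<omega> r s =
     (\<Sum>i\<in>PiE {1..q} (\<lambda>_. {1..m}). (\<Prod>t\<in>{1..q}. H t (i t) \<omega>) * A i r s)"

text \<open>
  The norms below take values in the extended nonnegative reals: they are \<open>\<infinity>\<close> if the random
  variable is not in the corresponding space. The exponent \<open>log m\<close> of the second upper bound is
  read as \<open>max 1 (log m)\<close>: it differs from \<open>log m\<close> only for \<open>m \<le> 2\<close>, where \<open>L\<^sup>0\<close> is meaningless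
  (\<open>m = 1\<close>) and the bound fails for the quasinorm of \<open>L\<^bsup>log 2\<^esup>\<close> (\<open>m = 2\<close>), which does not
  control \<open>L\<^sup>1\<close>.
\<close>

definition Lp_norm :: "'w measure \<Rightarrow> real \<Rightarrow> ('w \<Rightarrow> real) \<Rightarrow> ennreal" where
  "Lp_norm M p h =
     (if integrable M (\<lambda>\<omega>. \<bar>h \<omega>\<bar> powr p)
      then ennreal ((\<integral>\<omega>. \<bar>h \<omega>\<bar> powr p \<partial>M) powr (1 / p)) else \<infinity>)"

definition psi2_norm :: "'w measure \<Rightarrow> ('w \<Rightarrow> real) \<Rightarrow> ennreal" where
  "psi2_norm M h =
     Inf {ennreal t | t. t > 0 \<and> (\<integral>\<^sup>+\<omega>. ennreal (exp ((h \<omega>)\<^sup>2 / t\<^sup>2)) \<partial>M) \<le> 2}"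

definition iid_copies ::
    "'w measure \<Rightarrow> ('w \<Rightarrow> real) \<Rightarrow> nat \<Rightarrow> nat \<Rightarrow> (nat \<Rightarrow> nat \<Rightarrow> 'w \<Rightarrow> real) \<Rightarrow> bool" where
  "iid_copies M h q m H \<longleftrightarrow>
     prob_space.indep_vars M (\<lambda>_. borel) (\<lambda>(t, i). H t i) ({1..q} \<times> {1..m}) \<and>
     (\<forall>t\<in>{1..q}. \<forall>i\<in>{1..m}. distr M borel (H t i) = distr M borel h)"

text \<open>
  Constants that are independent of the probability space cannot be asserted for sample spaces
  of arbitrary type, since HOL has no quantification over types inside a formula. The sample
  spaces are therefore the probability spaces over the single type \<open>nat \<times> nat \<Rightarrow> real\<close>. Nothing is
  lost: by the following lemma, i.i.d. copies on any probability space are realised there with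
  the same law of \<open>h\<close> and the same joint law of the copies, and all quantities involved depend on
  these laws only.
\<close>

lemma iid_copies_realisation:
  fixes M :: "'w measure" and h :: "'w \<Rightarrow> real"
  assumes "prob_space M" "q \<ge> 1" "m \<ge> 1" "iid_copies M h q m H"
  defines "I \<equiv> {1..q} \<times> {1..m}"
  shows "\<exists>(M' :: (nat \<times> nat \<Rightarrow> real) measure) h' H'.
           prob_space M' \<and> h' \<in> borel_measurable M' \<and> iid_copies M' h' q m H' \<and>
           distr M' borel h' = distr M borel h \<and>
           distr M' (PiM I (\<lambda>_. borel)) (\<lambda>\<omega>. \<lambda>x\<in>I. H' (fst x) (snd x) \<omega>) =
           distr M (PiM I (\<lambda>_. borel)) (\<lambda>\<omega>. \<lambda>x\<in>I. H (fst x) (snd x) \<omega>)"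
proof -
  interpret prob_space M by fact
  define X where "X = (\<lambda>\<omega>. \<lambda>x\<in>I. H (fst x) (snd x) \<omega>)"
  define M' where "M' = distr M (PiM I (\<lambda>_. borel)) X"
  have ne: "I \<noteq> {}" and one: "(1, 1) \<in> I"
    using assms(2,3) by (auto simp: I_def)
  have ind: "indep_vars (\<lambda>_. borel) (\<lambda>x. H (fst x) (snd x)) I"
    and law: "\<And>t i. (t, i) \<in> I \<Longrightarrow> distr M borel (H t i) = distr M borel h"
    using assms(4) by (auto simp: iid_copies_def I_def case_prod_unfold)
  have rv: "H (fst x) (snd x) \<in> borel_measurable M" if "x \<in> I" for x
    using ind that by (auto simp: indep_vars_def)
  have X: "X \<in> measurable M (PiM I (\<lambda>_. borel))"
    unfolding X_def using rv by (intro measurable_restrict) auto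
  interpret M': prob_space M'
    unfolding M'_def by (rule prob_space_distr[OF X])
  have coord: "(\<lambda>\<omega>. \<omega> x) \<in> borel_measurable M'" if "x \<in> I" for x
    using that by (simp add: M'_def measurable_component_singleton)
  have coord_law: "distr M' borel (\<lambda>\<omega>. \<omega> x) = distr M borel (H (fst x) (snd x))" if "x \<in> I" for x
    unfolding M'_def using that
    by (subst distr_distr[OF _ X]) (auto simp: measurable_component_singleton X_def o_def)
  have joint: "distr M' (PiM I (\<lambda>_. borel)) (\<lambda>\<omega>. \<lambda>x\<in>I. \<omega> x) = distr M (PiM I (\<lambda>_. borel)) X"
    unfolding M'_def
    by (subst distr_distr[OF _ X]) (auto simp: X_def o_def intro!: measurable_restrict measurable_component_singleton)
  have prod_law: "distr M (PiM I (\<lambda>_. borel)) X =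
      PiM I (\<lambda>x. distr M borel (H (fst x) (snd x)))"
    using ind rv unfolding X_def by (subst (asm) indep_vars_iff_distr_eq_PiM'[OF ne]) auto
  have "M'.indep_vars (\<lambda>_. borel) (\<lambda>x \<omega>. \<omega> x) I"
  proof (subst M'.indep_vars_iff_distr_eq_PiM'[OF ne])
    show "(\<lambda>\<omega>. \<omega> x) \<in> borel_measurable M'" if "x \<in> I" for x
      using coord[OF that] .
    show "distr M' (PiM I (\<lambda>_. borel)) (\<lambda>\<omega>. \<lambda>x\<in>I. \<omega> x) = PiM I (\<lambda>x. distr M' borel (\<lambda>\<omega>. \<omega> x))"
      unfolding joint prod_law by (intro PiM_cong) (simp_all add: coord_law)
  qed
  then have "iid_copies M' (\<lambda>\<omega>. \<omega> (1, 1)) q m (\<lambda>t i \<omega>. \<omega> (t, i))"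
    using coord_law law one by (auto simp: iid_copies_def I_def case_prod_unfold)
  then show ?thesis
    using M'.prob_space_axioms coord[OF one] coord_law[OF one] law[OF one] joint
    by (intro exI[of _ M'] exI[of _ "\<lambda>\<omega>. \<omega> (1, 1)"] exI[of _ "\<lambda>t i \<omega>. \<omega> (t, i)"])
       (simp add: X_def)
qed

end

theory Submission
  imports Defs
begin

text \<open>
  The modes are integrated out one at a time, conditionally on the others. Integrating out mode
  \<open>t\<close> compares the expected norm of a random matrix \<open>\<Sum>k. h\<^sub>k B\<^sub>k\<close> with the norms of the two matrices
  obtained by stacking the \<open>B\<^sub>k\<close> vertically and horizontally, that is, by moving \<open>t\<close> to the rows or
  to the columns; after \<open>q\<close> steps only flattenings remain.

  Upper bound for one mode. For signs, it is the noncommutative Khintchine inequality, proved by the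
  moment recursion \<open>E tr X\<^sup>2\<^sup>r\<^sup>+\<^sup>2 \<le> 2 (2r + 1) v\<^sup>2 E tr X\<^sup>2\<^sup>r\<close> for a symmetric Rademacher sum \<open>X\<close>; rectangular
  matrices are reduced to symmetric ones by dilation. A subgaussian variable is dominated, in the
  convex order and up to a constant factor, by normalised sums of signs. In the \<open>L\<^sup>p\<close> case one
  symmetrises and applies the contraction principle with \<open>E max\<^sub>k |h\<^sub>k| \<le> m\<^sup>1\<^sup>/\<^sup>p \<parallel>h\<parallel>\<^sub>p\<close>, where
  \<open>m\<^sup>1\<^sup>/\<^sup>p \<le> e\<close> for \<open>p = max 1 (log m)\<close>.

  Lower bound for one mode. Testing against a unit vector reduces it to vector coefficients. There
  signs can be inserted at the cost of a factor 2, and the fourth moment gives the Khintchine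
  inequality in \<open>L\<^sup>1\<close>.
\<close>

text \<open>Two stability properties shape the reduction to one mode. A normalised sum of
  \<open>n\<close> signs multiplying \<open>B k\<close> amounts to \<open>n\<close> separate signs
  multiplying copies of \<open>B k / sqrt n\<close>, and this leaves the norms of both stackings
  unchanged; so the bound for signs passes to a subgaussian variable whatever the lengths of the
  sums. And convex Lipschitz functions stay convex and Lipschitz when a coordinate is integrated
  out, so that comparisons of laws on the line extend coordinate by coordinate, with measurability
  and integrability supplied by the Lipschitz bound. The two norms produced by a mode are still
  random as long as other modes remain, so their maximum is replaced by their sum; this costs a
  factor 2 per mode. The matrices met on the way have at most \<open>(d + m) ^ (q + 1)\<close> rows
  and as many columns, which is why the logarithm of the dimension costs only a factor depending on
  \<open>q\<close>.\<close>

section \<open>Euclidean and operator norms over finite index sets\<close>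

lemma L2_set_scale: "L2_set (\<lambda>i. a * f i) I = \<bar>a\<bar> * L2_set f I"
  by (simp add: L2_set_def power_mult_distrib real_sqrt_mult flip: sum_distrib_left)

lemma L2_set_power2: "(L2_set f I)\<^sup>2 = (\<Sum>i\<in>I. (f i)\<^sup>2)"
  by (simp add: L2_set_def sum_nonneg)

lemma cauchy_schwarz_sum:
  fixes f g :: "'i \<Rightarrow> real"
  shows "\<bar>\<Sum>i\<in>I. f i * g i\<bar> \<le> L2_set f I * L2_set g I"
proof -
  have "\<bar>\<Sum>i\<in>I. f i * g i\<bar> \<le> (\<Sum>i\<in>I. \<bar>f i\<bar> * \<bar>g i\<bar>)"
    using sum_abs[of "\<lambda>i. f i * g i" I] by (simp add: abs_mult)
  also have "\<dots> \<le> L2_set f I * L2_set g I" by (rule L2_set_mult_ineq)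
  finally show ?thesis .
qed

lemma L2_set_le_dual:
  assumes "0 \<le> b" and "\<And>u. L2_set u I \<le> 1 \<Longrightarrow> (\<Sum>i\<in>I. u i * f i) \<le> b"
  shows "L2_set f I \<le> b"
proof (cases "L2_set f I = 0")
  case False
  then have pos: "L2_set f I > 0" using L2_set_nonneg[of f I] by linarith
  define u where "u = (\<lambda>i. inverse (L2_set f I) * f i)"
  have "L2_set u I \<le> 1"
    unfolding u_def using pos by (simp only: L2_set_scale) simp
  then have "(\<Sum>i\<in>I. u i * f i) \<le> b" by (rule assms(2))
  moreover have "(\<Sum>i\<in>I. u i * f i) = inverse (L2_set f I) * (\<Sum>i\<in>I. (f i)\<^sup>2)"
    by (simp add: u_def sum_distrib_left power2_eq_square algebra_simps)
  moreover have "inverse (L2_set f I) * (\<Sum>i\<in>I. (f i)\<^sup>2) = L2_set f I"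
    by (simp only: L2_set_power2[symmetric]) (use pos in \<open>simp add: power2_eq_square\<close>)
  ultimately show ?thesis by simp
qed (use assms in simp)

lemma L2_set_eq_0_imp: "finite I \<Longrightarrow> L2_set f I = 0 \<Longrightarrow> i \<in> I \<Longrightarrow> f i = 0"
  by (simp add: L2_set_eq_0_iff)

lemma L2_set_matrix_bound:
  assumes "finite I" "finite J"
  shows "L2_set (\<lambda>r. \<Sum>c\<in>J. B r c * x c) I \<le> (\<Sum>r\<in>I. L2_set (B r) J) * L2_set x J"
proof -
  have "L2_set (\<lambda>r. \<Sum>c\<in>J. B r c * x c) I \<le> (\<Sum>r\<in>I. \<bar>\<Sum>c\<in>J. B r c * x c\<bar>)"
    by (rule L2_set_le_sum_abs)
  also have "\<dots> \<le> (\<Sum>r\<in>I. L2_set (B r) J * L2_set x J)"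
    by (intro sum_mono cauchy_schwarz_sum)
  finally show ?thesis by (simp add: sum_distrib_right)
qed

context
  fixes I :: "'r set" and J :: "'c set"
  assumes fin: "finite I" "finite J"
begin

lemma op_norm_bdd:
  "bdd_above ((\<lambda>x. L2_set (\<lambda>r. \<Sum>c\<in>J. B r c * x c) I) ` {x. L2_set x J \<le> 1})"
proof (rule bdd_aboveI2)
  fix x :: "'c \<Rightarrow> real" assume "x \<in> {x. L2_set x J \<le> 1}"
  then have "(\<Sum>r\<in>I. L2_set (B r) J) * L2_set x J \<le> (\<Sum>r\<in>I. L2_set (B r) J) * 1"
    by (intro mult_left_mono) (auto intro: sum_nonneg)
  then show "L2_set (\<lambda>r. \<Sum>c\<in>J. B r c * x c) I \<le> (\<Sum>r\<in>I. L2_set (B r) J)"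
    using L2_set_matrix_bound[OF fin, of B x] by simp
qed

lemma op_norm_upper1:
  "L2_set x J \<le> 1 \<Longrightarrow> L2_set (\<lambda>r. \<Sum>c\<in>J. B r c * x c) I \<le> op_norm I J B"
  unfolding op_norm_def by (rule cSUP_upper) (auto intro: op_norm_bdd)

lemma op_norm_nonneg: "0 \<le> op_norm I J B"
proof -
  have "L2_set (\<lambda>r. \<Sum>c\<in>J. B r c * 0) I \<le> op_norm I J B"
    by (rule op_norm_upper1) (simp add: L2_set_def)
  then show ?thesis by (simp add: L2_set_def)
qed

lemma op_norm_upper:
  "L2_set (\<lambda>r. \<Sum>c\<in>J. B r c * x c) I \<le> op_norm I J B * L2_set x J"
proof (cases "L2_set x J = 0")
  case True
  then have "\<And>c. c \<in> J \<Longrightarrow> x c = 0" using L2_set_eq_0_imp[OF fin(2)] by blast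
  then show ?thesis using True by (simp add: L2_set_def)
next
  case False
  then have pos: "L2_set x J > 0" using L2_set_nonneg[of x J] by linarith
  define y where "y = (\<lambda>i. inverse (L2_set x J) * x i)"
  have "L2_set (\<lambda>r. \<Sum>c\<in>J. B r c * y c) I \<le> op_norm I J B"
    by (rule op_norm_upper1) (use pos in \<open>simp add: y_def L2_set_scale\<close>)
  also have "(\<lambda>r. \<Sum>c\<in>J. B r c * y c) = (\<lambda>r. inverse (L2_set x J) * (\<Sum>c\<in>J. B r c * x c))"
    by (simp add: y_def sum_distrib_left algebra_simps)
  also have "L2_set \<dots> I = inverse (L2_set x J) * L2_set (\<lambda>r. \<Sum>c\<in>J. B r c * x c) I"
    using pos by (simp only: L2_set_scale) simp
  finally show ?thesis using pos by (simp add: field_simps)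
qed

lemma op_norm_bilinear_upper:
  "(\<Sum>r\<in>I. u r * (\<Sum>c\<in>J. B r c * x c)) \<le> op_norm I J B * L2_set u I * L2_set x J"
proof -
  have "(\<Sum>r\<in>I. u r * (\<Sum>c\<in>J. B r c * x c)) \<le> L2_set u I * L2_set (\<lambda>r. \<Sum>c\<in>J. B r c * x c) I"
    using cauchy_schwarz_sum[of u] by (rule order_trans[OF abs_ge_self])
  also have "\<dots> \<le> L2_set u I * (op_norm I J B * L2_set x J)"
    by (intro mult_left_mono op_norm_upper) simp
  finally show ?thesis by (simp add: mult_ac)
qed

lemma op_norm_least:
  assumes "\<And>x. L2_set x J \<le> 1 \<Longrightarrow> L2_set (\<lambda>r. \<Sum>c\<in>J. B r c * x c) I \<le> b"
  shows "op_norm I J B \<le> b"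
  unfolding op_norm_def
proof (rule cSUP_least)
  show "{x. L2_set x J \<le> 1} \<noteq> {}"
    by (rule ex_in_conv[THEN iffD1], rule exI[of _ "\<lambda>_. 0"]) (simp add: L2_set_def)
qed (use assms in auto)

lemma op_norm_least_bilinear:
  assumes "0 \<le> b" and "\<And>u x. \<lbrakk>L2_set u I \<le> 1; L2_set x J \<le> 1\<rbrakk>
      \<Longrightarrow> (\<Sum>r\<in>I. u r * (\<Sum>c\<in>J. B r c * x c)) \<le> b"
  shows "op_norm I J B \<le> b"
  by (rule op_norm_least, rule L2_set_le_dual) (use assms in auto)

lemma op_norm_triangle:
  "op_norm I J (\<lambda>r c. B r c + B' r c) \<le> op_norm I J B + op_norm I J B'"
proof (rule op_norm_least)
  fix x assume x: "L2_set x J \<le> 1"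
  have "L2_set (\<lambda>r. \<Sum>c\<in>J. (B r c + B' r c) * x c) I
      = L2_set (\<lambda>r. (\<Sum>c\<in>J. B r c * x c) + (\<Sum>c\<in>J. B' r c * x c)) I"
    by (simp add: algebra_simps sum.distrib)
  also have "\<dots> \<le> L2_set (\<lambda>r. \<Sum>c\<in>J. B r c * x c) I + L2_set (\<lambda>r. \<Sum>c\<in>J. B' r c * x c) I"
    by (rule L2_set_triangle_ineq)
  finally show "L2_set (\<lambda>r. \<Sum>c\<in>J. (B r c + B' r c) * x c) I \<le> op_norm I J B + op_norm I J B'"
    using op_norm_upper1[OF x, of B] op_norm_upper1[OF x, of B'] by linarith
qed

lemma op_norm_scale_le: "op_norm I J (\<lambda>r c. a * B r c) \<le> \<bar>a\<bar> * op_norm I J B"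
proof (rule op_norm_least)
  fix x assume x: "L2_set x J \<le> 1"
  have "L2_set (\<lambda>r. \<Sum>c\<in>J. a * B r c * x c) I = \<bar>a\<bar> * L2_set (\<lambda>r. \<Sum>c\<in>J. B r c * x c) I"
    by (subst L2_set_scale[symmetric]) (simp add: sum_distrib_left mult_ac)
  then show "L2_set (\<lambda>r. \<Sum>c\<in>J. a * B r c * x c) I \<le> \<bar>a\<bar> * op_norm I J B"
    using op_norm_upper1[OF x, of B] by (simp add: mult_left_mono)
qed

end

lemma op_norm_cong:
  assumes "\<And>r c. r \<in> I \<Longrightarrow> c \<in> J \<Longrightarrow> B r c = B' r c"
  shows "op_norm I J B = op_norm I J B'"
proof -
  have "(\<lambda>x. L2_set (\<lambda>r. \<Sum>c\<in>J. B r c * x c) I) = (\<lambda>x. L2_set (\<lambda>r. \<Sum>c\<in>J. B' r c * x c) I)"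
    by (intro ext L2_set_cong refl sum.cong) (simp_all add: assms)
  then show ?thesis unfolding op_norm_def by (simp only:)
qed

lemma op_norm_transpose_le:
  assumes "finite I" "finite J"
  shows "op_norm J I (\<lambda>c r. B r c) \<le> op_norm I J B"
proof (rule op_norm_least_bilinear[OF assms(2,1)])
  fix u x assume ux: "L2_set u J \<le> 1" "L2_set x I \<le> 1"
  have "(\<Sum>c\<in>J. u c * (\<Sum>r\<in>I. B r c * x r)) = (\<Sum>r\<in>I. x r * (\<Sum>c\<in>J. B r c * u c))"
    by (simp add: sum_distrib_left mult_ac) (rule sum.swap)
  also have "\<dots> \<le> op_norm I J B * L2_set x I * L2_set u J"
    by (rule op_norm_bilinear_upper[OF assms])
  also have "\<dots> \<le> op_norm I J B * 1 * 1"
    using ux op_norm_nonneg[OF assms] by (intro mult_mono) auto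
  finally show "(\<Sum>c\<in>J. u c * (\<Sum>r\<in>I. B r c * x r)) \<le> op_norm I J B" by simp
qed (rule op_norm_nonneg[OF assms])

lemma op_norm_transpose:
  assumes "finite I" "finite J"
  shows "op_norm J I (\<lambda>c r. B r c) = op_norm I J B"
  using op_norm_transpose_le[OF assms, of B] op_norm_transpose_le[OF assms(2,1), of "\<lambda>c r. B r c"]
  by simp

subsection \<open>Trace moments of symmetric matrices\<close>

text \<open>The outer indices have types of their own, so that the product also acts on a vector
  written as a matrix with a single column.\<close>

definition mat_mult :: "'n set \<Rightarrow> ('a \<Rightarrow> 'n \<Rightarrow> real) \<Rightarrow> ('n \<Rightarrow> 'b \<Rightarrow> real) \<Rightarrow> 'a \<Rightarrow> 'b \<Rightarrow> real" where
  "mat_mult N X Y a b = (\<Sum>c\<in>N. X a c * Y c b)"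

text \<open>The Hilbert-Schmidt inner product, that is, the trace of \<open>U^T V\<close>. Traces
  occur only in this form.\<close>

definition frob :: "'a set \<Rightarrow> 'b set \<Rightarrow> ('a \<Rightarrow> 'b \<Rightarrow> real) \<Rightarrow> ('a \<Rightarrow> 'b \<Rightarrow> real) \<Rightarrow> real" where
  "frob A B U V = (\<Sum>a\<in>A. \<Sum>b\<in>B. U a b * V a b)"

definition unit_mat :: "'n \<Rightarrow> 'n \<Rightarrow> real" where
  "unit_mat a b = (if a = b then 1 else 0)"

text \<open>\<open>unit_mat\<close> is the identity on the whole index type and not only on
  \<open>N\<close>. Matrices that vanish outside \<open>N\<close> make
  \<open>mat_mult N X unit_mat = X\<close> an equation between functions, which can be used for
  rewriting.\<close>

definition supported :: "'n set \<Rightarrow> ('n \<Rightarrow> 'n \<Rightarrow> real) \<Rightarrow> bool" where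
  "supported N X \<longleftrightarrow> (\<forall>a b. X a b \<noteq> 0 \<longrightarrow> a \<in> N \<and> b \<in> N)"

definition symmetric :: "('n \<Rightarrow> 'n \<Rightarrow> real) \<Rightarrow> bool" where
  "symmetric X \<longleftrightarrow> (\<forall>a b. X a b = X b a)"

lemma mat_mult_assoc: "mat_mult N (mat_mult M X Y) Z = mat_mult M X (mat_mult N Y Z)"
proof (intro ext)
  fix a b
  have "mat_mult N (mat_mult M X Y) Z a b = (\<Sum>c\<in>N. \<Sum>d\<in>M. X a d * Y d c * Z c b)"
    by (simp add: mat_mult_def sum_distrib_right)
  also have "\<dots> = (\<Sum>d\<in>M. \<Sum>c\<in>N. X a d * Y d c * Z c b)" by (rule sum.swap)
  also have "\<dots> = mat_mult M X (mat_mult N Y Z) a b"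
    by (simp add: mat_mult_def sum_distrib_left mult.assoc)
  finally show "mat_mult N (mat_mult M X Y) Z a b = mat_mult M X (mat_mult N Y Z) a b" .
qed

lemma frob_sum_right: "frob A B U (\<lambda>a b. \<Sum>k\<in>K. V k a b) = (\<Sum>k\<in>K. frob A B U (V k))"
proof -
  have "frob A B U (\<lambda>a b. \<Sum>k\<in>K. V k a b) = (\<Sum>a\<in>A. \<Sum>k\<in>K. \<Sum>b\<in>B. U a b * V k a b)"
    unfolding frob_def sum_distrib_left by (intro sum.cong refl sum.swap)
  also have "\<dots> = (\<Sum>k\<in>K. frob A B U (V k))"
    unfolding frob_def by (rule sum.swap)
  finally show ?thesis .
qed

lemma frob_commute: "frob A B U V = frob A B V U"
  by (simp add: frob_def mult.commute)

lemma frob_scale_right: "frob A B U (\<lambda>a b. c * V a b) = c * frob A B U V"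
  by (simp add: frob_def sum_distrib_left mult_ac)

lemma frob_diff_right: "frob A B U (\<lambda>a b. V a b - W a b) = frob A B U V - frob A B U W"
  by (simp add: frob_def sum_subtractf right_diff_distrib)

lemma frob_transpose: "frob B A (\<lambda>b a. U a b) (\<lambda>b a. V a b) = frob A B U V"
  unfolding frob_def by (rule sum.swap)

lemma frob_nonneg: "0 \<le> frob A B U U"
  by (simp add: frob_def sum_nonneg)

lemma frob_cauchy_schwarz: "(frob A B U V)\<^sup>2 \<le> frob A B U U * frob A B V V"
proof -
  have prod: "frob A B U V = (\<Sum>x\<in>A \<times> B. case_prod U x * case_prod V x)" for U V
    by (simp add: frob_def sum.cartesian_product case_prod_unfold)
  have "\<bar>frob A B U V\<bar>\<^sup>2 \<le> (L2_set (case_prod U) (A \<times> B) * L2_set (case_prod V) (A \<times> B))\<^sup>2"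
    unfolding prod by (intro power_mono cauchy_schwarz_sum) simp
  also have "\<dots> = frob A B U U * frob A B V V"
    unfolding power_mult_distrib L2_set_power2 by (simp add: prod power2_eq_square)
  finally show ?thesis by simp
qed

lemma frob_mult_left:
  assumes "symmetric X"
  shows "frob N B (mat_mult N X U) V = frob N B U (mat_mult N X V)"
proof -
  have "frob N B (mat_mult N X U) V = (\<Sum>a\<in>N. \<Sum>b\<in>B. \<Sum>c\<in>N. X a c * U c b * V a b)"
    by (simp add: frob_def mat_mult_def sum_distrib_right)
  also have "\<dots> = (\<Sum>a\<in>N. \<Sum>c\<in>N. \<Sum>b\<in>B. X a c * U c b * V a b)"
    by (intro sum.cong refl sum.swap)
  also have "\<dots> = (\<Sum>c\<in>N. \<Sum>a\<in>N. \<Sum>b\<in>B. X a c * U c b * V a b)" by (rule sum.swap)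
  also have "\<dots> = (\<Sum>c\<in>N. \<Sum>b\<in>B. \<Sum>a\<in>N. X a c * U c b * V a b)"
    by (intro sum.cong refl sum.swap)
  also have "\<dots> = frob N B U (mat_mult N X V)"
  proof -
    have X: "X a c = X c a" for a c using assms by (simp add: symmetric_def)
    have "X a c * U c b * V a b = U c b * (X c a * V a b)" for a b c
      using X[of a c] by simp
    then show ?thesis
      unfolding frob_def mat_mult_def sum_distrib_left by (intro sum.cong refl)
  qed
  finally show ?thesis .
qed

lemma mat_mult_transpose: "(\<lambda>b a. mat_mult N U Y a b) = mat_mult N (\<lambda>b c. Y c b) (\<lambda>c a. U a c)"
  by (simp add: mat_mult_def fun_eq_iff mult.commute)

lemma frob_mult_right:
  assumes "symmetric Y"
  shows "frob A N (mat_mult N U Y) V = frob A N U (mat_mult N V Y)"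
proof -
  have Y: "(\<lambda>b c. Y c b) = Y" using assms by (auto simp: symmetric_def fun_eq_iff)
  have "frob A N (mat_mult N U Y) V = frob N A (mat_mult N Y (\<lambda>c a. U a c)) (\<lambda>b a. V a b)"
    by (subst frob_transpose[symmetric]) (simp add: mat_mult_transpose Y)
  also have "\<dots> = frob N A (\<lambda>c a. U a c) (\<lambda>b a. mat_mult N V Y a b)"
    by (subst frob_mult_left[OF assms]) (simp add: mat_mult_transpose Y)
  also have "\<dots> = frob A N U (mat_mult N V Y)" by (rule frob_transpose)
  finally show ?thesis .
qed

lemma frob_mult_le: "finite N \<Longrightarrow> frob A B (mat_mult N M U) (mat_mult N M U) \<le> frob A N M M * frob N B U U"
proof -
  assume "finite N"
  have "(mat_mult N M U a b)\<^sup>2 \<le> (\<Sum>c\<in>N. (M a c)\<^sup>2) * (\<Sum>c\<in>N. (U c b)\<^sup>2)" for a b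
  proof -
    have "\<bar>mat_mult N M U a b\<bar>\<^sup>2 \<le> (L2_set (M a) N * L2_set (\<lambda>c. U c b) N)\<^sup>2"
      unfolding mat_mult_def by (intro power_mono cauchy_schwarz_sum) simp
    then show ?thesis by (simp add: power_mult_distrib L2_set_power2)
  qed
  then have "frob A B (mat_mult N M U) (mat_mult N M U)
      \<le> (\<Sum>a\<in>A. \<Sum>b\<in>B. (\<Sum>c\<in>N. (M a c)\<^sup>2) * (\<Sum>c\<in>N. (U c b)\<^sup>2))"
    unfolding frob_def power2_eq_square[symmetric] by (intro sum_mono)
  also have "\<dots> = (\<Sum>a\<in>A. \<Sum>c\<in>N. (M a c)\<^sup>2) * (\<Sum>b\<in>B. \<Sum>c\<in>N. (U c b)\<^sup>2)"
    by (simp add: sum_product)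
  also have "(\<Sum>b\<in>B. \<Sum>c\<in>N. (U c b)\<^sup>2) = frob N B U U"
    unfolding frob_def power2_eq_square by (rule sum.swap)
  finally show ?thesis by (simp add: frob_def power2_eq_square)
qed

lemma funpow_commute_ops:
  assumes "\<And>x. f (g x) = g (f x)"
  shows "(f ^^ m) ((g ^^ n) x) = (g ^^ n) ((f ^^ m) x)"
proof -
  have "(f ^^ m) (g x) = g ((f ^^ m) x)" for x m
    by (induction m) (simp_all add: assms)
  then show ?thesis by (induction n) simp_all
qed

text \<open>A log-convex sequence has its maximum at an end. Cauchy-Schwarz at neighbouring even
  places shows that an interior maximum is also attained one step to the left, so the leftmost one
  cannot be interior unless it is 0; an arbitrary term is bounded by two even ones. The maximum of
  the two ends is relaxed to their sum.\<close>

lemma log_convex_max: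
  fixes a :: "nat \<Rightarrow> real"
  assumes nonneg: "\<And>i. i \<le> r \<Longrightarrow> 0 \<le> a (2 * i)"
    and cs: "\<And>i j. i \<le> r \<Longrightarrow> j \<le> r \<Longrightarrow> (a (i + j))\<^sup>2 \<le> a (2 * i) * a (2 * j)"
    and k: "k \<le> 2 * r"
  shows "a k \<le> a 0 + a (2 * r)"
proof -
  define M where "M = Max ((\<lambda>i. a (2 * i)) ` {..r})"
  have le_M: "a (2 * i) \<le> M" if "i \<le> r" for i
    unfolding M_def using that by (intro Max_ge) auto
  have "M \<in> (\<lambda>i. a (2 * i)) ` {..r}" unfolding M_def by (intro Max_in) auto
  then have ex: "\<exists>i. i \<le> r \<and> a (2 * i) = M" by auto
  define i where "i = (LEAST i. i \<le> r \<and> a (2 * i) = M)"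
  have i: "i \<le> r" "a (2 * i) = M" using LeastI_ex[OF ex] by (auto simp: i_def)
  have M0: "0 \<le> M" using nonneg[OF i(1)] i(2) by simp
  have "M \<le> a 0 + a (2 * r)"
  proof (cases "i = 0 \<or> i = r \<or> M = 0")
    case True
    then show ?thesis using i nonneg[of 0] nonneg[of r] by auto
  next
    case False
    then have ir: "0 < i" "i < r" "0 < M" using i M0 by auto
    have "(a ((i - 1) + (i + 1)))\<^sup>2 \<le> a (2 * (i - 1)) * a (2 * (i + 1))"
      using ir by (intro cs) auto
    also have "(i - 1) + (i + 1) = 2 * i" using ir by simp
    also have "a (2 * (i - 1)) * a (2 * (i + 1)) \<le> a (2 * (i - 1)) * M"
      using ir by (intro mult_left_mono le_M nonneg) auto
    finally have "M * M \<le> a (2 * (i - 1)) * M" using i by (simp add: power2_eq_square)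
    then have "M \<le> a (2 * (i - 1))" using ir by simp
    then have "a (2 * (i - 1)) = M" using le_M[of "i - 1"] ir by simp
    then have "i \<le> i - 1" unfolding i_def using ir by (intro Least_le) (auto simp: i_def)
    then show ?thesis using ir by simp
  qed
  moreover have "a k \<le> M"
  proof -
    obtain i j where ij: "k = i + j" "i \<le> r" "j \<le> r"
      using k by (intro that[of "min k r" "k - min k r"]) auto
    have "(a k)\<^sup>2 \<le> M\<^sup>2"
      using cs[OF ij(2,3)] mult_mono[OF le_M[OF ij(2)] le_M[OF ij(3)] M0 nonneg[OF ij(3)]]
      by (simp add: ij(1) power2_eq_square)
    then show ?thesis using M0 by (rule power2_le_imp_le)
  qed
  ultimately show ?thesis by simp
qed

text \<open>Powers are iterates of left and right multiplication. These two operators commute, and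
  each is self-adjoint for \<open>frob\<close> if its matrix is symmetric; applied to
  \<open>unit_mat\<close> they give the powers themselves.\<close>

abbreviation left_pow :: "'n set \<Rightarrow> ('n \<Rightarrow> 'n \<Rightarrow> real) \<Rightarrow> nat \<Rightarrow> ('n \<Rightarrow> 'b \<Rightarrow> real) \<Rightarrow> ('n \<Rightarrow> 'b \<Rightarrow> real)" where
  "left_pow N X k \<equiv> (mat_mult N X ^^ k)"

abbreviation right_pow :: "'n set \<Rightarrow> ('n \<Rightarrow> 'n \<Rightarrow> real) \<Rightarrow> nat \<Rightarrow> ('a \<Rightarrow> 'n \<Rightarrow> real) \<Rightarrow> ('a \<Rightarrow> 'n \<Rightarrow> real)" where
  "right_pow N Y k \<equiv> ((\<lambda>U. mat_mult N U Y) ^^ k)"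

lemma left_right_pow_commute:
  "left_pow N X j (right_pow N Y k U) = right_pow N Y k (left_pow N X j U)"
  by (rule funpow_commute_ops) (simp add: mat_mult_assoc)

lemma frob_left_pow:
  assumes "symmetric X"
  shows "frob N B (left_pow N X k U) V = frob N B U (left_pow N X k V)"
proof (induction k arbitrary: V)
  case (Suc k)
  have "frob N B (left_pow N X (Suc k) U) V = frob N B (left_pow N X k U) (mat_mult N X V)"
    by (simp add: frob_mult_left[OF assms])
  also have "\<dots> = frob N B U (left_pow N X k (mat_mult N X V))" by (rule Suc)
  finally show ?case by (simp only: funpow_Suc_right o_apply)
qed simp

lemma frob_right_pow:
  assumes "symmetric Y"
  shows "frob A N (right_pow N Y k U) V = frob A N U (right_pow N Y k V)"
proof (induction k arbitrary: V)
  case (Suc k)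
  have "frob A N (right_pow N Y (Suc k) U) V = frob A N (right_pow N Y k U) (mat_mult N V Y)"
    by (simp add: frob_mult_right[OF assms])
  also have "\<dots> = frob A N U (right_pow N Y k (mat_mult N V Y))" by (rule Suc)
  finally show ?case by (simp only: funpow_Suc_right o_apply)
qed simp

text \<open>The spectral theorem is replaced by log-convexity of the mixed moments in the exponent.\<close>

lemma frob_mixed_power_le:
  assumes X: "symmetric X" and Y: "symmetric Y" and k: "k \<le> 2 * r"
  shows "frob N N S (left_pow N X k (right_pow N Y (2 * r - k) S))
    \<le> frob N N (right_pow N Y r S) (right_pow N Y r S) + frob N N (left_pow N X r S) (left_pow N X r S)"
proof -
  define a where "a k = frob N N S (left_pow N X k (right_pow N Y (2 * r - k) S))" for k
  \<comment> \<open>Each mixed moment is an inner product of two such matrices. By self-adjointness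
    and commutation it depends on \<open>i + j\<close> only, which is the form that
    \<open>log_convex_max\<close> asks for.\<close>
  define W where "W i = left_pow N X i (right_pow N Y (r - i) S)" for i
  have a: "a (i + j) = frob N N (W i) (W j)" if "i \<le> r" "j \<le> r" for i j
  proof -
    have "frob N N (W i) (W j) = frob N N S (right_pow N Y (r - i) (left_pow N X i (W j)))"
      by (simp add: W_def frob_left_pow[OF X] frob_right_pow[OF Y])
    also have "right_pow N Y (r - i) (left_pow N X i (W j))
        = left_pow N X i (left_pow N X j (right_pow N Y (r - i) (right_pow N Y (r - j) S)))"
      by (simp add: W_def left_right_pow_commute)
    also have "\<dots> = left_pow N X (i + j) (right_pow N Y ((r - i) + (r - j)) S)"
      by (simp only: funpow_add o_apply)
    also have "(r - i) + (r - j) = 2 * r - (i + j)" using that by simp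
    finally show ?thesis by (simp add: a_def)
  qed
  have "a k \<le> a 0 + a (2 * r)"
  proof (rule log_convex_max[OF _ _ k])
    show "0 \<le> a (2 * i)" if "i \<le> r" for i
      using a[OF that that] frob_nonneg[of N N "W i"] by (simp add: mult_2)
    show "(a (i + j))\<^sup>2 \<le> a (2 * i) * a (2 * j)" if "i \<le> r" "j \<le> r" for i j
      using a[OF that] a[OF that(1,1)] a[OF that(2,2)] frob_cauchy_schwarz[of N N "W i" "W j"]
      by (simp add: mult_2)
  qed
  moreover have "a 0 = frob N N (W 0) (W 0)" "a (2 * r) = frob N N (W r) (W r)"
    using a[of 0 0] a[of r r] by (simp_all add: mult_2)
  ultimately show ?thesis by (simp add: a_def W_def)
qed

text \<open>For a symmetric \<open>X\<close> supported in \<open>N\<close> this is the trace of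
  \<open>X\<close> to the power \<open>2 p\<close>; as a squared Hilbert-Schmidt norm it is visibly
  nonnegative.\<close>

definition trace_moment :: "'n set \<Rightarrow> nat \<Rightarrow> ('n \<Rightarrow> 'n \<Rightarrow> real) \<Rightarrow> real" where
  "trace_moment N p X = frob N N (left_pow N X p unit_mat) (left_pow N X p unit_mat)"

lemma trace_moment_nonneg: "0 \<le> trace_moment N p X"
  unfolding trace_moment_def by (rule frob_nonneg)

lemma trace_moment_0: "finite N \<Longrightarrow> trace_moment N 0 X = real (card N)"
proof -
  assume "finite N"
  then have "(\<Sum>b\<in>N. unit_mat a b * unit_mat a b) = (1::real)" if "a \<in> N" for a
    using that sum.delta[of N a "\<lambda>_. 1::real"] by (simp add: unit_mat_def if_distrib cong: if_cong)
  then show ?thesis by (simp add: trace_moment_def frob_def)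
qed

lemma mat_mult_unit_right:
  assumes "finite N" "supported N X"
  shows "mat_mult N X unit_mat = X"
proof (intro ext)
  fix a b
  have "mat_mult N X unit_mat a b = (\<Sum>c\<in>N. if c = b then X a b else 0)"
    unfolding mat_mult_def unit_mat_def by (intro sum.cong) auto
  then show "mat_mult N X unit_mat a b = X a b"
    using assms by (auto simp: supported_def)
qed

lemma mat_mult_unit_left:
  assumes "finite N" "supported N X"
  shows "mat_mult N unit_mat X = X"
proof (intro ext)
  fix a b
  have "mat_mult N unit_mat X a b = (\<Sum>c\<in>N. if a = c then X a b else 0)"
    unfolding mat_mult_def unit_mat_def by (intro sum.cong) auto
  then show "mat_mult N unit_mat X a b = X a b"
    using assms by (auto simp: supported_def)
qed

lemma left_pow_unit_eq_right_pow:
  assumes "finite N" "supported N X"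
  shows "left_pow N X n unit_mat = right_pow N X n unit_mat"
proof (induction n)
  case (Suc n)
  have "left_pow N X (Suc n) unit_mat = left_pow N X 1 (right_pow N X n unit_mat)"
    by (simp add: Suc)
  also have "\<dots> = right_pow N X n (left_pow N X 1 unit_mat)"
    by (rule left_right_pow_commute)
  also have "left_pow N X 1 unit_mat = right_pow N X 1 unit_mat"
    by (simp add: mat_mult_unit_left[OF assms] mat_mult_unit_right[OF assms])
  also have "right_pow N X n \<dots> = right_pow N X (Suc n) unit_mat"
    by (simp only: funpow_Suc_right o_apply One_nat_def funpow.simps id_apply)
  finally show ?case .
qed simp

lemma left_pow_scale: "left_pow N X k (\<lambda>a b. c * V a b) = (\<lambda>a b. c * left_pow N X k V a b)"
  by (induction k) (simp_all add: mat_mult_def sum_distrib_left mult_ac)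

lemma right_pow_scale: "right_pow N X k (\<lambda>a b. c * V a b) = (\<lambda>a b. c * right_pow N X k V a b)"
  by (induction k) (simp_all add: mat_mult_def sum_distrib_left mult_ac)

lemma left_pow_diff:
  "left_pow N X k (\<lambda>a b. U a b - V a b) = (\<lambda>a b. left_pow N X k U a b - left_pow N X k V a b)"
  by (induction k) (simp_all add: mat_mult_def right_diff_distrib sum_subtractf)

lemma right_pow_diff:
  "right_pow N X k (\<lambda>a b. U a b - V a b) = (\<lambda>a b. right_pow N X k U a b - right_pow N X k V a b)"
  by (induction k) (simp_all add: mat_mult_def left_diff_distrib sum_subtractf)

text \<open>Telescoping without commutativity: one factor after the other is switched from
  \<open>Y\<close> to \<open>X\<close>.\<close>

lemma power_difference:
  assumes fin: "finite N" and X: "supported N X" and Y: "supported N Y"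
    and D: "\<And>a b. X a b - Y a b = D a b"
  shows "left_pow N X n unit_mat a b - left_pow N Y n unit_mat a b
    = (\<Sum>k<n. left_pow N X k (right_pow N Y (n - 1 - k) D) a b)"
proof -
  define f where "f k = left_pow N X k (right_pow N Y (n - k) unit_mat) a b" for k
  have step: "f (Suc k) - f k = left_pow N X k (right_pow N Y (n - 1 - k) D) a b" if "k < n" for k
  proof -
    have D': "D = (\<lambda>a b. X a b - Y a b)" using D by auto
    have 1: "f (Suc k) = left_pow N X k (right_pow N Y (n - 1 - k) X) a b"
    proof -
      have "f (Suc k) = right_pow N Y (n - Suc k) (left_pow N X k (mat_mult N X unit_mat)) a b"
        unfolding f_def left_right_pow_commute[where j = "Suc k"] by (simp only: funpow_Suc_right o_apply)
      then show ?thesis by (simp add: mat_mult_unit_right[OF fin X] left_right_pow_commute)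
    qed
    have 2: "f k = left_pow N X k (right_pow N Y (n - 1 - k) Y) a b"
    proof -
      have "n - k = Suc (n - 1 - k)" using that by simp
      then have "f k = left_pow N X k (right_pow N Y (n - 1 - k) (mat_mult N unit_mat Y)) a b"
        unfolding f_def by (simp only: funpow_Suc_right o_apply)
      then show ?thesis by (simp add: mat_mult_unit_left[OF fin Y])
    qed
    show ?thesis unfolding 1 2 D' by (simp add: right_pow_diff left_pow_diff)
  qed
  have "(\<Sum>k<n. left_pow N X k (right_pow N Y (n - 1 - k) D) a b) = (\<Sum>k<n. f (Suc k) - f k)"
    by (intro sum.cong refl step[symmetric]) simp
  also have "\<dots> = f n - f 0" by (rule sum_lessThan_telescope)
  finally show ?thesis
    by (simp add: f_def left_pow_unit_eq_right_pow[OF fin Y])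
qed

text \<open>Brings \<open>S X^r\<close> into the shape of \<open>S\<close> applied to a matrix, to
  which a bound on the sum of the squares of several \<open>S\<close> applies.\<close>

lemma right_pow_eq_mult:
  assumes "finite N" "supported N S" "supported N X"
  shows "right_pow N X r S = mat_mult N S (left_pow N X r unit_mat)"
proof -
  have "mat_mult N S (left_pow N X r unit_mat) = left_pow N S 1 (right_pow N X r unit_mat)"
    by (simp add: left_pow_unit_eq_right_pow[OF assms(1,3)])
  also have "\<dots> = right_pow N X r S"
    by (simp only: left_right_pow_commute) (simp add: mat_mult_unit_right[OF assms(1,2)])
  finally show ?thesis ..
qed

lemma left_pow_transpose:
  assumes "symmetric X"
  shows "(\<lambda>b a. left_pow N X r U a b) = right_pow N X r (\<lambda>b a. U a b)"
proof (induction r)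
  case (Suc r)
  have X: "(\<lambda>b c. X c b) = X" using assms by (auto simp: symmetric_def fun_eq_iff)
  have "(\<lambda>b a. left_pow N X (Suc r) U a b) = mat_mult N (\<lambda>b a. left_pow N X r U a b) X"
    by (simp add: mat_mult_transpose X)
  then show ?case by (simp add: Suc)
qed simp

text \<open>Transposition turns \<open>X^r S\<close> into \<open>S X^r\<close> and keeps the
  Hilbert-Schmidt norm. The two end terms of a mixed moment thereby become quantities of the same
  kind.\<close>

lemma frob_left_pow_eq_right_pow:
  assumes "symmetric X" "symmetric S"
  shows "frob N N (left_pow N X r S) (left_pow N X r S) = frob N N (right_pow N X r S) (right_pow N X r S)"
proof -
  have S: "(\<lambda>b a. S a b) = S" using assms(2) by (auto simp: symmetric_def fun_eq_iff)
  show ?thesis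
    by (subst frob_transpose[symmetric]) (simp add: left_pow_transpose[OF assms(1)] S)
qed

text \<open>Splits off a single factor \<open>X\<close>, which is linear in the signs when
  \<open>X\<close> is a Rademacher sum; the remaining power is odd.\<close>

lemma trace_moment_Suc:
  assumes "finite N" "supported N X" "symmetric X"
  shows "trace_moment N (Suc r) X = frob N N X (left_pow N X (2 * r + 1) unit_mat)"
proof -
  have "trace_moment N (Suc r) X = frob N N (left_pow N X r X) (left_pow N X (Suc r) unit_mat)"
    unfolding trace_moment_def funpow_Suc_right[of r] by (simp add: mat_mult_unit_right[OF assms(1,2)])
  also have "\<dots> = frob N N X (left_pow N X (r + Suc r) unit_mat)"
    by (simp only: frob_left_pow[OF assms(3)] funpow_add o_apply)
  finally show ?thesis by (simp add: mult_2)
qed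

text \<open>Log-convexity makes the ratios \<open>c (k + 1) / c k\<close> nondecreasing, so each of
  them is at least \<open>c 1 / c 0\<close>. The induction uses products in place of ratios because
  terms may vanish.\<close>

lemma log_convex_power_le:
  fixes c :: "nat \<Rightarrow> real"
  assumes "\<And>k. 0 \<le> c k" "c 0 \<le> 1" "\<And>k. (c (k + 1))\<^sup>2 \<le> c k * c (k + 2)" "p \<ge> 1"
  shows "c 1 ^ p \<le> c p"
proof -
  have ratio: "c 1 * c k \<le> c 0 * c (k + 1)" for k
  proof (induction k)
    case (Suc k)
    show ?case
    proof (cases "c k = 0")
      case True
      then have "c (k + 1) = 0" using assms(3)[of k] by simp
      then show ?thesis using assms(1) by simp
    next
      case False
      then have pos: "0 < c k" using assms(1)[of k] by linarith
      have "c k * (c 1 * c (k + 1)) \<le> c 0 * (c (k + 1))\<^sup>2"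
        using mult_right_mono[OF Suc assms(1)[of "k + 1"]] by (simp add: power2_eq_square mult_ac)
      also have "\<dots> \<le> c 0 * (c k * c (k + 2))"
        by (intro mult_left_mono assms)
      finally have "c k * (c 1 * c (k + 1)) \<le> c k * (c 0 * c (k + 2))" by (simp add: mult_ac)
      then show ?thesis using pos by simp
    qed
  qed simp
  have "c 1 ^ Suc n \<le> c (Suc n)" for n
  proof (induction n)
    case (Suc n)
    have "c 1 ^ Suc (Suc n) \<le> c 1 * c (Suc n)"
      using mult_left_mono[OF Suc assms(1)[of 1]] by simp
    also have "\<dots> \<le> c 0 * c (Suc (Suc n))" using ratio[of "Suc n"] by simp
    also have "\<dots> \<le> 1 * c (Suc (Suc n))" by (intro mult_right_mono assms)
    finally show ?case by simp
  qed simp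
  from this[of "p - 1"] show ?thesis using assms(4) by simp
qed

text \<open>The squared lengths of \<open>X^k x\<close> are log-convex in \<open>k\<close>. So for a
  vector \<open>x\<close> of length at most 1 the length of \<open>X x\<close> to the power
  \<open>2 p\<close> is at most the squared length of \<open>X^p x\<close>, and this is at most the
  squared Hilbert-Schmidt norm of \<open>X^p\<close>.\<close>

lemma symmetric_op_norm_power_le_trace_moment:
  assumes fin: "finite N" and sup: "supported N X" and sym: "symmetric X" and p: "p \<ge> 1"
  shows "op_norm N N X ^ (2 * p) \<le> trace_moment N p X"
proof -
  have bound: "(L2_set (\<lambda>r. \<Sum>c\<in>N. X r c * x c) N)\<^sup>2 ^ p \<le> trace_moment N p X"
    if x: "L2_set x N \<le> 1" for x
  proof -
    \<comment> \<open>The vector as a matrix with one column, set to zero outside \<open>N\<close>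
      so that multiplication by \<open>unit_mat\<close> returns the same function.\<close>
    define U where "U = (\<lambda>a (_ :: unit). if a \<in> N then x a else 0)"
    define c where "c k = frob N UNIV (left_pow N X k U) (left_pow N X k U)" for k
    have frob: "frob N UNIV V V = (L2_set (\<lambda>r. V r ()) N)\<^sup>2" for V
      by (simp only: frob_def L2_set_power2) (simp add: UNIV_unit power2_eq_square)
    have "L2_set (\<lambda>r. U r ()) N = L2_set x N"
      by (intro L2_set_cong) (auto simp: U_def)
    then have "c 0 \<le> 1" using power_mono[OF x, of 2] by (simp add: c_def frob)
    moreover have "(c (k + 1))\<^sup>2 \<le> c k * c (k + 2)" for k
    proof -
      have "c (k + 1) = frob N UNIV (left_pow N X k U) (left_pow N X (k + 2) U)"
        unfolding c_def by (simp add: frob_mult_left[OF sym])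
      then show ?thesis unfolding c_def by (simp only: frob_cauchy_schwarz)
    qed
    ultimately have "c 1 ^ p \<le> c p"
      by (intro log_convex_power_le[OF _ _ _ p]) (auto simp: c_def frob_nonneg)
    also have "c p \<le> trace_moment N p X * 1"
    proof -
      have U: "mat_mult N unit_mat U = U"
      proof (intro ext)
        fix a b
        have "mat_mult N unit_mat U a b = (\<Sum>c\<in>N. if a = c then U a b else 0)"
          unfolding mat_mult_def unit_mat_def by (intro sum.cong) auto
        then show "mat_mult N unit_mat U a b = U a b"
          using fin by (auto simp: U_def)
      qed
      have "left_pow N X k U = mat_mult N (left_pow N X k unit_mat) U" for k
        by (induction k) (simp_all add: U mat_mult_assoc)
      then have "c p \<le> trace_moment N p X * c 0"
        unfolding c_def trace_moment_def using frob_mult_le[OF fin] by simp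
      also have "\<dots> \<le> trace_moment N p X * 1"
        using \<open>c 0 \<le> 1\<close> by (intro mult_left_mono trace_moment_nonneg)
      finally show ?thesis .
    qed
    also have "c 1 = (L2_set (\<lambda>r. \<Sum>c\<in>N. X r c * x c) N)\<^sup>2"
      unfolding c_def frob by (simp add: mat_mult_def U_def cong: sum.cong)
    finally show ?thesis by simp
  qed
  have "op_norm N N X \<le> root (2 * p) (trace_moment N p X)"
  proof (rule op_norm_least[OF fin fin])
    fix x assume "L2_set x N \<le> 1"
    then have "L2_set (\<lambda>r. \<Sum>c\<in>N. X r c * x c) N ^ (2 * p) \<le> trace_moment N p X"
      using bound[of x] by (simp add: power_mult)
    then have "root (2 * p) (L2_set (\<lambda>r. \<Sum>c\<in>N. X r c * x c) N ^ (2 * p)) \<le> root (2 * p) (trace_moment N p X)"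
      using p by (intro real_root_le_mono) auto
    then show "L2_set (\<lambda>r. \<Sum>c\<in>N. X r c * x c) N \<le> root (2 * p) (trace_moment N p X)"
      using p by (simp add: real_root_power_cancel)
  qed
  then have "op_norm N N X ^ (2 * p) \<le> root (2 * p) (trace_moment N p X) ^ (2 * p)"
    by (intro power_mono op_norm_nonneg fin)
  then show ?thesis using p trace_moment_nonneg[of N p X] by simp
qed

subsection \<open>Rademacher averages\<close>

text \<open>The expectation over independent signs, as a finite average: the index set can change
  from one use to the next and no integrability is at stake.\<close>

definition rad :: "'k set \<Rightarrow> (('k \<Rightarrow> real) \<Rightarrow> real) \<Rightarrow> real" where
  "rad K f = (\<Sum>s\<in>PiE K (\<lambda>_. {- 1, 1}). f s) / 2 ^ card K"

lemma finite_signs: "finite K \<Longrightarrow> finite (PiE K (\<lambda>_. {- 1, 1 :: real}))"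
  by (rule finite_PiE) auto

lemma rad_empty: "rad {} f = f (\<lambda>_. undefined)"
  by (simp add: rad_def)

lemma rad_insert:
  assumes "finite K" "j \<notin> K"
  shows "rad (insert j K) f = (rad K (\<lambda>s. f (s(j := 1))) + rad K (\<lambda>s. f (s(j := - 1)))) / 2"
proof -
  have inj: "inj_on (\<lambda>(y, g). g(j := y)) ({- 1, 1 :: real} \<times> PiE K (\<lambda>_. {- 1, 1}))"
    by (rule inj_combinator[OF assms(2), of "\<lambda>_. {- 1, 1}"])
  have "(\<Sum>s\<in>PiE (insert j K) (\<lambda>_. {- 1, 1}). f s)
      = (\<Sum>(e, s)\<in>{- 1, 1} \<times> PiE K (\<lambda>_. {- 1, 1 :: real}). f (s(j := e)))"
    unfolding PiE_insert_eq sum.reindex[OF inj] by (simp add: case_prod_unfold)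
  also have "\<dots> = (\<Sum>e\<in>{- 1, 1}. \<Sum>s\<in>PiE K (\<lambda>_. {- 1, 1 :: real}). f (s(j := e)))"
    by (rule sum.cartesian_product[symmetric])
  finally show ?thesis using assms by (simp add: rad_def add_divide_distrib)
qed

lemma rad_mono:
  assumes "\<And>s. s \<in> PiE K (\<lambda>_. {- 1, 1}) \<Longrightarrow> f s \<le> g s"
  shows "rad K f \<le> rad K g"
  unfolding rad_def by (intro divide_right_mono sum_mono assms) auto

lemma rad_cong:
  assumes "\<And>s. s \<in> PiE K (\<lambda>_. {- 1, 1}) \<Longrightarrow> f s = g s"
  shows "rad K f = rad K g"
  unfolding rad_def by (intro arg_cong2[where f = "(/)"] sum.cong assms) auto

lemma rad_const: "finite K \<Longrightarrow> rad K (\<lambda>_. c) = c"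
  by (simp add: rad_def card_PiE)

lemma rad_cmult: "rad K (\<lambda>s. c * f s) = c * rad K f"
  by (simp add: rad_def sum_distrib_left)

lemma rad_add: "rad K (\<lambda>s. f s + g s) = rad K f + rad K g"
  by (simp add: rad_def sum.distrib add_divide_distrib)

lemma rad_diff: "rad K (\<lambda>s. f s - g s) = rad K f - rad K g"
  by (simp add: rad_def sum_subtractf diff_divide_distrib)

lemma rad_sum: "rad K (\<lambda>s. \<Sum>a\<in>A. f a s) = (\<Sum>a\<in>A. rad K (f a))"
  unfolding rad_def sum_divide_distrib[symmetric] by (subst sum.swap) simp

lemma rad_nonneg: "(\<And>s. 0 \<le> f s) \<Longrightarrow> 0 \<le> rad K f"
  by (simp add: rad_def sum_nonneg)

lemma rad_flip:
  assumes "j \<in> K"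
  shows "rad K (\<lambda>s. f (s(j := - s j))) = rad K f"
proof -
  have "(\<Sum>s\<in>PiE K (\<lambda>_. {- 1, 1}). f (s(j := - s j))) = (\<Sum>s\<in>PiE K (\<lambda>_. {- 1, 1}). f s)"
    by (rule sum.reindex_bij_witness[where i = "\<lambda>s. s(j := - s j)" and j = "\<lambda>s. s(j := - s j)"])
      (use assms in \<open>auto simp: PiE_iff extensional_def fun_eq_iff\<close>)
  then show ?thesis by (simp add: rad_def)
qed

text \<open>Jensen's inequality for the power \<open>n\<close>. Bernoulli's inequality says that the
  power lies above its tangent, and solving the tangent for \<open>f s\<close> gives a bound that
  can be averaged.\<close>

lemma rad_le_of_rad_power_le:
  assumes fin: "finite K" and f: "\<And>s. 0 \<le> f s" and b: "0 \<le> b" and n: "n \<ge> 1"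
    and le: "rad K (\<lambda>s. f s ^ n) \<le> b ^ n"
  shows "rad K f \<le> b"
proof (rule field_le_epsilon)
  fix e :: real assume "0 < e"
  \<comment> \<open>\<open>b\<close> may be 0, and the tangent has to be taken at a positive
    point.\<close>
  define B where "B = b + e"
  have B: "0 < B" using b \<open>0 < e\<close> by (simp add: B_def)
  have Bn: "rad K (\<lambda>s. f s ^ n) \<le> B ^ n"
    using le power_mono[of b B n] b \<open>0 < e\<close> by (simp add: B_def)
  have "f s \<le> (B - B / n) + B / (n * B ^ n) * f s ^ n" for s
  proof -
    have "1 + real n * (f s / B - 1) \<le> (1 + (f s / B - 1)) ^ n"
      by (rule Bernoulli_inequality) (use B f in auto)
    then have "B / n * (1 + n * (f s / B - 1)) \<le> B / n * (f s / B) ^ n"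
      using B by (intro mult_left_mono) auto
    moreover have "B / n * (1 + n * (f s / B - 1)) = f s - (B - B / n)"
      using B n by (simp add: field_simps)
    moreover have "B / n * (f s / B) ^ n = B / (n * B ^ n) * f s ^ n"
      by (simp add: power_divide)
    ultimately show ?thesis by simp
  qed
  then have "rad K f \<le> rad K (\<lambda>s. (B - B / n) + B / (n * B ^ n) * f s ^ n)"
    by (intro rad_mono)
  also have "\<dots> = (B - B / n) + B / (n * B ^ n) * rad K (\<lambda>s. f s ^ n)"
    by (simp only: rad_add rad_cmult rad_const[OF fin])
  also have "\<dots> \<le> (B - B / n) + B / (n * B ^ n) * B ^ n"
    using B Bn by (intro add_left_mono mult_left_mono) auto
  also have "\<dots> = B" using B by simp
  finally show "rad K f \<le> b + e" by (simp add: B_def)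
qed

subsection \<open>The noncommutative Khintchine inequality\<close>

context
  fixes N :: "'n set" and K :: "'k set" and S :: "'k \<Rightarrow> 'n \<Rightarrow> 'n \<Rightarrow> real" and v :: real
  assumes fin: "finite N" "finite K"
    and sup: "\<And>k. supported N (S k)" and sym: "\<And>k. symmetric (S k)"
    and var: "\<And>U :: 'n \<Rightarrow> 'n \<Rightarrow> real.
      (\<Sum>k\<in>K. frob N N (mat_mult N (S k) U) (mat_mult N (S k) U)) \<le> v * frob N N U U"
begin

definition rad_mat :: "('k \<Rightarrow> real) \<Rightarrow> 'n \<Rightarrow> 'n \<Rightarrow> real" where
  "rad_mat s a b = (\<Sum>k\<in>K. s k * S k a b)"

lemma rad_mat_supported: "supported N (rad_mat s)"
  unfolding supported_def
proof (intro allI impI, rule ccontr)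
  fix a b assume nz: "rad_mat s a b \<noteq> 0" and "\<not> (a \<in> N \<and> b \<in> N)"
  then have "S k a b = 0" for k using sup[of k] by (auto simp: supported_def)
  then show False using nz by (simp add: rad_mat_def)
qed

lemma rad_mat_symmetric: "symmetric (rad_mat s)"
proof -
  have "S k a b = S k b a" for k a b using sym[of k] by (simp add: symmetric_def)
  then show ?thesis unfolding symmetric_def rad_mat_def by (metis (no_types, lifting) sum.cong)
qed

text \<open>
  Flipping one sign \<open>s k\<close> turns the average of \<open>s k\<close> times an odd power into a difference of odd
  powers of two matrices that differ by \<open>2 s k S\<^sub>k\<close>, which telescopes into mixed moments.
\<close>

lemma rad_trace_moment_Suc:
  "rad K (\<lambda>s. trace_moment N (Suc r) (rad_mat s))
    \<le> 2 * (2 * real r + 1) * v * rad K (\<lambda>s. trace_moment N r (rad_mat s))"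
proof -
  define P where "P s = left_pow N (rad_mat s) (2 * r + 1) unit_mat" for s
  define G where "G k s = frob N N (right_pow N (rad_mat s) r (S k)) (right_pow N (rad_mat s) r (S k))"
    for k s
  have key: "rad K (\<lambda>s. s k * frob N N (S k) (P s)) \<le> 2 * (2 * real r + 1) * rad K (G k)" if k: "k \<in> K" for k
  proof -
    let ?f = "\<lambda>s. s(k := - s k)"
    have diff: "s k * (frob N N (S k) (P s) - frob N N (S k) (P (t)))
        \<le> 2 * (2 * real r + 1) * (G k s + G k (t))" if s: "s \<in> PiE K (\<lambda>_. {- 1, 1})" and t: "t = s(k := - s k)" for s t
    proof -
      define D where "D = (\<lambda>a b. 2 * s k * S k a b)"
      have "rad_mat s a b - rad_mat (t) a b = D a b" for a b
      proof -
        have "rad_mat s a b - rad_mat (t) a b = (\<Sum>l\<in>K. if l = k then D a b else 0)"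
          unfolding rad_mat_def sum_subtractf[symmetric] by (intro sum.cong) (auto simp: D_def t)
        then show ?thesis using k fin by simp
      qed
      note pd = power_difference[OF fin(1) rad_mat_supported rad_mat_supported this]
      let ?M = "\<lambda>l. left_pow N (rad_mat s) l (right_pow N (rad_mat (t)) (2 * r - l) (S k))"
      have "P s a b - P (t) a b = (\<Sum>l<2 * r + 1. 2 * s k * ?M l a b)" for a b
        unfolding P_def pd by (simp add: D_def right_pow_scale left_pow_scale)
      then have "frob N N (S k) (P s) - frob N N (S k) (P (t))
          = (\<Sum>l<2 * r + 1. 2 * s k * frob N N (S k) (?M l))"
        by (simp only: frob_diff_right[symmetric] frob_sum_right frob_scale_right)
      then have "s k * (frob N N (S k) (P s) - frob N N (S k) (P (t)))
          = (\<Sum>l<2 * r + 1. 2 * (s k * s k) * frob N N (S k) (?M l))"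
        by (simp only: sum_distrib_left mult_ac)
      also have "s k * s k = 1" using s k by (auto simp: PiE_iff)
      \<comment> \<open>Each of the \<open>2 r + 1\<close> mixed moments is at most the sum of the
        two pure ones; this is where the factor \<open>2 r + 1\<close> of the recursion
        arises.\<close>
      also have "(\<Sum>l<2 * r + 1. 2 * 1 * frob N N (S k) (?M l))
          \<le> (\<Sum>l<2 * r + 1. 2 * (G k s + G k (t)))"
      proof (intro sum_mono)
        fix l assume "l \<in> {..<2 * r + 1}"
        then have "frob N N (S k) (?M l) \<le> G k (t) +
            frob N N (left_pow N (rad_mat s) r (S k)) (left_pow N (rad_mat s) r (S k))"
          unfolding G_def by (intro frob_mixed_power_le rad_mat_symmetric) auto
        then show "2 * 1 * frob N N (S k) (?M l) \<le> 2 * (G k s + G k (t))"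
          by (simp add: frob_left_pow_eq_right_pow[OF rad_mat_symmetric sym] G_def)
      qed
      finally show ?thesis by (simp add: algebra_simps)
    qed
    have "2 * rad K (\<lambda>s. s k * frob N N (S k) (P s))
        = rad K (\<lambda>s. s k * frob N N (S k) (P s)) + rad K (\<lambda>s. ?f s k * frob N N (S k) (P (?f s)))"
      by (subst rad_flip[OF k, of "\<lambda>s. s k * frob N N (S k) (P s)"]) simp
    also have "\<dots> = rad K (\<lambda>s. s k * (frob N N (S k) (P s) - frob N N (S k) (P (?f s))))"
      by (simp add: rad_add[symmetric] algebra_simps)
    also have "\<dots> \<le> rad K (\<lambda>s. 2 * (2 * real r + 1) * (G k s + G k (?f s)))"
      by (intro rad_mono diff refl)
    also have "\<dots> = 2 * (2 * real r + 1) * (2 * rad K (G k))"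
      by (simp only: rad_cmult rad_add rad_flip[OF k, of "G k"] mult_2)
    finally show ?thesis by simp
  qed
  have "rad K (\<lambda>s. trace_moment N (Suc r) (rad_mat s))
      = (\<Sum>k\<in>K. rad K (\<lambda>s. s k * frob N N (S k) (P s)))"
  proof -
    have "trace_moment N (Suc r) (rad_mat s) = (\<Sum>k\<in>K. s k * frob N N (S k) (P s))" for s
    proof -
      have "trace_moment N (Suc r) (rad_mat s) = frob N N (P s) (\<lambda>a b. \<Sum>k\<in>K. s k * S k a b)"
        unfolding trace_moment_Suc[OF fin(1) rad_mat_supported rad_mat_symmetric] P_def
        by (subst frob_commute) (simp only: rad_mat_def[abs_def])
      then show ?thesis by (simp add: frob_sum_right frob_scale_right frob_commute[of N N "P s"])
    qed
    then show ?thesis by (simp add: rad_sum)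
  qed
  also have "\<dots> \<le> (\<Sum>k\<in>K. 2 * (2 * real r + 1) * rad K (G k))"
    by (intro sum_mono key)
  also have "\<dots> = 2 * (2 * real r + 1) * rad K (\<lambda>s. \<Sum>k\<in>K. G k s)"
    by (simp add: rad_sum sum_distrib_left)
  \<comment> \<open>\<open>var\<close> says that the sum of the squares of the \<open>S k\<close> is
    at most \<open>v\<close> times the identity, tested on matrices; it is applied to the power
    \<open>X^r\<close>.\<close>
  also have "\<dots> \<le> 2 * (2 * real r + 1) * rad K (\<lambda>s. v * trace_moment N r (rad_mat s))"
    unfolding G_def trace_moment_def right_pow_eq_mult[OF fin(1) sup rad_mat_supported]
    by (intro mult_left_mono rad_mono var) auto
  finally show ?thesis by (simp add: rad_cmult mult_ac)
qed

text \<open>The factors of the recursion grow with \<open>r\<close>; for \<open>r < p\<close> each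
  is at most \<open>4 p v\<close>, as \<open>4 r + 2 \<le> 4 p\<close>.\<close>

lemma rad_trace_moment_le:
  assumes v: "0 \<le> v"
  shows "r \<le> p \<Longrightarrow> rad K (\<lambda>s. trace_moment N r (rad_mat s)) \<le> (4 * real p * v) ^ r * card N"
proof (induction r)
  case 0
  then show ?case by (simp add: trace_moment_0 fin rad_const)
next
  case (Suc r)
  have "rad K (\<lambda>s. trace_moment N (Suc r) (rad_mat s))
      \<le> 2 * (2 * real r + 1) * v * rad K (\<lambda>s. trace_moment N r (rad_mat s))"
    by (rule rad_trace_moment_Suc)
  also have "\<dots> \<le> (4 * real p * v) * ((4 * real p * v) ^ r * card N)"
  proof (rule mult_mono)
    have "2 * (2 * real r + 1) \<le> 4 * real p"
      using of_nat_mono[OF Suc.prems, where 'a = real] by simp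
    then show "2 * (2 * real r + 1) * v \<le> 4 * real p * v" using v by (intro mult_right_mono) auto
  qed (use Suc v in \<open>auto intro!: rad_nonneg trace_moment_nonneg\<close>)
  finally show ?case by simp
qed

text \<open>The exponent \<open>p\<close> is about the logarithm of the dimension, so that the
  factor \<open>card N\<close> is only a constant to the power \<open>p\<close>.\<close>

lemma rad_symmetric_op_norm_le:
  assumes v: "0 \<le> v" and N: "card N \<ge> 2"
  shows "rad K (\<lambda>s. op_norm N N (rad_mat s)) \<le> 10 * sqrt (ln (card N)) * sqrt v"
proof -
  define l where "l = ln (card N)"
  define p where "p = nat \<lceil>l\<rceil>"
  have "ln 2 \<le> l" using N by (simp add: l_def)
  then have l: "2 / 3 \<le> l" using ln2_ge_two_thirds by linarith
  have p: "l \<le> p" "p \<le> l + 1" "p \<ge> 1" using l by (auto simp: p_def) linarith+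
  \<comment> \<open>The rounding is absorbed by \<open>1 \<le> 3 / 2 * l\<close>. With
    \<open>4 * 5 / 2 = 10\<close> and the \<open>9\<close> from the dimension the total is
    \<open>90\<close>, rounded up to the square of \<open>10\<close>.\<close>
  have p': "p \<le> 5 / 2 * l" using p l by linarith
  have "rad K (\<lambda>s. op_norm N N (rad_mat s) ^ (2 * p)) \<le> rad K (\<lambda>s. trace_moment N p (rad_mat s))"
    by (intro rad_mono symmetric_op_norm_power_le_trace_moment fin rad_mat_supported rad_mat_symmetric p)
  also have "\<dots> \<le> (4 * real p * v) ^ p * card N" by (rule rad_trace_moment_le[OF v]) simp
  also have "\<dots> \<le> (10 * l * v) ^ p * 9 ^ p"
  proof (rule mult_mono, rule power_mono)
    show "4 * real p * v \<le> 10 * l * v" using p' v by (intro mult_right_mono) auto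
    have "real (card N) = exp l" using N by (simp add: l_def)
    also have "\<dots> \<le> exp p" using p by simp
    also have "\<dots> = exp 1 ^ p" by (simp add: exp_of_nat_mult[symmetric])
    also have "\<dots> \<le> 9 ^ p" using exp_le by (intro power_mono) auto
    finally show "real (card N) \<le> 9 ^ p" .
  qed (use v l in auto)
  also have "\<dots> = (90 * l * v) ^ p"
    by (subst power_mult_distrib[symmetric]) (simp add: mult_ac)
  also have "\<dots> \<le> (100 * l * v) ^ p" using l v by (intro power_mono mult_right_mono) auto
  also have "\<dots> = (10 * sqrt l * sqrt v) ^ (2 * p)"
    unfolding power_mult using l v by (intro arg_cong[where f = "\<lambda>x. x ^ p"]) (simp add: power_mult_distrib)
  finally show ?thesis unfolding l_def[symmetric]
    by (rule rad_le_of_rad_power_le[OF fin(2), rotated 3]) (use p l v in \<open>auto intro: op_norm_nonneg fin\<close>)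
qed

end

section \<open>Rectangular matrices by dilation\<close>

text \<open>The symmetric block matrix with \<open>B\<close> and its transpose off the diagonal. Its
  square is block diagonal, with blocks \<open>B B^T\<close> and \<open>B^T B\<close>.\<close>

definition dilation :: "'r set \<Rightarrow> 'c set \<Rightarrow> ('r \<Rightarrow> 'c \<Rightarrow> real) \<Rightarrow> 'r + 'c \<Rightarrow> 'r + 'c \<Rightarrow> real" where
  "dilation I J B a b = (case (a, b) of
      (Inl r, Inr c) \<Rightarrow> if r \<in> I \<and> c \<in> J then B r c else 0
    | (Inr c, Inl r) \<Rightarrow> if r \<in> I \<and> c \<in> J then B r c else 0
    | _ \<Rightarrow> 0)"

lemma dilation_supported: "supported (I <+> J) (dilation I J B)"
  by (auto simp: supported_def dilation_def split: sum.splits if_splits)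

lemma dilation_symmetric: "symmetric (dilation I J B)"
  by (auto simp: symmetric_def dilation_def split: sum.splits)

lemma mat_mult_dilation:
  assumes "finite I" "finite J"
  shows "r \<in> I \<Longrightarrow> mat_mult (I <+> J) (dilation I J B) U (Inl r) b = (\<Sum>c\<in>J. B r c * U (Inr c) b)"
    and "c \<in> J \<Longrightarrow> mat_mult (I <+> J) (dilation I J B) U (Inr c) b = (\<Sum>r\<in>I. B r c * U (Inl r) b)"
  using assms by (simp_all add: mat_mult_def sum.Plus dilation_def)

lemma frob_Plus:
  assumes "finite I" "finite J"
  shows "frob (I <+> J) N U U = (\<Sum>b\<in>N. (\<Sum>r\<in>I. (U (Inl r) b)\<^sup>2) + (\<Sum>c\<in>J. (U (Inr c) b)\<^sup>2))"
proof -
  have "frob (I <+> J) N U U = (\<Sum>b\<in>N. \<Sum>a\<in>I <+> J. (U a b)\<^sup>2)"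
    unfolding frob_def power2_eq_square by (rule sum.swap)
  then show ?thesis using assms by (simp add: sum.Plus)
qed

lemma op_norm_le_dilation:
  assumes fin: "finite I" "finite J"
  shows "op_norm I J B \<le> op_norm (I <+> J) (I <+> J) (dilation I J B)"
proof (rule op_norm_least[OF fin])
  have finP: "finite (I <+> J)" using fin by simp
  fix x assume x: "L2_set x J \<le> 1"
  define y where "y = case_sum (\<lambda>_ :: 'a. 0) x"
  have "L2_set y (I <+> J) = L2_set x J"
    using fin by (simp add: L2_set_def sum.Plus y_def)
  then have "L2_set (\<lambda>a. \<Sum>b\<in>I <+> J. dilation I J B a b * y b) (I <+> J)
      \<le> op_norm (I <+> J) (I <+> J) (dilation I J B)"
    using x by (intro op_norm_upper1 finP) simp
  moreover have "L2_set (\<lambda>r. \<Sum>c\<in>J. B r c * x c) I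
      \<le> L2_set (\<lambda>a. \<Sum>b\<in>I <+> J. dilation I J B a b * y b) (I <+> J)"
  proof -
    have "(\<Sum>b\<in>I <+> J. dilation I J B (Inl r) b * y b) = (\<Sum>c\<in>J. B r c * x c)" if "r \<in> I" for r
      using that fin by (simp add: sum.Plus dilation_def y_def)
    then show ?thesis using fin by (simp add: L2_set_def sum.Plus sum_nonneg)
  qed
  ultimately show "L2_set (\<lambda>r. \<Sum>c\<in>J. B r c * x c) I \<le> op_norm (I <+> J) (I <+> J) (dilation I J B)"
    by linarith
qed

lemma dilation_sum:
  "(\<Sum>k\<in>K. s k * dilation I J (B k) a b) = dilation I J (\<lambda>r c. \<Sum>k\<in>K. s k * B k r c) a b"
  by (auto simp: dilation_def split: sum.splits)

text \<open>\<open>row\<close> and \<open>col\<close> say that stacking the \<open>B k\<close>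
  vertically or horizontally gives matrices of norm at most \<open>v\<close>. Since the square of a
  dilation is block diagonal, they add up to the variance bound for the dilations, column by column
  of \<open>U\<close>. Both blocks are nonempty, hence the dimension is at least 2 and its logarithm
  stays away from 0.\<close>

theorem rademacher_Khintchine:
  fixes B :: "'k \<Rightarrow> 'r \<Rightarrow> 'c \<Rightarrow> real"
  assumes fin: "finite I" "finite J" "finite K" and ne: "I \<noteq> {}" "J \<noteq> {}" and v: "0 \<le> v"
    and row: "\<And>x. (\<Sum>k\<in>K. \<Sum>r\<in>I. (\<Sum>c\<in>J. B k r c * x c)\<^sup>2) \<le> v\<^sup>2 * (\<Sum>c\<in>J. (x c)\<^sup>2)"
    and col: "\<And>x. (\<Sum>k\<in>K. \<Sum>c\<in>J. (\<Sum>r\<in>I. B k r c * x r)\<^sup>2) \<le> v\<^sup>2 * (\<Sum>r\<in>I. (x r)\<^sup>2)"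
  shows "rad K (\<lambda>s. op_norm I J (\<lambda>r c. \<Sum>k\<in>K. s k * B k r c)) \<le> 10 * sqrt (ln (card I + card J)) * v"
proof -
  let ?N = "I <+> J" and ?S = "\<lambda>k. dilation I J (B k)"
  have finN: "finite ?N" using fin by simp
  have var: "(\<Sum>k\<in>K. frob ?N ?N (mat_mult ?N (?S k) U) (mat_mult ?N (?S k) U)) \<le> v\<^sup>2 * frob ?N ?N U U"
    for U :: "'r + 'c \<Rightarrow> 'r + 'c \<Rightarrow> real"
  proof -
    have "(\<Sum>k\<in>K. frob ?N ?N (mat_mult ?N (?S k) U) (mat_mult ?N (?S k) U))
       = (\<Sum>k\<in>K. \<Sum>b\<in>?N. (\<Sum>r\<in>I. (\<Sum>c\<in>J. B k r c * U (Inr c) b)\<^sup>2) + (\<Sum>c\<in>J. (\<Sum>r\<in>I. B k r c * U (Inl r) b)\<^sup>2))"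
      by (simp add: frob_Plus[OF fin(1,2)] mat_mult_dilation[OF fin(1,2)] del: sum.Plus)
    also have "\<dots> = (\<Sum>b\<in>?N. (\<Sum>k\<in>K. \<Sum>r\<in>I. (\<Sum>c\<in>J. B k r c * U (Inr c) b)\<^sup>2)
        + (\<Sum>k\<in>K. \<Sum>c\<in>J. (\<Sum>r\<in>I. B k r c * U (Inl r) b)\<^sup>2))"
      unfolding sum.distrib[symmetric] by (rule sum.swap)
    also have "\<dots> \<le> (\<Sum>b\<in>?N. v\<^sup>2 * (\<Sum>c\<in>J. (U (Inr c) b)\<^sup>2) + v\<^sup>2 * (\<Sum>r\<in>I. (U (Inl r) b)\<^sup>2))"
      by (intro sum_mono add_mono row col)
    also have "\<dots> = v\<^sup>2 * frob ?N ?N U U"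
      by (simp add: frob_Plus[OF fin(1,2)] sum_distrib_left algebra_simps del: sum.Plus)
    finally show ?thesis .
  qed
  have "card ?N = card I + card J" using fin by (simp add: card_Plus)
  moreover have "card I \<ge> 1" "card J \<ge> 1" using fin ne by (simp_all add: Suc_le_eq card_gt_0_iff)
  ultimately have cardN: "card ?N = card I + card J" "card ?N \<ge> 2" by auto
  have "rad K (\<lambda>s. op_norm ?N ?N (rad_mat K ?S s)) \<le> 10 * sqrt (ln (card ?N)) * sqrt (v\<^sup>2)"
    by (rule rad_symmetric_op_norm_le)
      (use finN fin(3) dilation_supported dilation_symmetric var cardN in auto)
  moreover have "op_norm I J (\<lambda>r c. \<Sum>k\<in>K. s k * B k r c) \<le> op_norm ?N ?N (rad_mat K ?S s)" for s
  proof -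
    have "rad_mat K ?S s = dilation I J (\<lambda>r c. \<Sum>k\<in>K. s k * B k r c)"
      by (intro ext) (simp only: dilation_sum rad_mat_def[OF finN fin(3) dilation_supported dilation_symmetric var])
    then show ?thesis using op_norm_le_dilation[OF fin(1,2)] by simp
  qed
  ultimately show ?thesis
    using v by (simp add: cardN(1)) (meson order_trans rad_mono)
qed

subsection \<open>Convex domination\<close>

text \<open>The test functions of the convex order. The Lipschitz condition makes \<open>f\<close>
  depend on the coordinates in \<open>K\<close> only and gives its measurability and
  integrability.\<close>

definition convex_lip :: "real \<Rightarrow> 'k set \<Rightarrow> (('k \<Rightarrow> real) \<Rightarrow> real) \<Rightarrow> bool" where
  "convex_lip L K f \<longleftrightarrow>
     (\<forall>x y t. 0 \<le> t \<and> t \<le> 1 \<longrightarrow> f (\<lambda>k. t * x k + (1 - t) * y k) \<le> t * f x + (1 - t) * f y) \<and>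
     (\<forall>x y. \<bar>f x - f y\<bar> \<le> L * (\<Sum>k\<in>K. \<bar>x k - y k\<bar>))"

definition convex_lip1 :: "real \<Rightarrow> (real \<Rightarrow> real) \<Rightarrow> bool" where
  "convex_lip1 L f \<longleftrightarrow>
     (\<forall>x y t. 0 \<le> t \<and> t \<le> 1 \<longrightarrow> f (t * x + (1 - t) * y) \<le> t * f x + (1 - t) * f y) \<and>
     (\<forall>x y. \<bar>f x - f y\<bar> \<le> L * \<bar>x - y\<bar>)"

lemma convex_lipD:
  assumes "convex_lip L K f"
  shows "0 \<le> t \<Longrightarrow> t \<le> 1 \<Longrightarrow> f (\<lambda>k. t * x k + (1 - t) * y k) \<le> t * f x + (1 - t) * f y"
    and "\<bar>f x - f y\<bar> \<le> L * (\<Sum>k\<in>K. \<bar>x k - y k\<bar>)"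
  using assms by (auto simp: convex_lip_def)

lemma convex_lip1D:
  assumes "convex_lip1 L f"
  shows "0 \<le> t \<Longrightarrow> t \<le> 1 \<Longrightarrow> f (t * x + (1 - t) * y) \<le> t * f x + (1 - t) * f y"
    and "\<bar>f x - f y\<bar> \<le> L * \<bar>x - y\<bar>"
  using assms by (auto simp: convex_lip1_def)

lemma convex_lip1_convex_on: "convex_lip1 L f \<Longrightarrow> convex_on UNIV f"
  by (rule convex_onI) (use convex_lip1D(1)[of L f] in \<open>auto simp: algebra_simps\<close>)

lemma convex_lip_cong:
  assumes "convex_lip L K f" "\<And>k. k \<in> K \<Longrightarrow> x k = y k"
  shows "f x = f y"
  using convex_lipD(2)[OF assms(1), of x y] assms(2) by simp

lemma convex_lip_slice:
  assumes f: "convex_lip L (insert j K) f" and "finite K" "j \<notin> K"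
  shows "convex_lip1 L (\<lambda>y. f (x(j := y)))"
  unfolding convex_lip1_def
proof (intro conjI allI impI)
  fix u v t :: real assume t: "0 \<le> t \<and> t \<le> 1"
  have "(\<lambda>k. t * (x(j := u)) k + (1 - t) * (x(j := v)) k) = x(j := t * u + (1 - t) * v)"
    by (auto simp: fun_eq_iff algebra_simps)
  then show "f (x(j := t * u + (1 - t) * v)) \<le> t * f (x(j := u)) + (1 - t) * f (x(j := v))"
    using convex_lipD(1)[OF f, of t "x(j := u)" "x(j := v)"] t by simp
next
  fix u v :: real
  have "(\<Sum>k\<in>K. \<bar>(x(j := u)) k - (x(j := v)) k\<bar>) = 0"
    using assms(3) by (intro sum.neutral) auto
  then show "\<bar>f (x(j := u)) - f (x(j := v))\<bar> \<le> L * \<bar>u - v\<bar>"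
    using convex_lipD(2)[OF f, of "x(j := u)" "x(j := v)"] assms by simp
qed

lemma convex_lip_fix:
  assumes f: "convex_lip L (insert j K) f" and "finite K" "j \<notin> K"
  shows "convex_lip L K (\<lambda>x. f (x(j := y)))"
  unfolding convex_lip_def
proof (intro conjI allI impI)
  fix u v :: "'a \<Rightarrow> real" and t :: real assume t: "0 \<le> t \<and> t \<le> 1"
  have "(\<lambda>k. t * (u(j := y)) k + (1 - t) * (v(j := y)) k) = (\<lambda>k. t * u k + (1 - t) * v k)(j := y)"
    by (auto simp: fun_eq_iff algebra_simps)
  then show "f ((\<lambda>k. t * u k + (1 - t) * v k)(j := y)) \<le> t * f (u(j := y)) + (1 - t) * f (v(j := y))"
    using convex_lipD(1)[OF f, of t "u(j := y)" "v(j := y)"] t by simp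
next
  fix u v :: "'a \<Rightarrow> real"
  have "(\<Sum>k\<in>K. \<bar>(u(j := y)) k - (v(j := y)) k\<bar>) = (\<Sum>k\<in>K. \<bar>u k - v k\<bar>)"
    using assms(3) by (intro sum.cong) auto
  then show "\<bar>f (u(j := y)) - f (v(j := y))\<bar> \<le> L * (\<Sum>k\<in>K. \<bar>u k - v k\<bar>)"
    using convex_lipD(2)[OF f, of "u(j := y)" "v(j := y)"] assms by simp
qed

lemma convex_lip1_rad:
  assumes "finite A" and f: "\<And>s. convex_lip1 L (f s)"
  shows "convex_lip1 L (\<lambda>x. rad A (\<lambda>s. f s x))"
  unfolding convex_lip1_def
proof (intro conjI allI impI)
  fix u v t :: real assume t: "0 \<le> t \<and> t \<le> 1"
  have "rad A (\<lambda>s. f s (t * u + (1 - t) * v)) \<le> rad A (\<lambda>s. t * f s u + (1 - t) * f s v)"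
    using t by (intro rad_mono convex_lip1D(1)[OF f]) auto
  then show "rad A (\<lambda>s. f s (t * u + (1 - t) * v)) \<le> t * rad A (\<lambda>s. f s u) + (1 - t) * rad A (\<lambda>s. f s v)"
    by (simp only: rad_add rad_cmult)
next
  fix u v :: real
  have le: "rad A (\<lambda>s. f s x - f s y) \<le> L * \<bar>x - y\<bar>" for x y
  proof -
    have "rad A (\<lambda>s. f s x - f s y) \<le> rad A (\<lambda>s. L * \<bar>x - y\<bar>)"
      by (rule rad_mono) (rule order_trans[OF abs_ge_self convex_lip1D(2)[OF f]])
    then show ?thesis by (simp only: rad_const[OF assms(1)])
  qed
  show "\<bar>rad A (\<lambda>s. f s u) - rad A (\<lambda>s. f s v)\<bar> \<le> L * \<bar>u - v\<bar>"
    using le[of u v] le[of v u] unfolding abs_minus_commute[of v u] rad_diff by linarith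
qed

lemma convex_lip_continuous:
  fixes f :: "('k \<Rightarrow> real) \<Rightarrow> real"
  assumes f: "convex_lip L K f"
  shows "continuous_on UNIV f"
  unfolding continuous_on_def
proof (intro ballI)
  fix x :: "'k \<Rightarrow> real"
  have coord: "((\<lambda>y. y k) \<longlongrightarrow> x k) (at x)" for k
  proof -
    have "continuous_on UNIV (\<lambda>y :: 'k \<Rightarrow> real. y k)"
      by (rule continuous_on_product_coordinates)
    then show ?thesis by (simp add: continuous_on_def)
  qed
  have "((\<lambda>y. L * (\<Sum>k\<in>K. \<bar>y k - x k\<bar>)) \<longlongrightarrow> L * (\<Sum>k\<in>K. \<bar>x k - x k\<bar>)) (at x)"
    by (intro tendsto_intros coord)
  then have bound: "((\<lambda>y. L * (\<Sum>k\<in>K. \<bar>y k - x k\<bar>)) \<longlongrightarrow> 0) (at x)"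
    by (simp only: diff_self abs_zero sum.neutral_const mult_zero_right)
  have "((\<lambda>y. f y - f x) \<longlongrightarrow> 0) (at x)"
    by (rule Lim_null_comparison[OF always_eventually bound])
      (simp only: real_norm_def convex_lipD(2)[OF f] simp_thms)
  then show "(f \<longlongrightarrow> f x) (at x within UNIV)" by (simp add: LIM_zero_iff)
qed

text \<open>\<open>f\<close> is continuous in the product topology, and over a countable index type
  the Borel sets of that topology are generated by the coordinates.\<close>

lemma convex_lip_measurable:
  fixes f :: "('k :: countable \<Rightarrow> real) \<Rightarrow> real"
  assumes f: "convex_lip L K f" and X: "\<And>k. k \<in> K \<Longrightarrow> (\<lambda>\<omega>. X \<omega> k) \<in> borel_measurable M"
  shows "(\<lambda>\<omega>. f (X \<omega>)) \<in> borel_measurable M"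
proof -
  \<comment> \<open>Coordinates outside \<open>K\<close> are replaced by 0, since nothing is known
    about their measurability; \<open>f\<close> does not see the change.\<close>
  have "(\<lambda>\<omega> k. if k \<in> K then X \<omega> k else 0) \<in> borel_measurable M"
  proof (rule measurable_coordinatewise_then_product)
    show "(\<lambda>\<omega>. if k \<in> K then X \<omega> k else 0) \<in> borel_measurable M" for k
      using X[of k] by (cases "k \<in> K") auto
  qed
  moreover have "f \<in> borel_measurable borel"
    by (rule borel_measurable_continuous_onI) (rule convex_lip_continuous[OF f])
  ultimately have "(\<lambda>\<omega>. f (\<lambda>k. if k \<in> K then X \<omega> k else 0)) \<in> borel_measurable M"
    by (rule measurable_compose)
  moreover have "f (\<lambda>k. if k \<in> K then X \<omega> k else 0) = f (X \<omega>)" for \<omega>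
    by (rule convex_lip_cong[OF f]) simp
  ultimately show ?thesis by simp
qed

lemma (in prob_space) convex_lip_integrable:
  fixes f :: "('k :: countable \<Rightarrow> real) \<Rightarrow> real"
  assumes f: "convex_lip L K f" and X: "\<And>k. k \<in> K \<Longrightarrow> integrable M (\<lambda>\<omega>. X \<omega> k)"
  shows "integrable M (\<lambda>\<omega>. f (X \<omega>))"
proof (rule Bochner_Integration.integrable_bound)
  show "integrable M (\<lambda>\<omega>. \<bar>f (\<lambda>_. 0)\<bar> + L * (\<Sum>k\<in>K. \<bar>X \<omega> k - 0\<bar>))"
    using X by simp
  show "(\<lambda>\<omega>. f (X \<omega>)) \<in> borel_measurable M"
    by (rule convex_lip_measurable[OF f]) (use X in auto)
  have "\<bar>f x\<bar> \<le> \<bar>f (\<lambda>_. 0)\<bar> + L * (\<Sum>k\<in>K. \<bar>x k - 0\<bar>)" for x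
    using convex_lipD(2)[OF f, of x "\<lambda>_. 0"] by linarith
  then show "AE \<omega> in M. norm (f (X \<omega>)) \<le> norm (\<bar>f (\<lambda>_. 0)\<bar> + L * (\<Sum>k\<in>K. \<bar>X \<omega> k - 0\<bar>))"
    by (intro AE_I2) (metis abs_ge_self order_trans real_norm_def)
qed

section \<open>Expectations under a centred law on the line\<close>

text \<open>The law of \<open>h\<close> alone; independent copies become coordinates of a product
  measure, and conditioning becomes Fubini's theorem.\<close>

locale centered_law = prob_space \<mu> for \<mu> :: "real measure" +
  assumes sets_law [measurable_cong]: "sets \<mu> = sets borel"
    and integrable_law: "integrable \<mu> (\<lambda>y. y)"
    and mean_zero: "(\<integral>y. y \<partial>\<mu>) = 0"
begin

lemma integrable_lip1:
  assumes "convex_lip1 L f"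
  shows "integrable \<mu> (\<lambda>y. f (c * y))"
proof -
  have "convex_lip L (UNIV :: unit set) (\<lambda>x. f (x ()))"
    using assms by (simp add: convex_lip_def convex_lip1_def UNIV_unit)
  from convex_lip_integrable[OF this, of "\<lambda>y _. c * y"] integrable_law show ?thesis by simp
qed

lemma jensen_zero:
  assumes f: "convex_lip1 L f"
  shows "f 0 \<le> (\<integral>y. f (c * y) \<partial>\<mu>)"
proof -
  have "f (\<integral>y. c * y \<partial>\<mu>) \<le> (\<integral>y. f (c * y) \<partial>\<mu>)"
    by (rule jensens_inequality[where I = UNIV])
      (use integrable_law integrable_lip1[OF f] convex_lip1_convex_on[OF f] in auto)
  then show ?thesis by (simp add: mean_zero)
qed

text \<open>Symmetrisation without an independent copy: \<open>c * y\<close> is the midpoint of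
  \<open>2 * c * y\<close> and 0, and by Jensen's inequality the value of \<open>f\<close> at the
  mean 0 is at most the expectation of \<open>f (- (2 * c * y))\<close>.\<close>

lemma symmetrize1:
  assumes f: "convex_lip1 L f"
  shows "(\<integral>y. f (c * y) \<partial>\<mu>) \<le> (\<integral>y. (f (2 * c * y) + f (- (2 * c * y))) / 2 \<partial>\<mu>)"
proof -
  have int: "integrable \<mu> (\<lambda>y. f (d * y))" for d by (rule integrable_lip1[OF f])
  have "(\<integral>y. f (c * y) \<partial>\<mu>) \<le> (\<integral>y. (f (2 * c * y) + f 0) / 2 \<partial>\<mu>)"
  proof (rule integral_mono[OF int])
    show "integrable \<mu> (\<lambda>y. (f (2 * c * y) + f 0) / 2)" using int[of "2 * c"] by simp
    show "f (c * y) \<le> (f (2 * c * y) + f 0) / 2" for y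
      using convex_lip1D(1)[OF f, of "1/2" "2 * c * y" 0] by simp
  qed
  also have "\<dots> = ((\<integral>y. f (2 * c * y) \<partial>\<mu>) + f 0) / 2"
    using int[of "2 * c"] by (simp add: prob_space)
  also have "\<dots> \<le> ((\<integral>y. f (2 * c * y) \<partial>\<mu>) + (\<integral>y. f (- (2 * c * y)) \<partial>\<mu>)) / 2"
    using jensen_zero[OF f, of "- (2 * c)"] by simp
  also have "\<dots> = (\<integral>y. (f (2 * c * y) + f (- (2 * c * y))) / 2 \<partial>\<mu>)"
    using int[of "2 * c"] int[of "- (2 * c)"] by simp
  finally show ?thesis .
qed

text \<open>
  All \<open>n\<close> signs agree with probability \<open>2\<^sup>1\<^sup>-\<^sup>n\<close>, so normalised Rademacher sums of all lengths have
  at least the tails of a subgaussian variable.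
\<close>

lemma subgaussian_domination1:
  fixes A :: "nat \<Rightarrow> 'i set"
  assumes A: "\<And>n. finite (A n)" "\<And>n. card (A n) = n"
    and f: "convex_lip1 L f" and t: "t > 0"
    and psi2: "(\<integral>\<^sup>+y. ennreal (exp (y\<^sup>2 / t\<^sup>2)) \<partial>\<mu>) \<le> 2"
    and b: "\<And>n :: nat. n \<ge> 1 \<Longrightarrow> rad (A n) (\<lambda>s. f ((\<Sum>i\<in>A n. s i) / sqrt (real n))) \<le> b"
  shows "(\<integral>y. f (1 / (4 * t) * y) \<partial>\<mu>) \<le> b"
proof -
  \<comment> \<open>The even part of \<open>f\<close>, shifted to vanish at 0. It is convex and
    therefore nonnegative and monotone in the absolute value, so that terms may be dropped from its
    averages.\<close>
  define g where "g y = (f y + f (- y)) / 2 - f 0" for y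
  have g0: "g 0 = 0" and even: "g (- y) = g y" for y by (simp_all add: g_def)
  have convex: "g (u * x + (1 - u) * y) \<le> u * g x + (1 - u) * g y" if "0 \<le> u" "u \<le> 1" for u x y
  proof -
    have "- (u * x + (1 - u) * y) = u * - x + (1 - u) * - y" by (simp add: algebra_simps)
    moreover have "u * g x + (1 - u) * g y
        = ((u * f x + (1 - u) * f y) + (u * f (- x) + (1 - u) * f (- y))) / 2 - f 0"
      by (simp add: g_def field_simps)
    ultimately show ?thesis
      using convex_lip1D(1)[OF f that, of x y] convex_lip1D(1)[OF f that, of "- x" "- y"]
      unfolding g_def[of "u * x + (1 - u) * y"] by simp
  qed
  have nonneg: "0 \<le> g y" for y using convex[of "1/2" y "- y"] g0 even by simp
  have mono: "g x \<le> g r" if "\<bar>x\<bar> \<le> r" for x r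
  proof (cases "r = 0")
    case False
    then have r: "r > 0" using that by linarith
    define u where "u = (x + r) / (2 * r)"
    have "0 \<le> u" "u \<le> 1" using that r by (auto simp: u_def field_simps)
    moreover have "u * r + (1 - u) * - r = x" using r by (simp add: u_def field_simps)
    moreover have "u * g r + (1 - u) * g (- r) = g r" by (simp add: even algebra_simps)
    ultimately show ?thesis using convex[of u r "- r"] by simp
  qed (use that in simp)
  define d where "d = b - f 0"
  have sqrt_bound: "g (sqrt n) * 2 \<le> 2 ^ n * d" if n: "n \<ge> 1" for n :: nat
  proof -
    let ?G = "\<lambda>s. (\<Sum>i\<in>A n. s i) / sqrt n" and ?S = "PiE (A n) (\<lambda>_. {- 1, 1 :: real})"
    have neg: "rad (A n) (\<lambda>s. f (- ?G s)) = rad (A n) (\<lambda>s. f (?G s))"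
    proof -
      have "(\<Sum>s\<in>?S. f (- ?G s)) = (\<Sum>s\<in>?S. f (?G s))"
        by (rule sum.reindex_bij_witness[where i = "\<lambda>s. \<lambda>i\<in>A n. - s i" and j = "\<lambda>s. \<lambda>i\<in>A n. - s i"])
          (auto simp: PiE_iff extensional_def fun_eq_iff sum_negf)
      then show ?thesis by (simp add: rad_def)
    qed
    \<comment> \<open>The two constant sign patterns, at which the normalised sum equals
      \<open>sqrt n\<close> and \<open>- sqrt n\<close>; all other terms are dropped.\<close>
    define p q where "p = (\<lambda>i\<in>A n. 1 :: real)" and "q = (\<lambda>i\<in>A n. - 1 :: real)"
    have pq: "p \<noteq> q" "p \<in> ?S" "q \<in> ?S"
    proof -
      obtain i where "i \<in> A n" using A(2)[of n] n by fastforce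
      then show "p \<noteq> q" by (auto simp: p_def q_def fun_eq_iff intro!: exI[of _ i])
    qed (auto simp: p_def q_def)
    have nn: "n / sqrt n = sqrt n" using n by (simp add: real_div_sqrt)
    have "g (sqrt n) * 2 = g (?G p) + g (?G q)"
      using even[of "sqrt n"] nn by (simp add: p_def q_def sum_negf A)
    also have "\<dots> = (\<Sum>s\<in>{p, q}. g (?G s))" using pq by simp
    also have "\<dots> \<le> (\<Sum>s\<in>?S. g (?G s))"
      by (rule sum_mono2) (use pq nonneg in \<open>auto intro: finite_signs A\<close>)
    also have "\<dots> = 2 ^ n * rad (A n) (\<lambda>s. g (?G s))" by (simp add: rad_def A)
    also have "rad (A n) (\<lambda>s. g (?G s)) = rad (A n) (\<lambda>s. 1 / 2 * (f (?G s) + f (- ?G s)) - f 0)"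
      by (simp add: g_def)
    also have "\<dots> = rad (A n) (\<lambda>s. f (?G s)) - f 0"
      by (simp only: rad_diff rad_cmult rad_add neg rad_const A(1)) simp
    also have "\<dots> \<le> d" using b[OF n] by (simp add: d_def)
    finally show ?thesis by simp
  qed
  have d: "0 \<le> d" using sqrt_bound[of 1] nonneg[of 1] by simp
  have exp_bound: "g x \<le> exp (x\<^sup>2) * d" for x
  proof (cases "x = 0")
    case False
    \<comment> \<open>Rounding \<open>x^2\<close> up exceeds it by at most 1, and the factor 2 on
      the left of \<open>sqrt_bound\<close> pays for exactly this:
      \<open>n - 1 \<le> x^2\<close>.\<close>
    define n where "n = nat \<lceil>x\<^sup>2\<rceil>"
    have "0 < \<lceil>x\<^sup>2\<rceil>" using False by simp
    then have n: "x\<^sup>2 \<le> n" "n \<le> x\<^sup>2 + 1" "n \<ge> 1" unfolding n_def by linarith+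
    have "\<bar>x\<bar> \<le> sqrt n" using n(1) by (metis real_sqrt_abs real_sqrt_le_iff)
    then have "g x * 2 \<le> 2 ^ n * d" using mono sqrt_bound[OF n(3)] by fastforce
    also have "(2 :: real) ^ n = 2 * 2 powr (real n - 1)"
      using n(3) by (simp add: powr_diff powr_realpow)
    also have "(2 :: real) powr (real n - 1) \<le> exp (real n - 1)"
    proof -
      have "(real n - 1) * ln 2 \<le> (real n - 1) * 1"
        using n(3) ln_le_minus_one[of 2] by (intro mult_left_mono) auto
      then show ?thesis by (simp add: powr_def mult.commute)
    qed
    also have "exp (real n - 1) \<le> exp (x\<^sup>2)" using n by simp
    finally show ?thesis using d by (simp add: mult_right_mono)
  qed (use d g0 in simp)
  \<comment> \<open>Halving the argument halves \<open>g\<close>, by convexity and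
    \<open>g 0 = 0\<close>. This cancels the bound 2 on the exponential moment; together with the
    factor 2 of \<open>symmetrize1\<close> it produces the scale \<open>1 / (4 * t)\<close>.\<close>
  have half: "g (1 / (2 * t) * y) \<le> exp (y\<^sup>2 / t\<^sup>2) * d / 2" for y
    using convex[of "1/2" "y / t" 0] g0 exp_bound[of "y / t"] by (simp add: power_divide field_simps)
  have int: "integrable \<mu> (\<lambda>y. f (c * y))" for c by (rule integrable_lip1[OF f])
  have int_g: "integrable \<mu> (\<lambda>y. g (1 / (2 * t) * y))"
    using int[of "1 / (2 * t)"] int[of "- (1 / (2 * t))"] by (simp add: g_def)
  have "ennreal (\<integral>y. g (1 / (2 * t) * y) \<partial>\<mu>) = (\<integral>\<^sup>+y. ennreal (g (1 / (2 * t) * y)) \<partial>\<mu>)"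
    by (rule nn_integral_eq_integral[symmetric]) (use int_g nonneg in auto)
  also have "\<dots> \<le> (\<integral>\<^sup>+y. ennreal (d / 2) * ennreal (exp (y\<^sup>2 / t\<^sup>2)) \<partial>\<mu>)"
    by (intro nn_integral_mono)
      (use half d in \<open>simp add: ennreal_mult'[symmetric] mult.commute ennreal_leI\<close>)
  also have "\<dots> = ennreal (d / 2) * (\<integral>\<^sup>+y. ennreal (exp (y\<^sup>2 / t\<^sup>2)) \<partial>\<mu>)"
    by (rule nn_integral_cmult) measurable
  also have "\<dots> \<le> ennreal (d / 2) * 2" by (intro mult_left_mono psi2) auto
  also have "\<dots> = ennreal d" using d by (simp add: ennreal_mult'[symmetric] flip: ennreal_numeral)
  finally have "(\<integral>y. g (1 / (2 * t) * y) \<partial>\<mu>) \<le> d" using d by simp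
  moreover have "(\<integral>y. f (1 / (4 * t) * y) \<partial>\<mu>)
      \<le> (\<integral>y. g (1 / (2 * t) * y) + f 0 \<partial>\<mu>)"
    using symmetrize1[OF f, of "1 / (4 * t)"] by (simp add: g_def)
  ultimately show ?thesis using int_g by (simp add: d_def prob_space)
qed

end

section \<open>Products of a centred law\<close>

context centered_law
begin

abbreviation product_law :: "'k set \<Rightarrow> ('k \<Rightarrow> real) measure" where
  "product_law K \<equiv> Pi\<^sub>M K (\<lambda>_. \<mu>)"

lemma product_sigma_finite_law: "product_sigma_finite (\<lambda>_. \<mu>)"
  by (simp add: product_sigma_finite_def sigma_finite_measure_axioms)

lemma prob_space_product_law: "prob_space (product_law K)"
  by (rule prob_space_PiM) (rule prob_space_axioms)

lemma integrable_coordinate: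
  assumes "k \<in> K" "integrable \<mu> (f :: real \<Rightarrow> real)"
  shows "integrable (product_law K) (\<lambda>x. f (x k))"
    and "(\<integral>x. f (x k) \<partial>product_law K) = (\<integral>y. f y \<partial>\<mu>)"
proof -
  have distr: "distr (product_law K) \<mu> (\<lambda>x. x k) = \<mu>"
    by (rule distr_PiM_component) (use prob_space_axioms assms in auto)
  have meas: "(\<lambda>x. x k) \<in> measurable (product_law K) \<mu>"
    using assms(1) by (rule measurable_component_singleton)
  show "integrable (product_law K) (\<lambda>x. f (x k))"
    by (rule integrable_distr[OF meas]) (simp add: distr assms)
  have "(\<integral>y. f y \<partial>distr (product_law K) \<mu> (\<lambda>x. x k)) = (\<integral>x. f (x k) \<partial>product_law K)"
    by (rule integral_distr[OF meas]) (use assms in auto)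
  then show "(\<integral>x. f (x k) \<partial>product_law K) = (\<integral>y. f y \<partial>\<mu>)" by (simp add: distr)
qed

lemma integrable_convex_lip:
  fixes f :: "('k :: countable \<Rightarrow> real) \<Rightarrow> real"
  assumes "convex_lip L K f"
  shows "integrable (product_law K) (\<lambda>x. f (\<lambda>k. c k * x k))"
proof -
  interpret P: prob_space "product_law K" by (rule prob_space_product_law)
  show ?thesis
    by (rule P.convex_lip_integrable[OF assms]) (intro integrable_mult_right integrable_coordinate integrable_law)
qed

text \<open>The closure property behind the inductions over product laws: after one coordinate is
  integrated out, the induction hypothesis applies to what is left.\<close>

lemma convex_lip_expectation:
  fixes f :: "('k :: countable \<Rightarrow> real) \<Rightarrow> real"
  assumes f: "convex_lip L (insert j K) f" and K: "finite K" "j \<notin> K"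
  shows "convex_lip L K (\<lambda>x. \<integral>y. f (x(j := c * y)) \<partial>\<mu>)"
proof -
  have int: "integrable \<mu> (\<lambda>y. f (x(j := c * y)))" for x
    by (rule integrable_lip1[OF convex_lip_slice[OF f K]])
  note fixed = convex_lip_fix[OF f K]
  show ?thesis unfolding convex_lip_def
  proof (intro conjI allI impI)
    fix u v :: "'k \<Rightarrow> real" and t :: real assume t: "0 \<le> t \<and> t \<le> 1"
    have "(\<integral>y. f ((\<lambda>k. t * u k + (1 - t) * v k)(j := c * y)) \<partial>\<mu>)
        \<le> (\<integral>y. t * f (u(j := c * y)) + (1 - t) * f (v(j := c * y)) \<partial>\<mu>)"
      using t by (intro integral_mono int Bochner_Integration.integrable_add integrable_mult_right convex_lipD(1)[OF fixed]) auto
    also have "\<dots> = t * (\<integral>y. f (u(j := c * y)) \<partial>\<mu>) + (1 - t) * (\<integral>y. f (v(j := c * y)) \<partial>\<mu>)"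
      using int by simp
    finally show "(\<integral>y. f ((\<lambda>k. t * u k + (1 - t) * v k)(j := c * y)) \<partial>\<mu>) \<le> \<dots>" .
  next
    fix u v :: "'k \<Rightarrow> real"
    have "\<bar>(\<integral>y. f (u(j := c * y)) \<partial>\<mu>) - (\<integral>y. f (v(j := c * y)) \<partial>\<mu>)\<bar>
        = \<bar>\<integral>y. f (u(j := c * y)) - f (v(j := c * y)) \<partial>\<mu>\<bar>"
      using int by simp
    also have "\<dots> \<le> (\<integral>y. \<bar>f (u(j := c * y)) - f (v(j := c * y))\<bar> \<partial>\<mu>)"
      by (rule integral_abs_bound)
    also have "\<dots> \<le> (\<integral>y. L * (\<Sum>k\<in>K. \<bar>u k - v k\<bar>) \<partial>\<mu>)"
      by (rule integral_mono) (use int convex_lipD(2)[OF fixed] in auto)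
    finally show "\<bar>(\<integral>y. f (u(j := c * y)) \<partial>\<mu>) - (\<integral>y. f (v(j := c * y)) \<partial>\<mu>)\<bar> \<le> L * (\<Sum>k\<in>K. \<bar>u k - v k\<bar>)"
      by (simp add: prob_space)
  qed
qed

lemma integral_product_law_insert:
  fixes f :: "('k :: countable \<Rightarrow> real) \<Rightarrow> real"
  assumes f: "convex_lip L (insert j K) f" and K: "finite K" "j \<notin> K"
  shows "(\<integral>x. f (\<lambda>k. c k * x k) \<partial>product_law (insert j K))
    = (\<integral>x. (\<integral>y. f ((\<lambda>k. c k * x k)(j := c j * y)) \<partial>\<mu>) \<partial>product_law K)"
proof -
  interpret product_sigma_finite "\<lambda>_. \<mu>" by (rule product_sigma_finite_law)
  have eq: "(\<lambda>k. c k * (x(j := y)) k) = (\<lambda>k. c k * x k)(j := c j * y)" for x y by auto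
  show ?thesis
    by (subst product_integral_insert[OF K integrable_convex_lip[OF f]]) (simp only: eq)
qed

text \<open>Jensen's inequality coordinate by coordinate: replacing a coordinate by its mean 0
  cannot increase the expectation of a convex function.\<close>

lemma zeroing:
  fixes f :: "('k :: countable \<Rightarrow> real) \<Rightarrow> real"
  assumes K: "finite K" and f: "convex_lip L K f" and e: "\<And>k. e k = 0 \<or> e k = 1"
  shows "(\<integral>x. f (\<lambda>k. e k * x k) \<partial>product_law K) \<le> (\<integral>x. f (\<lambda>k. 1 * x k) \<partial>product_law K)"
  using K f
proof (induction K arbitrary: f rule: finite_induct)
  case empty
  obtain c where "\<And>x. f x = c" using convex_lip_cong[OF empty] by blast
  then show ?case by simp
next
  case (insert j K)
  define g where "g x = (\<integral>y. f (x(j := 1 * y)) \<partial>\<mu>)" for x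
  have g: "convex_lip L K g"
    unfolding g_def by (rule convex_lip_expectation) (use insert in auto)
  have slice: "convex_lip1 L (\<lambda>y. f (x(j := y)))" for x
    by (rule convex_lip_slice) (use insert in auto)
  have "(\<integral>x. f (\<lambda>k. e k * x k) \<partial>product_law (insert j K))
      = (\<integral>x. (\<integral>y. f ((\<lambda>k. e k * x k)(j := e j * y)) \<partial>\<mu>) \<partial>product_law K)"
    by (rule integral_product_law_insert) (use insert in auto)
  also have "\<dots> \<le> (\<integral>x. g (\<lambda>k. e k * x k) \<partial>product_law K)"
  proof (rule integral_mono)
    have "convex_lip L K (\<lambda>x. \<integral>y. f (x(j := e j * y)) \<partial>\<mu>)"
      by (rule convex_lip_expectation) (use insert in auto)
    then show "integrable (product_law K) (\<lambda>x. \<integral>y. f ((\<lambda>k. e k * x k)(j := e j * y)) \<partial>\<mu>)"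
      by (rule integrable_convex_lip)
    show "integrable (product_law K) (\<lambda>x. g (\<lambda>k. e k * x k))"
      by (rule integrable_convex_lip[OF g])
    show "(\<integral>y. f ((\<lambda>k. e k * x k)(j := e j * y)) \<partial>\<mu>) \<le> g (\<lambda>k. e k * x k)" for x
      using e[of j] jensen_zero[OF slice, of "\<lambda>k. e k * x k" 1] by (auto simp: g_def prob_space)
  qed
  also have "\<dots> \<le> (\<integral>x. g (\<lambda>k. 1 * x k) \<partial>product_law K)" by (rule insert.IH[OF g])
  also have "\<dots> = (\<integral>x. f (\<lambda>k. 1 * x k) \<partial>product_law (insert j K))"
    unfolding g_def by (rule integral_product_law_insert[symmetric]) (use insert in auto)
  finally show ?case .
qed

text \<open>\<open>symmetrize1\<close> coordinate by coordinate. Signs and variables end up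
  separated, so that the signs can be averaged with the variables held fixed.\<close>

lemma symmetrization:
  fixes f :: "('k :: countable \<Rightarrow> real) \<Rightarrow> real"
  assumes K: "finite K" and f: "convex_lip L K f"
  shows "(\<integral>x. f (\<lambda>k. 1 * x k) \<partial>product_law K)
    \<le> rad K (\<lambda>s. \<integral>x. f (\<lambda>k. (2 * s k) * x k) \<partial>product_law K)"
  using K f
proof (induction K arbitrary: f rule: finite_induct)
  case empty
  obtain c where "\<And>x. f x = c" using convex_lip_cong[OF empty] by blast
  then show ?case by (simp add: rad_empty)
next
  case (insert j K)
  define g where "g e x = (\<integral>y. f (x(j := (2 * e) * y)) \<partial>\<mu>)" for e x
  have g: "convex_lip L K (g e)" for e
    unfolding g_def by (rule convex_lip_expectation) (use insert in auto)
  have slice: "convex_lip1 L (\<lambda>y. f (x(j := y)))" for x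
    by (rule convex_lip_slice) (use insert in auto)
  have int1: "integrable \<mu> (\<lambda>y. f (x(j := c * y)))" for x c
    by (rule integrable_lip1[OF slice])
  have intg: "integrable (product_law K) (\<lambda>x. g e (\<lambda>k. 1 * x k))" for e
    by (rule integrable_convex_lip[OF g])
  have "(\<integral>x. f (\<lambda>k. 1 * x k) \<partial>product_law (insert j K))
      = (\<integral>x. (\<integral>y. f ((\<lambda>k. 1 * x k)(j := 1 * y)) \<partial>\<mu>) \<partial>product_law K)"
    by (rule integral_product_law_insert) (use insert in auto)
  also have "\<dots> \<le> (\<integral>x. (g 1 (\<lambda>k. 1 * x k) + g (- 1) (\<lambda>k. 1 * x k)) / 2 \<partial>product_law K)"
  proof (rule integral_mono)
    have "convex_lip L K (\<lambda>x. \<integral>y. f (x(j := 1 * y)) \<partial>\<mu>)"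
      by (rule convex_lip_expectation) (use insert in auto)
    then show "integrable (product_law K) (\<lambda>x. \<integral>y. f ((\<lambda>k. 1 * x k)(j := 1 * y)) \<partial>\<mu>)"
      by (rule integrable_convex_lip)
    show "integrable (product_law K) (\<lambda>x. (g 1 (\<lambda>k. 1 * x k) + g (- 1) (\<lambda>k. 1 * x k)) / 2)"
      using intg by simp
    show "(\<integral>y. f ((\<lambda>k. 1 * x k)(j := 1 * y)) \<partial>\<mu>)
        \<le> (g 1 (\<lambda>k. 1 * x k) + g (- 1) (\<lambda>k. 1 * x k)) / 2" for x
      using symmetrize1[OF slice[of "\<lambda>k. 1 * x k"], of 1] int1[of x 2] int1[of x "- 2"] by (simp add: g_def)
  qed
  also have "\<dots> = ((\<integral>x. g 1 (\<lambda>k. 1 * x k) \<partial>product_law K) + (\<integral>x. g (- 1) (\<lambda>k. 1 * x k) \<partial>product_law K)) / 2"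
    using intg by simp
  also have "\<dots> \<le> (rad K (\<lambda>s. \<integral>x. g 1 (\<lambda>k. (2 * s k) * x k) \<partial>product_law K)
      + rad K (\<lambda>s. \<integral>x. g (- 1) (\<lambda>k. (2 * s k) * x k) \<partial>product_law K)) / 2"
    using insert.IH[OF g[of 1]] insert.IH[OF g[of "- 1"]] by simp
  also have "\<dots> = rad (insert j K) (\<lambda>s. \<integral>x. f (\<lambda>k. (2 * s k) * x k) \<partial>product_law (insert j K))"
  proof -
    have step: "(\<integral>x. g e (\<lambda>k. (2 * s k) * x k) \<partial>product_law K)
      = (\<integral>x. f (\<lambda>k. (2 * (s(j := e)) k) * x k) \<partial>product_law (insert j K))" for s e
    proof -
      have eq: "(\<lambda>k. (2 * s k) * x k)(j := (2 * e) * y) = (\<lambda>k. (2 * (s(j := e)) k) * x k)(j := (2 * (s(j := e)) j) * y)"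
        for x y by auto
      show ?thesis unfolding g_def eq
        by (rule integral_product_law_insert[symmetric]) (use insert in auto)
    qed
    show ?thesis unfolding step rad_insert[OF insert(1,2)] ..
  qed
  finally show ?case .
qed

end

lemma rad_union:
  assumes "finite A" "finite B" "A \<inter> B = {}"
  shows "rad (A \<union> B) f = rad A (\<lambda>s. rad B (\<lambda>s'. f (\<lambda>k. if k \<in> A then s k else s' k)))"
  using assms
proof (induction A arbitrary: f rule: finite_induct)
  case (insert j A)
  have eq: "(\<lambda>k. if k \<in> A then s k else s' k)(j := e) = (\<lambda>k. if k \<in> insert j A then (s(j := e)) k else s' k)"
    for s s' :: "'a \<Rightarrow> real" and e using insert by auto
  have IH: "rad (A \<union> B) h = rad A (\<lambda>s. rad B (\<lambda>s'. h (\<lambda>k. if k \<in> A then s k else s' k)))" for h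
    by (rule insert.IH) (use insert in auto)
  have "rad (insert j A \<union> B) f = (rad (A \<union> B) (\<lambda>s. f (s(j := 1))) + rad (A \<union> B) (\<lambda>s. f (s(j := - 1)))) / 2"
    using insert rad_insert[of "A \<union> B" j f] by simp
  also have "\<dots> = rad (insert j A) (\<lambda>s. rad B (\<lambda>s'. f (\<lambda>k. if k \<in> insert j A then s k else s' k)))"
    unfolding rad_insert[OF insert(1,2)] IH eq ..
  finally show ?case .
qed (simp add: rad_empty)

lemma integral_rad:
  assumes "\<And>s. integrable M (\<lambda>y. f s y :: real)"
  shows "rad K (\<lambda>s. \<integral>y. f s y \<partial>M) = (\<integral>y. rad K (\<lambda>s. f s y) \<partial>M)"
  using assms by (simp add: rad_def)

context centered_law
begin

text \<open>The coordinates are exchanged for sums of signs one at a time. The comparison on the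
  line needs sums of every length, so the bound is assumed for every choice of the lengths
  \<open>n k\<close>, one for each coordinate.\<close>

lemma subgaussian_domination:
  fixes f :: "('k :: countable \<Rightarrow> real) \<Rightarrow> real"
  assumes K: "finite K" and t: "t > 0"
    and psi2: "(\<integral>\<^sup>+y. ennreal (exp (y\<^sup>2 / t\<^sup>2)) \<partial>\<mu>) \<le> 2"
    and f: "convex_lip L K f"
    and b: "\<And>n :: 'k \<Rightarrow> nat. (\<And>k. n k \<ge> 1) \<Longrightarrow>
      rad (SIGMA k:K. {..<n k}) (\<lambda>s. f (\<lambda>k. (\<Sum>i<n k. s (k, i)) / sqrt (real (n k)))) \<le> b"
  shows "(\<integral>x. f (\<lambda>k. 1 / (4 * t) * x k) \<partial>product_law K) \<le> b"
  using K f b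
proof (induction K arbitrary: f rule: finite_induct)
  case empty
  obtain c where "\<And>x. f x = c" using convex_lip_cong[OF empty(1)] by blast
  then show ?case
    using empty(2)[of "\<lambda>_. 1"] prob_space.prob_space[OF prob_space_product_law, of "{} :: 'k set"]
    by (simp add: rad_empty)
next
  case (insert j K)
  define g where "g x = (\<integral>y. f (x(j := 1 / (4 * t) * y)) \<partial>\<mu>)" for x
  have g: "convex_lip L K g"
    unfolding g_def by (rule convex_lip_expectation) (use insert in auto)
  have slice: "convex_lip1 L (\<lambda>y. f (x(j := y)))" for x
    by (rule convex_lip_slice) (use insert in auto)
  have "(\<integral>x. f (\<lambda>k. 1 / (4 * t) * x k) \<partial>product_law (insert j K))
      = (\<integral>x. g (\<lambda>k. 1 / (4 * t) * x k) \<partial>product_law K)"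
    unfolding g_def by (rule integral_product_law_insert) (use insert in auto)
  also have "\<dots> \<le> b"
  proof (rule insert.IH[OF g])
    fix n :: "'k \<Rightarrow> nat" assume n: "\<And>k. n k \<ge> 1"
    let ?S = "SIGMA k:K. {..<n k}" and ?G = "\<lambda>s k. (\<Sum>i<n k. s (k, i)) / sqrt (real (n k))"
    have finS: "finite ?S" using insert by auto
    have "rad ?S (\<lambda>s. g (?G s)) = (\<integral>y. rad ?S (\<lambda>s. f ((?G s)(j := 1 / (4 * t) * y))) \<partial>\<mu>)"
      unfolding g_def by (rule integral_rad) (rule integrable_lip1[OF slice])
    also have "\<dots> \<le> b"
    \<comment> \<open>With the signs over \<open>K\<close> averaged, what remains is a convex
      Lipschitz function of \<open>y\<close>. The signs of coordinate \<open>j\<close> are indexed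
      by pairs, which is why the sets \<open>A n\<close> were left arbitrary.\<close>
    proof (rule subgaussian_domination1[where A = "\<lambda>N. {j} \<times> {..<N}", OF _ _ _ t psi2])
      show "convex_lip1 L (\<lambda>y. rad ?S (\<lambda>s. f ((?G s)(j := y))))"
        by (rule convex_lip1_rad[OF finS slice])
      fix N :: nat assume N: "N \<ge> 1"
      let ?n = "n(j := N)"
      have split: "(SIGMA k:insert j K. {..<?n k}) = {j} \<times> {..<N} \<union> ?S"
        using insert(2) by (auto split: if_splits)
      have "rad ({j} \<times> {..<N}) (\<lambda>s. rad ?S (\<lambda>s'. f ((?G s')(j := (\<Sum>i\<in>{j} \<times> {..<N}. s i) / sqrt (real N)))))
        = rad (SIGMA k:insert j K. {..<?n k}) (\<lambda>s. f (\<lambda>k. (\<Sum>i<?n k. s (k, i)) / sqrt (real (?n k))))"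
        unfolding split
      proof (subst rad_union)
        have "f ((?G s')(j := (\<Sum>i\<in>{j} \<times> {..<N}. s i) / sqrt (real N)))
          = f (\<lambda>k. (\<Sum>i<?n k. (\<lambda>z. if z \<in> {j} \<times> {..<N} then s z else s' z) (k, i)) / sqrt (real (?n k)))" for s s'
        proof (rule convex_lip_cong[OF insert.prems(1)])
          have sum: "(\<Sum>i\<in>{j} \<times> {..<N}. s i) = (\<Sum>i<N. s (j, i))"
            using sum.cartesian_product[of "\<lambda>x y. s (x, y)" "{..<N}" "{j}"] by simp
          fix k assume "k \<in> insert j K"
          then show "((?G s')(j := (\<Sum>i\<in>{j} \<times> {..<N}. s i) / sqrt (real N))) k
            = (\<Sum>i<?n k. (\<lambda>z. if z \<in> {j} \<times> {..<N} then s z else s' z) (k, i)) / sqrt (real (?n k))"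
            using insert(2) sum by (cases "k = j") auto
        qed
        then show "rad ({j} \<times> {..<N}) (\<lambda>s. rad ?S (\<lambda>s'. f ((?G s')(j := (\<Sum>i\<in>{j} \<times> {..<N}. s i) / sqrt (real N)))))
          = rad ({j} \<times> {..<N}) (\<lambda>s. rad ?S (\<lambda>s'. f (\<lambda>k. (\<Sum>i<?n k. (\<lambda>z. if z \<in> {j} \<times> {..<N} then s z else s' z) (k, i)) / sqrt (real (?n k)))))"
          by simp
      qed (use insert finS in auto)
      also have "\<dots> \<le> b" by (rule insert.prems(2)) (use n N in auto)
      finally show "rad ({j} \<times> {..<N}) (\<lambda>s. rad ?S (\<lambda>s'. f ((?G s')(j := (\<Sum>i\<in>{j} \<times> {..<N}. s i) / sqrt (real N))))) \<le> b" .
    qed (auto simp: card_cartesian_product)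
    finally show "rad ?S (\<lambda>s. g (?G s)) \<le> b" .
  qed
  finally show ?case .
qed

end

subsection \<open>Random linear combinations of matrices\<close>

text \<open>Expanding the difference of two arguments in coordinate vectors yields the Lipschitz
  constant, crudely the sum of their seminorms.\<close>

lemma seminorm_convex_lip:
  fixes F :: "('k \<Rightarrow> real) \<Rightarrow> real"
  assumes K: "finite K" and tri: "\<And>x y. F (\<lambda>k. x k + y k) \<le> F x + F y"
    and scale: "\<And>a x. F (\<lambda>k. a * x k) \<le> \<bar>a\<bar> * F x"
    and loc: "\<And>x y. (\<And>k. k \<in> K \<Longrightarrow> x k = y k) \<Longrightarrow> F x = F y"
  shows "\<exists>L. convex_lip L K F"
proof -
  define e :: "'k \<Rightarrow> 'k \<Rightarrow> real" where "e j k = (if k = j then 1 else 0)" for j k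
  define L where "L = (\<Sum>k\<in>K. F (e k))"
  have zero: "F (\<lambda>_. 0) = 0"
    using scale[of 0 "\<lambda>_. 0"] tri[of "\<lambda>_. 0" "\<lambda>_. 0"] by simp
  have nonneg: "0 \<le> F x" for x
    using tri[of x "\<lambda>k. - 1 * x k"] scale[of "- 1" x] zero by simp
  have coord: "F z \<le> (\<Sum>k\<in>S. \<bar>z k\<bar> * F (e k))" if "finite S" "\<And>k. k \<notin> S \<Longrightarrow> z k = 0" for S z
    using that
  proof (induction S arbitrary: z rule: finite_induct)
    case empty
    then have "z = (\<lambda>_. 0)" by auto
    then show ?case by (simp add: zero)
  next
    case (insert j S)
    have eq: "z = (\<lambda>k. (z(j := 0)) k + z j * e j k)" by (auto simp: e_def)
    have "F z \<le> F (z(j := 0)) + F (\<lambda>k. z j * e j k)"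
      using tri[of "z(j := 0)" "\<lambda>k. z j * e j k"] by (simp only: eq[symmetric])
    also have "F (z(j := 0)) \<le> (\<Sum>k\<in>S. \<bar>(z(j := 0)) k\<bar> * F (e k))"
      by (rule insert.IH) (use insert.prems in auto)
    also have "\<dots> = (\<Sum>k\<in>S. \<bar>z k\<bar> * F (e k))"
      using insert by (intro sum.cong) auto
    also have "F (\<lambda>k. z j * e j k) \<le> \<bar>z j\<bar> * F (e j)" by (rule scale)
    finally show ?case using insert by simp
  qed
  have lip: "F x \<le> F y + L * (\<Sum>k\<in>K. \<bar>x k - y k\<bar>)" for x y
  proof -
    define z where "z k = (if k \<in> K then x k - y k else 0)" for k
    have "F x = F (\<lambda>k. y k + z k)" by (rule loc) (simp add: z_def)
    also have "\<dots> \<le> F y + F z" by (rule tri)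
    also have "F z \<le> (\<Sum>k\<in>K. \<bar>z k\<bar> * F (e k))" by (rule coord[OF K]) (simp add: z_def)
    also have "\<dots> \<le> (\<Sum>k\<in>K. \<bar>x k - y k\<bar> * L)"
    proof (intro sum_mono)
      fix k assume k: "k \<in> K"
      have "F (e k) \<le> L" unfolding L_def by (rule member_le_sum) (use k K nonneg in auto)
      then show "\<bar>z k\<bar> * F (e k) \<le> \<bar>x k - y k\<bar> * L" using k by (simp add: z_def mult_left_mono)
    qed
    finally show ?thesis by (simp add: sum_distrib_left mult.commute)
  qed
  have "convex_lip L K F"
    unfolding convex_lip_def
  proof (intro conjI allI impI)
    fix x y :: "'k \<Rightarrow> real" and t :: real assume t: "0 \<le> t \<and> t \<le> 1"
    show "F (\<lambda>k. t * x k + (1 - t) * y k) \<le> t * F x + (1 - t) * F y"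
      using tri[of "\<lambda>k. t * x k" "\<lambda>k. (1 - t) * y k"] scale[of t x] scale[of "1 - t" y] t by simp
  next
    fix x y :: "'k \<Rightarrow> real"
    have "(\<Sum>k\<in>K. \<bar>y k - x k\<bar>) = (\<Sum>k\<in>K. \<bar>x k - y k\<bar>)"
      by (intro sum.cong abs_minus_commute refl)
    then show "\<bar>F x - F y\<bar> \<le> L * (\<Sum>k\<in>K. \<bar>x k - y k\<bar>)"
      using lip[of x y] lip[of y x] by simp
  qed
  then show ?thesis ..
qed

definition matrix_comb :: "'k set \<Rightarrow> ('k \<Rightarrow> 'r \<Rightarrow> 'c \<Rightarrow> real) \<Rightarrow> ('k \<Rightarrow> real) \<Rightarrow> 'r \<Rightarrow> 'c \<Rightarrow> real" where
  "matrix_comb K B x r c = (\<Sum>k\<in>K. x k * B k r c)"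

lemma op_norm_comb_scale:
  assumes "finite I" "finite J" "0 \<le> a"
  shows "op_norm I J (matrix_comb K B (\<lambda>k. a * x k)) = a * op_norm I J (matrix_comb K B x)"
proof -
  have le: "op_norm I J (matrix_comb K B (\<lambda>k. a * x k)) \<le> \<bar>a\<bar> * op_norm I J (matrix_comb K B x)" for a x
    using op_norm_scale_le[OF assms(1,2), of a "matrix_comb K B x"]
    by (simp add: matrix_comb_def[abs_def] sum_distrib_left mult.assoc)
  show ?thesis
  proof (cases "a = 0")
    case False
    then have "a * op_norm I J (matrix_comb K B x) \<le> op_norm I J (matrix_comb K B (\<lambda>k. a * x k))"
      using le[of "inverse a" "\<lambda>k. a * x k"] assms(3) by (simp add: field_simps)
    then show ?thesis using le[of a x] assms(3) by simp
  qed (use le[of 0 x] op_norm_nonneg[OF assms(1,2)] in \<open>simp add: order_antisym\<close>)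
qed

lemma op_norm_comb_convex_lip:
  assumes "finite I" "finite J" "finite K"
  obtains L where "convex_lip L K (\<lambda>x. op_norm I J (matrix_comb K B x))"
proof -
  have "\<exists>L. convex_lip L K (\<lambda>x. op_norm I J (matrix_comb K B x))"
  proof (rule seminorm_convex_lip[OF assms(3)])
    show "op_norm I J (matrix_comb K B (\<lambda>k. x k + y k)) \<le> op_norm I J (matrix_comb K B x) + op_norm I J (matrix_comb K B y)" for x y
      using op_norm_triangle[OF assms(1,2), of "matrix_comb K B x" "matrix_comb K B y"]
      by (simp add: matrix_comb_def[abs_def] sum.distrib distrib_right)
    show "op_norm I J (matrix_comb K B (\<lambda>k. a * x k)) \<le> \<bar>a\<bar> * op_norm I J (matrix_comb K B x)" for a x
      using op_norm_scale_le[OF assms(1,2), of a "matrix_comb K B x"]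
      by (simp add: matrix_comb_def[abs_def] sum_distrib_left mult.assoc)
    show "op_norm I J (matrix_comb K B x) = op_norm I J (matrix_comb K B y)" if "\<And>k. k \<in> K \<Longrightarrow> x k = y k" for x y
      using that by (intro op_norm_cong) (simp add: matrix_comb_def)
  qed
  then show ?thesis using that by blast
qed

text \<open>In one coordinate, \<open>x j\<close> and \<open>- x j\<close> are mixtures of
  \<open>c\<close> and \<open>- c\<close> with exchanged weights, so convexity bounds
  \<open>g (x j) + g (- x j)\<close> by \<open>g c + g (- c)\<close>.\<close>

lemma rad_contraction:
  assumes "finite K" "convex_lip L K f" "\<And>k. k \<in> K \<Longrightarrow> \<bar>x k\<bar> \<le> c"
  shows "rad K (\<lambda>s. f (\<lambda>k. s k * x k)) \<le> rad K (\<lambda>s. f (\<lambda>k. c * s k))"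
  using assms
proof (induction K arbitrary: f rule: finite_induct)
  case empty
  obtain d where "\<And>x. f x = d" using convex_lip_cong[OF empty(1)] by blast
  then show ?case by simp
next
  case (insert j K)
  define g where "g y = rad K (\<lambda>s. f ((\<lambda>k. c * s k)(j := y)))" for y
  have g: "convex_lip1 L g" unfolding g_def
    by (rule convex_lip1_rad[OF insert.hyps(1) convex_lip_slice[OF insert.prems(1) insert.hyps]])
  have IH: "rad K (\<lambda>s. f ((\<lambda>k. s k * x k)(j := y))) \<le> g y" for y
    unfolding g_def by (rule insert.IH[OF convex_lip_fix[OF insert.prems(1) insert.hyps]]) (use insert.prems(2) in auto)
  have eq1: "(\<lambda>k. (s(j := e)) k * x k) = (\<lambda>k. s k * x k)(j := e * x j)"
    and eq2: "(\<lambda>k. c * (s(j := e)) k) = (\<lambda>k. c * s k)(j := c * e)" for s e by auto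
  have "rad (insert j K) (\<lambda>s. f (\<lambda>k. s k * x k)) \<le> (g (1 * x j) + g (- 1 * x j)) / 2"
    unfolding rad_insert[OF insert(1,2)] eq1 by (intro divide_right_mono add_mono IH) simp
  also have "\<dots> \<le> (g (c * 1) + g (c * - 1)) / 2"
  proof (cases "c = 0")
    case False
    have xj: "\<bar>x j\<bar> \<le> c" using insert.prems(2) by simp
    then have c: "c > 0" using False by linarith
    define u where "u = (x j + c) / (2 * c)"
    have u: "0 \<le> u" "u \<le> 1" using xj c by (auto simp: u_def field_simps)
    have "u * c + (1 - u) * - c = x j" "u * - c + (1 - u) * c = - x j"
      using c by (simp_all add: u_def field_simps)
    then show ?thesis
      using convex_lip1D(1)[OF g u, of c "- c"] convex_lip1D(1)[OF g u, of "- c" c]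
      by (simp add: algebra_simps)
  qed (use insert.prems(2)[of j] in simp)
  also have "\<dots> = rad (insert j K) (\<lambda>s. f (\<lambda>k. c * s k))"
    unfolding rad_insert[OF insert(1,2)] eq2 g_def ..
  finally show ?case .
qed

text \<open>The tangent of the p-th root at \<open>b powr p\<close>, obtained from Young's
  inequality. It bounds \<open>y\<close> by an affine function of \<open>y powr p\<close>, so that
  an expectation can be bounded by a p-th moment without taking a root.\<close>

lemma powr_young:
  fixes b p y :: real
  assumes "b > 0" "p \<ge> 1" "y \<ge> 0"
  shows "y \<le> b * (1 - 1 / p) + b powr (1 - p) / p * y powr p"
proof (cases "y = 0")
  case False
  then have y: "y > 0" using assms by simp
  have "(y powr p) powr (1 / p) * (b powr p) powr (1 - 1 / p) \<le> 1 / p * y powr p + (1 - 1 / p) * b powr p"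
    by (rule Youngs_inequality_0) (use assms y in auto)
  moreover have "(y powr p) powr (1 / p) = y" using assms y by (simp add: powr_powr)
  moreover have "(b powr p) powr (1 - 1 / p) = b powr (p - 1)"
    using assms by (simp add: powr_powr right_diff_distrib)
  ultimately have "y * b powr (p - 1) \<le> 1 / p * y powr p + (1 - 1 / p) * b powr p" by simp
  then have "(y * b powr (p - 1)) * b powr (1 - p) \<le> (1 / p * y powr p + (1 - 1 / p) * b powr p) * b powr (1 - p)"
    by (rule mult_right_mono) simp
  moreover have "b powr (p - 1) * b powr (1 - p) = 1" "b powr p * b powr (1 - p) = b"
    using assms by (simp_all add: powr_add[symmetric])
  ultimately show ?thesis by (simp add: algebra_simps mult.assoc)
qed (use assms in auto)

context centered_law
begin

lemma integrable_op_norm_comb: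
  fixes B :: "'k :: countable \<Rightarrow> 'r \<Rightarrow> 'c \<Rightarrow> real"
  assumes "finite I" "finite J" "finite K"
  shows "integrable (product_law K) (\<lambda>x. op_norm I J (matrix_comb K B x))"
proof -
  obtain L where "convex_lip L K (\<lambda>x. op_norm I J (matrix_comb K B x))"
    using op_norm_comb_convex_lip[OF assms] .
  from integrable_convex_lip[OF this, of "\<lambda>_. 1"] show ?thesis by simp
qed

context
  fixes I :: "'r set" and J :: "'c set" and K :: "'k :: countable set" and B :: "'k \<Rightarrow> 'r \<Rightarrow> 'c \<Rightarrow> real"
    and v :: real
  assumes fin: "finite I" "finite J" "finite K" and ne: "I \<noteq> {}" "J \<noteq> {}" and v: "0 \<le> v"
    and row: "\<And>x. (\<Sum>k\<in>K. \<Sum>r\<in>I. (\<Sum>c\<in>J. B k r c * x c)\<^sup>2) \<le> v\<^sup>2 * (\<Sum>c\<in>J. (x c)\<^sup>2)"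
    and col: "\<And>x. (\<Sum>k\<in>K. \<Sum>c\<in>J. (\<Sum>r\<in>I. B k r c * x r)\<^sup>2) \<le> v\<^sup>2 * (\<Sum>r\<in>I. (x r)\<^sup>2)"
begin

theorem subgaussian_Khintchine:
  assumes t: "t > 0" and psi2: "(\<integral>\<^sup>+y. ennreal (exp (y\<^sup>2 / t\<^sup>2)) \<partial>\<mu>) \<le> 2"
  shows "(\<integral>x. op_norm I J (matrix_comb K B x) \<partial>product_law K) \<le> 40 * t * sqrt (ln (card I + card J)) * v"
proof -
  define F where "F x = op_norm I J (matrix_comb K B x)" for x
  obtain L where F: "convex_lip L K F" unfolding F_def using op_norm_comb_convex_lip[OF fin] .
  have "(\<integral>x. F (\<lambda>k. 1 / (4 * t) * x k) \<partial>product_law K) \<le> 10 * sqrt (ln (card I + card J)) * v"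
  proof (rule subgaussian_domination[OF fin(3) t psi2 F])
    fix n :: "'k \<Rightarrow> nat" assume n: "\<And>k. n k \<ge> 1"
    let ?S = "SIGMA k:K. {..<n k}"
    \<comment> \<open>Each \<open>B k\<close> is split into \<open>n k\<close> equal parts with
      separate signs; division by the square root keeps the sums of squares in \<open>row\<close>
      and \<open>col\<close>.\<close>
    define B' where "B' z r c = B (fst z) r c / sqrt (n (fst z))" for z :: "'k \<times> nat" and r c
    have "F (\<lambda>k. (\<Sum>i<n k. s (k, i)) / sqrt (n k)) = op_norm I J (\<lambda>r c. \<Sum>z\<in>?S. s z * B' z r c)" for s
      unfolding F_def
    proof (rule op_norm_cong)
      fix r c
      have "(\<Sum>z\<in>?S. s z * B' z r c) = (\<Sum>k\<in>K. \<Sum>i<n k. s (k, i) * B' (k, i) r c)"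
        using fin(3) by (subst sum.Sigma) (auto simp: case_prod_unfold)
      then show "matrix_comb K B (\<lambda>k. (\<Sum>i<n k. s (k, i)) / sqrt (n k)) r c = (\<Sum>z\<in>?S. s z * B' z r c)"
        by (simp add: matrix_comb_def B'_def sum_distrib_right sum_divide_distrib)
    qed
    moreover have "rad ?S (\<lambda>s. op_norm I J (\<lambda>r c. \<Sum>z\<in>?S. s z * B' z r c)) \<le> 10 * sqrt (ln (card I + card J)) * v"
    proof (rule rademacher_Khintchine[OF fin(1,2) _ ne v])
      show "finite ?S" using fin by simp
      have sq: "(\<Sum>z\<in>?S. Q (fst z) / n (fst z)) = (\<Sum>k\<in>K. Q k)" for Q :: "'k \<Rightarrow> real"
      proof -
        have "(\<Sum>z\<in>?S. Q (fst z) / n (fst z)) = (\<Sum>k\<in>K. \<Sum>i<n k. Q k / n k)"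
          using fin(3) by (subst sum.Sigma) (auto simp: case_prod_unfold)
        also have "\<dots> = (\<Sum>k\<in>K. Q k)"
        proof (intro sum.cong refl)
          fix k show "(\<Sum>i<n k. Q k / n k) = Q k" using n[of k] by simp
        qed
        finally show ?thesis .
      qed
      have div: "(\<Sum>a\<in>A. B' z r a * x a)\<^sup>2 = (\<Sum>a\<in>A. B (fst z) r a * x a)\<^sup>2 / n (fst z)"
        "(\<Sum>a\<in>A'. B' z a c * x' a)\<^sup>2 = (\<Sum>a\<in>A'. B (fst z) a c * x' a)\<^sup>2 / n (fst z)" for A A' x x' z r c
      proof -
        have "(\<Sum>a\<in>A. B' z r a * x a) = (\<Sum>a\<in>A. B (fst z) r a * x a) / sqrt (n (fst z))"
          "(\<Sum>a\<in>A'. B' z a c * x' a) = (\<Sum>a\<in>A'. B (fst z) a c * x' a) / sqrt (n (fst z))"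
          by (simp_all add: B'_def sum_divide_distrib)
        then show "(\<Sum>a\<in>A. B' z r a * x a)\<^sup>2 = (\<Sum>a\<in>A. B (fst z) r a * x a)\<^sup>2 / n (fst z)"
          "(\<Sum>a\<in>A'. B' z a c * x' a)\<^sup>2 = (\<Sum>a\<in>A'. B (fst z) a c * x' a)\<^sup>2 / n (fst z)"
          by (simp_all only: power_divide real_sqrt_pow2 of_nat_0_le_iff)
      qed
      show "(\<Sum>z\<in>?S. \<Sum>r\<in>I. (\<Sum>c\<in>J. B' z r c * x c)\<^sup>2) \<le> v\<^sup>2 * (\<Sum>c\<in>J. (x c)\<^sup>2)" for x
        unfolding div sum_divide_distrib[symmetric]
        using row[of x] sq[of "\<lambda>k. \<Sum>r\<in>I. (\<Sum>c\<in>J. B k r c * x c)\<^sup>2"] by simp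
      show "(\<Sum>z\<in>?S. \<Sum>c\<in>J. (\<Sum>r\<in>I. B' z r c * x r)\<^sup>2) \<le> v\<^sup>2 * (\<Sum>r\<in>I. (x r)\<^sup>2)" for x
        unfolding div sum_divide_distrib[symmetric]
        using col[of x] sq[of "\<lambda>k. \<Sum>c\<in>J. (\<Sum>r\<in>I. B k r c * x r)\<^sup>2"] by simp
    qed
    ultimately show "rad ?S (\<lambda>s. F (\<lambda>k. (\<Sum>i<n k. s (k, i)) / sqrt (n k))) \<le> 10 * sqrt (ln (card I + card J)) * v"
      by simp
  qed
  moreover have "F (\<lambda>k. 1 / (4 * t) * x k) = 1 / (4 * t) * F x" for x
    unfolding F_def by (rule op_norm_comb_scale) (use fin t in auto)
  ultimately have "1 / (4 * t) * (\<integral>x. F x \<partial>product_law K) \<le> 10 * sqrt (ln (card I + card J)) * v"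
    by (simp only: integral_mult_right_zero)
  then show ?thesis using t by (simp add: F_def field_simps)
qed

theorem Lp_Khintchine:
  assumes p: "p \<ge> 1" and b: "b > 0" and int: "integrable \<mu> (\<lambda>y. \<bar>y\<bar> powr p)"
    and bound: "card K * (\<integral>y. \<bar>y\<bar> powr p \<partial>\<mu>) \<le> b powr p"
  shows "(\<integral>x. op_norm I J (matrix_comb K B x) \<partial>product_law K) \<le> 20 * b * sqrt (ln (card I + card J)) * v"
proof -
  interpret P: prob_space "product_law K" by (rule prob_space_product_law)
  define F where "F x = op_norm I J (matrix_comb K B x)" for x
  obtain L where F: "convex_lip L K F" unfolding F_def using op_norm_comb_convex_lip[OF fin] .
  \<comment> \<open>An integrable upper bound for all \<open>\<bar>x k\<bar>\<close> at once, with
    expectation at most \<open>b\<close>; it takes the place of the maximum. After contraction it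
    comes out of the norm as a scalar.\<close>
  define c where "c x = b * (1 - 1 / p) + b powr (1 - p) / p * (\<Sum>k\<in>K. \<bar>x k\<bar> powr p)" for x :: "'k \<Rightarrow> real"
  have c: "\<bar>x k\<bar> \<le> c x" if "k \<in> K" for x k
  proof -
    have "\<bar>x k\<bar> powr p \<le> (\<Sum>k\<in>K. \<bar>x k\<bar> powr p)"
      by (rule member_le_sum) (use that fin in auto)
    then have "b powr (1 - p) / p * \<bar>x k\<bar> powr p \<le> b powr (1 - p) / p * (\<Sum>k\<in>K. \<bar>x k\<bar> powr p)"
      using p by (intro mult_left_mono) auto
    then show ?thesis using powr_young[OF b p, of "\<bar>x k\<bar>"] by (simp add: c_def)
  qed
  have c0: "0 \<le> c x" for x
    using b p by (auto simp: c_def intro!: add_nonneg_nonneg mult_nonneg_nonneg divide_nonneg_nonneg sum_nonneg)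
  have int_c: "integrable (product_law K) c"
    unfolding c_def by (intro Bochner_Integration.integrable_add integrable_mult_right Bochner_Integration.integrable_sum
        integrable_coordinate(1)[OF _ int]) auto
  have "(\<integral>x. c x \<partial>product_law K) = b * (1 - 1 / p) + b powr (1 - p) / p * (card K * (\<integral>y. \<bar>y\<bar> powr p \<partial>\<mu>))"
  proof -
    have "(\<integral>x. c x \<partial>product_law K) = b * (1 - 1 / p) + b powr (1 - p) / p * (\<Sum>k\<in>K. \<integral>x. \<bar>x k\<bar> powr p \<partial>product_law K)"
    proof -
      have sum: "integrable (product_law K) (\<lambda>x. \<Sum>k\<in>K. \<bar>x k\<bar> powr p)"
        by (intro Bochner_Integration.integrable_sum integrable_coordinate(1)[OF _ int])
      have "(\<integral>x. c x \<partial>product_law K) = (\<integral>x. b * (1 - 1 / p) \<partial>product_law K)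
          + (\<integral>x. b powr (1 - p) / p * (\<Sum>k\<in>K. \<bar>x k\<bar> powr p) \<partial>product_law K)"
        unfolding c_def by (rule Bochner_Integration.integral_add) (use sum in auto)
      also have "(\<integral>x. b powr (1 - p) / p * (\<Sum>k\<in>K. \<bar>x k\<bar> powr p) \<partial>product_law K)
          = b powr (1 - p) / p * (\<Sum>k\<in>K. \<integral>x. \<bar>x k\<bar> powr p \<partial>product_law K)"
        by (subst integral_mult_right_zero, subst Bochner_Integration.integral_sum)
          (auto intro: integrable_coordinate(1)[OF _ int])
      finally show ?thesis by (simp add: P.prob_space)
    qed
    also have "(\<Sum>k\<in>K. \<integral>x. \<bar>x k\<bar> powr p \<partial>product_law K) = (\<Sum>k\<in>K. \<integral>y. \<bar>y\<bar> powr p \<partial>\<mu>)"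
      by (intro sum.cong refl integrable_coordinate(2)[OF _ int])
    finally show ?thesis by simp
  qed
  also have "\<dots> \<le> b * (1 - 1 / p) + b powr (1 - p) / p * b powr p"
    using p by (intro add_left_mono mult_left_mono bound) auto
  also have "\<dots> = b" using b p by (simp add: powr_add[symmetric] field_simps)
  finally have Ec: "(\<integral>x. c x \<partial>product_law K) \<le> b" .
  let ?R = "rad K (\<lambda>s. F s)"
  have R: "?R \<le> 10 * sqrt (ln (card I + card J)) * v"
    using rademacher_Khintchine[OF fin ne v row col] by (simp add: F_def matrix_comb_def[abs_def])
  have intF: "integrable (product_law K) (\<lambda>x. F (\<lambda>k. a k * x k))" for a
    by (rule integrable_convex_lip[OF F])
  have "(\<integral>x. F x \<partial>product_law K) \<le> rad K (\<lambda>s. \<integral>x. F (\<lambda>k. (2 * s k) * x k) \<partial>product_law K)"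
    using symmetrization[OF fin(3) F] by simp
  also have "\<dots> = (\<integral>x. rad K (\<lambda>s. F (\<lambda>k. (2 * s k) * x k)) \<partial>product_law K)"
    by (rule integral_rad[OF intF])
  also have "\<dots> \<le> (\<integral>x. 2 * c x * ?R \<partial>product_law K)"
  proof (rule integral_mono)
    show "integrable (product_law K) (\<lambda>x. rad K (\<lambda>s. F (\<lambda>k. (2 * s k) * x k)))"
      unfolding rad_def using intF by (intro integrable_divide Bochner_Integration.integrable_sum) auto
    show "integrable (product_law K) (\<lambda>x. 2 * c x * ?R)" using int_c by simp
    show "rad K (\<lambda>s. F (\<lambda>k. (2 * s k) * x k)) \<le> 2 * c x * ?R" for x
    proof -
      have "rad K (\<lambda>s. F (\<lambda>k. (2 * s k) * x k)) = rad K (\<lambda>s. F (\<lambda>k. s k * (2 * x k)))"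
        by (simp add: mult_ac)
      also have "\<dots> \<le> rad K (\<lambda>s. F (\<lambda>k. (2 * c x) * s k))"
        by (rule rad_contraction[OF fin(3) F]) (use c in \<open>simp add: abs_mult\<close>)
      also have "\<dots> = 2 * c x * ?R"
        unfolding F_def using c0 by (subst op_norm_comb_scale) (auto simp: fin rad_cmult)
      finally show ?thesis .
    qed
  qed
  also have "\<dots> = 2 * (\<integral>x. c x \<partial>product_law K) * ?R" by simp
  also have "\<dots> \<le> 2 * b * (10 * sqrt (ln (card I + card J)) * v)"
    by (intro mult_mono R Ec mult_left_mono)
      (use b c0 in \<open>auto simp: F_def intro!: rad_nonneg op_norm_nonneg fin integral_nonneg\<close>)
  finally show ?thesis by (simp add: F_def)
qed

end

end

section \<open>The lower bound for one mode\<close>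

text \<open>Terms odd in the new sign cancel. The average of \<open>W^2\<close> turns into that of
  \<open>(W + u)^2 + 4 D^2\<close>, and Cauchy-Schwarz gives \<open>D^2 \<le> u W\<close>; the cross
  term \<open>6 u V\<close> that results is the one in \<open>3 (V + u)^2\<close>, so the constant 3
  closes the induction.\<close>

lemma rad_second_fourth_moment:
  fixes a :: "'k \<Rightarrow> 'c \<Rightarrow> real" and J :: "'c set"
  assumes "finite K"
  defines "W \<equiv> \<lambda>K s. \<Sum>c\<in>J. (\<Sum>k\<in>K. s k * a k c)\<^sup>2"
    and "V \<equiv> \<lambda>K. \<Sum>k\<in>K. \<Sum>c\<in>J. (a k c)\<^sup>2"
  shows "rad K (W K) = V K \<and> rad K (\<lambda>s. (W K s)\<^sup>2) \<le> 3 * (V K)\<^sup>2"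
  using assms(1)
proof (induction K rule: finite_induct)
  case empty
  then show ?case by (simp add: rad_empty W_def V_def)
next
  case (insert j K)
  define T where "T s c = (\<Sum>k\<in>K. s k * a k c)" for s c
  define D where "D s = (\<Sum>c\<in>J. a j c * T s c)" for s
  define u where "u = (\<Sum>c\<in>J. (a j c)\<^sup>2)"
  have V: "V (insert j K) = V K + u" using insert by (simp add: V_def u_def)
  have W: "W (insert j K) (s(j := e)) = W K s + 2 * e * D s + e\<^sup>2 * u" for s e
  proof -
    have "(\<Sum>k\<in>insert j K. (s(j := e)) k * a k c) = T s c + e * a j c" for c
    proof -
      have "(\<Sum>k\<in>K. (s(j := e)) k * a k c) = T s c"
        unfolding T_def using insert by (intro sum.cong) auto
      then show ?thesis using insert by simp
    qed
    then have "W (insert j K) (s(j := e)) = (\<Sum>c\<in>J. (T s c)\<^sup>2 + 2 * e * (a j c * T s c) + e\<^sup>2 * (a j c)\<^sup>2)"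
      unfolding W_def by (intro sum.cong) (auto simp: power2_eq_square algebra_simps)
    then show ?thesis by (simp add: sum.distrib sum_distrib_left W_def T_def D_def u_def)
  qed
  have D: "(D s)\<^sup>2 \<le> u * W K s" for s
  proof -
    have "\<bar>D s\<bar>\<^sup>2 \<le> (L2_set (a j) J * L2_set (T s) J)\<^sup>2"
      unfolding D_def by (intro power_mono cauchy_schwarz_sum) simp
    then show ?thesis by (simp add: power_mult_distrib L2_set_power2 u_def W_def T_def)
  qed
  have "rad (insert j K) (W (insert j K)) = (rad K (\<lambda>s. W K s + 2 * 1 * D s + 1\<^sup>2 * u) + rad K (\<lambda>s. W K s + 2 * (- 1) * D s + (- 1)\<^sup>2 * u)) / 2"
    unfolding rad_insert[OF insert(1,2)] W ..
  also have "\<dots> = rad K (W K) + u"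
    by (simp only: rad_add rad_cmult rad_const[OF insert(1)]) simp
  finally have first: "rad (insert j K) (W (insert j K)) = V (insert j K)"
    using insert by (simp add: V)
  have "rad (insert j K) (\<lambda>s. (W (insert j K) s)\<^sup>2)
      = (rad K (\<lambda>s. (W K s + 2 * 1 * D s + 1\<^sup>2 * u)\<^sup>2) + rad K (\<lambda>s. (W K s + 2 * (- 1) * D s + (- 1)\<^sup>2 * u)\<^sup>2)) / 2"
    unfolding rad_insert[OF insert(1,2)] W ..
  also have "\<dots> = rad K (\<lambda>s. (W K s + u)\<^sup>2 + 4 * (D s)\<^sup>2)"
  proof -
    have "rad K (\<lambda>s. (W K s + 2 * 1 * D s + 1\<^sup>2 * u)\<^sup>2) + rad K (\<lambda>s. (W K s + 2 * (- 1) * D s + (- 1)\<^sup>2 * u)\<^sup>2)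
      = rad K (\<lambda>s. 2 * ((W K s + u)\<^sup>2 + 4 * (D s)\<^sup>2))"
      unfolding rad_add[symmetric] by (rule rad_cong) (simp add: power2_eq_square algebra_simps)
    also have "\<dots> = 2 * rad K (\<lambda>s. (W K s + u)\<^sup>2 + 4 * (D s)\<^sup>2)" by (rule rad_cmult)
    finally show ?thesis by (simp only: nonzero_mult_div_cancel_left[OF zero_neq_numeral[symmetric]])
  qed
  also have "\<dots> \<le> rad K (\<lambda>s. (W K s)\<^sup>2 + 6 * u * W K s + u\<^sup>2)"
  proof (rule rad_mono)
    fix s show "(W K s + u)\<^sup>2 + 4 * (D s)\<^sup>2 \<le> (W K s)\<^sup>2 + 6 * u * W K s + u\<^sup>2"
      using D[of s] by (simp add: power2_eq_square algebra_simps)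
  qed
  also have "\<dots> = rad K (\<lambda>s. (W K s)\<^sup>2) + 6 * u * V K + u\<^sup>2"
    using insert.IH by (simp only: rad_add rad_cmult rad_const[OF insert(1)])
  also have "\<dots> \<le> 3 * (V K)\<^sup>2 + 6 * u * V K + 3 * u\<^sup>2"
    using insert.IH by (intro add_mono) auto
  also have "\<dots> = 3 * (V (insert j K))\<^sup>2" by (simp add: V power2_eq_square algebra_simps)
  finally show ?case using first by blast
qed

text \<open>The first moment is bounded below by the second and the fourth through a polynomial
  minorant of the square root that touches it at \<open>t^2\<close>.\<close>

lemma rad_L2_set_lower:
  fixes a :: "'k \<Rightarrow> 'c \<Rightarrow> real"
  assumes "finite K"
  shows "sqrt (\<Sum>k\<in>K. \<Sum>c\<in>J. (a k c)\<^sup>2) / sqrt 3 \<le> rad K (\<lambda>s. L2_set (\<lambda>c. \<Sum>k\<in>K. s k * a k c) J)"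
proof -
  define W where "W s = (\<Sum>c\<in>J. (\<Sum>k\<in>K. s k * a k c)\<^sup>2)" for s
  define V where "V = (\<Sum>k\<in>K. \<Sum>c\<in>J. (a k c)\<^sup>2)"
  have mom: "rad K W = V" "rad K (\<lambda>s. (W s)\<^sup>2) \<le> 3 * V\<^sup>2"
    using rad_second_fourth_moment[OF assms, of a J] by (simp_all add: W_def[abs_def] V_def)
  have W0: "0 \<le> W s" for s by (simp add: W_def sum_nonneg)
  show ?thesis
  proof (cases "V = 0")
    case True
    then show ?thesis by (simp add: V_def rad_nonneg)
  next
    case False
    then have V: "V > 0" by (simp add: V_def sum_nonneg less_le)
    \<comment> \<open>Given a second moment \<open>V\<close> and the bound \<open>3 V^2\<close> on
      the fourth, \<open>t^2 = 3 V\<close> maximises the lower bound that results.\<close>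
    define t where "t = sqrt (3 * V)"
    have t: "t > 0" "t\<^sup>2 = 3 * V" using V by (simp_all add: t_def)
    have ptw: "3 / (2 * t) * W s - 1 / (2 * t ^ 3) * (W s)\<^sup>2 \<le> sqrt (W s)" for s
    proof -
      define x where "x = sqrt (W s) / t"
      have x: "0 \<le> x" using W0 t by (simp add: x_def)
      have sW: "sqrt (W s) = t * x" using t(1) by (simp add: x_def)
      have "W s = (sqrt (W s))\<^sup>2" using W0[of s] by simp
      then have W: "W s = t\<^sup>2 * x\<^sup>2" by (simp only: sW power_mult_distrib)
      \<comment> \<open>With \<open>W s = t^2 x^2\<close> the claim is
        \<open>3 x^2 - x^4 \<le> 2 x\<close> for \<open>x \<ge> 0\<close>; the difference of the
        sides factors, with a double zero at the point of contact.\<close>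
      have "0 \<le> x * (x - 1)\<^sup>2 * (x + 2)" using x by simp
      also have "\<dots> = 2 * x - 3 * x\<^sup>2 + x ^ 4" by (simp add: power2_eq_square power4_eq_xxxx algebra_simps)
      finally have "t * (3 * x\<^sup>2 - x ^ 4) / 2 \<le> t * (2 * x) / 2"
        using t by (intro divide_right_mono mult_left_mono) auto
      moreover have "3 / (2 * t) * W s - 1 / (2 * t ^ 3) * (W s)\<^sup>2 = t * (3 * x\<^sup>2 - x ^ 4) / 2"
        unfolding W using t(1) by (simp add: field_simps power2_eq_square power3_eq_cube power4_eq_xxxx)
      ultimately show ?thesis by (simp add: sW)
    qed
    have "sqrt V / sqrt 3 = 3 / (2 * t) * V - 1 / (2 * t ^ 3) * (3 * V\<^sup>2)"
    proof -
      have t3: "t ^ 3 = 3 * V * t" using t by (simp add: power3_eq_cube power2_eq_square)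
      have "sqrt V / sqrt 3 = V / t"
        using V by (simp add: t_def real_sqrt_mult field_simps)
      moreover have "3 / (2 * t) * V - 1 / (2 * (3 * V * t)) * (3 * V\<^sup>2) = V / t"
        using V t by (simp add: field_simps power2_eq_square)
      ultimately show ?thesis by (simp only: t3)
    qed
    also have "\<dots> \<le> 3 / (2 * t) * rad K W - 1 / (2 * t ^ 3) * rad K (\<lambda>s. (W s)\<^sup>2)"
      unfolding mom(1) using t by (intro diff_left_mono mult_left_mono mom) auto
    also have "\<dots> = rad K (\<lambda>s. 3 / (2 * t) * W s - 1 / (2 * t ^ 3) * (W s)\<^sup>2)"
      by (simp only: rad_diff rad_cmult)
    also have "\<dots> \<le> rad K (\<lambda>s. sqrt (W s))" by (intro rad_mono ptw)
    finally show ?thesis by (simp add: W_def V_def L2_set_def)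
  qed
qed

context centered_law
begin

text \<open>Signs can be inserted at the cost of a factor 2. For fixed \<open>x\<close> the average
  over the signs is then bounded below by Khintchine's inequality, and the resulting square root by
  a linear function of the \<open>\<bar>x k\<bar>\<close>, so that only first absolute moments are
  integrated.\<close>

theorem L2_set_comb_lower:
  fixes a :: "'k :: countable \<Rightarrow> 'c \<Rightarrow> real"
  assumes K: "finite K"
  shows "(\<integral>y. \<bar>y\<bar> \<partial>\<mu>) / (2 * sqrt 3) * sqrt (\<Sum>k\<in>K. \<Sum>c\<in>J. (a k c)\<^sup>2)
    \<le> (\<integral>x. L2_set (\<lambda>c. \<Sum>k\<in>K. x k * a k c) J \<partial>product_law K)"
proof -
  define F where "F x = L2_set (\<lambda>c. \<Sum>k\<in>K. x k * a k c) J" for x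
  define w where "w k = (\<Sum>c\<in>J. (a k c)\<^sup>2)" for k
  define V where "V = (\<Sum>k\<in>K. w k)"
  have w: "0 \<le> w k" for k by (simp add: w_def sum_nonneg)
  have tri: "F (\<lambda>k. x k + y k) \<le> F x + F y" for x y
    unfolding F_def by (simp add: distrib_right sum.distrib L2_set_triangle_ineq)
  have scale: "F (\<lambda>k. b * x k) = \<bar>b\<bar> * F x" for b x
    unfolding F_def by (simp add: sum_distrib_left[symmetric] mult.assoc L2_set_scale)
  have "\<exists>L. convex_lip L K F"
  proof (rule seminorm_convex_lip[OF K tri])
    show "F x = F y" if "\<And>k. k \<in> K \<Longrightarrow> x k = y k" for x y
      unfolding F_def using that by (intro L2_set_cong) auto
  qed (simp add: scale)
  then obtain L where F: "convex_lip L K F" ..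
  have intF: "integrable (product_law K) (\<lambda>x. F (\<lambda>k. b k * x k))" for b
    by (rule integrable_convex_lip[OF F])
  let ?E = "\<integral>x. F x \<partial>product_law K"
  have signs: "(\<integral>x. F (\<lambda>k. s k * x k) \<partial>product_law K) \<le> 2 * ?E" if "s \<in> PiE K (\<lambda>_. {- 1, 1})" for s
  proof -
    \<comment> \<open>The coordinates with sign 1 and those with sign -1: each part is a zeroing of
      the full vector.\<close>
    define p q where "p k = (if s k = 1 then 1 else 0 :: real)" and "q k = (if s k = 1 then 0 else 1 :: real)" for k
    have pq: "p k = 0 \<or> p k = 1" "q k = 0 \<or> q k = 1" for k by (simp_all add: p_def q_def)
    have "(\<integral>x. F (\<lambda>k. s k * x k) \<partial>product_law K)
        \<le> (\<integral>x. F (\<lambda>k. p k * x k) + F (\<lambda>k. q k * x k) \<partial>product_law K)"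
    proof (rule integral_mono)
      fix x
      have "F (\<lambda>k. s k * x k) = F (\<lambda>k. p k * x k + - 1 * (q k * x k))"
        by (rule convex_lip_cong[OF F]) (use that in \<open>auto simp: p_def q_def PiE_iff\<close>)
      also have "\<dots> \<le> F (\<lambda>k. p k * x k) + F (\<lambda>k. - 1 * (q k * x k))" by (rule tri)
      finally show "F (\<lambda>k. s k * x k) \<le> F (\<lambda>k. p k * x k) + F (\<lambda>k. q k * x k)"
        unfolding scale by simp
    qed (intro Bochner_Integration.integrable_add intF)+
    also have "\<dots> = (\<integral>x. F (\<lambda>k. p k * x k) \<partial>product_law K) + (\<integral>x. F (\<lambda>k. q k * x k) \<partial>product_law K)"
      by (rule Bochner_Integration.integral_add) (rule intF)+
    also have "\<dots> \<le> ?E + ?E"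
      using zeroing[OF K F, of p, OF pq(1)] zeroing[OF K F, of q, OF pq(2)] by simp
    finally show ?thesis by simp
  qed
  \<comment> \<open>Cauchy-Schwarz with the weights \<open>w k\<close> linearises the square root;
    the normalisation makes the expectation of the sum equal to \<open>sqrt V\<close> times the
    first absolute moment. For \<open>V = 0\<close> division by zero makes the left side 0.\<close>
  have ptw: "1 / sqrt 3 * (\<Sum>k\<in>K. w k / sqrt V * \<bar>x k\<bar>) \<le> rad K (\<lambda>s. F (\<lambda>k. s k * x k))" for x
  proof (cases "V = 0")
    case True
    then show ?thesis by (simp add: rad_nonneg F_def)
  next
    case False
    then have V: "V > 0" using w by (simp add: V_def sum_nonneg less_le)
    have "(\<Sum>k\<in>K. w k / sqrt V * \<bar>x k\<bar>) = (\<Sum>k\<in>K. sqrt (w k) * (sqrt (w k) * \<bar>x k\<bar>)) / sqrt V"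
      unfolding sum_divide_distrib by (intro sum.cong) (auto simp: mult.assoc[symmetric] w)
    also have "\<dots> \<le> (L2_set (\<lambda>k. sqrt (w k)) K * L2_set (\<lambda>k. sqrt (w k) * \<bar>x k\<bar>) K) / sqrt V"
      by (intro divide_right_mono order_trans[OF abs_ge_self cauchy_schwarz_sum]) (use V in simp)
    also have "L2_set (\<lambda>k. sqrt (w k)) K = sqrt V" by (simp add: L2_set_def V_def w)
    also have "sqrt V * L2_set (\<lambda>k. sqrt (w k) * \<bar>x k\<bar>) K / sqrt V = sqrt (\<Sum>k\<in>K. w k * (x k)\<^sup>2)"
      using V by (simp add: L2_set_def power_mult_distrib w)
    finally have "1 / sqrt 3 * (\<Sum>k\<in>K. w k / sqrt V * \<bar>x k\<bar>) \<le> sqrt (\<Sum>k\<in>K. w k * (x k)\<^sup>2) / sqrt 3"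
      by (simp add: divide_right_mono)
    also have "(\<Sum>k\<in>K. w k * (x k)\<^sup>2) = (\<Sum>k\<in>K. \<Sum>c\<in>J. (x k * a k c)\<^sup>2)"
      by (simp add: w_def sum_distrib_left power_mult_distrib mult.commute)
    also have "sqrt \<dots> / sqrt 3 \<le> rad K (\<lambda>s. L2_set (\<lambda>c. \<Sum>k\<in>K. s k * (x k * a k c)) J)"
      by (rule rad_L2_set_lower[OF K])
    also have "\<dots> = rad K (\<lambda>s. F (\<lambda>k. s k * x k))" by (simp add: F_def mult.assoc)
    finally show ?thesis .
  qed
  have int_abs: "integrable \<mu> (\<lambda>y. \<bar>y\<bar>)" using integrable_law by simp
  have "(\<integral>y. \<bar>y\<bar> \<partial>\<mu>) / sqrt 3 * sqrt V = 1 / sqrt 3 * (\<Sum>k\<in>K. w k / sqrt V * (\<integral>y. \<bar>y\<bar> \<partial>\<mu>))"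
  proof -
    have "0 \<le> V" using w by (simp add: V_def sum_nonneg)
    then have "sqrt V = (\<Sum>k\<in>K. w k) / sqrt V" by (simp add: V_def[symmetric] real_div_sqrt)
    also have "\<dots> = (\<Sum>k\<in>K. w k / sqrt V)" by (rule sum_divide_distrib)
    finally have root: "sqrt V = (\<Sum>k\<in>K. w k / sqrt V)" .
    show ?thesis by (subst root) (simp add: sum_distrib_left sum_divide_distrib mult_ac)
  qed
  also have "\<dots> = (\<integral>x. 1 / sqrt 3 * (\<Sum>k\<in>K. w k / sqrt V * \<bar>x k\<bar>) \<partial>product_law K)"
  proof -
    have "(\<integral>x. (\<Sum>k\<in>K. w k / sqrt V * \<bar>x k\<bar>) \<partial>product_law K) = (\<Sum>k\<in>K. \<integral>x. w k / sqrt V * \<bar>x k\<bar> \<partial>product_law K)"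
      by (rule Bochner_Integration.integral_sum) (intro integrable_mult_right integrable_coordinate(1)[OF _ int_abs])
    also have "\<dots> = (\<Sum>k\<in>K. w k / sqrt V * (\<integral>y. \<bar>y\<bar> \<partial>\<mu>))"
      by (intro sum.cong refl) (simp only: integral_mult_right_zero integrable_coordinate(2)[OF _ int_abs])
    finally show ?thesis by (simp only: integral_mult_right_zero)
  qed
  also have "\<dots> \<le> (\<integral>x. rad K (\<lambda>s. F (\<lambda>k. s k * x k)) \<partial>product_law K)"
  proof (rule integral_mono)
    show "integrable (product_law K) (\<lambda>x. 1 / sqrt 3 * (\<Sum>k\<in>K. w k / sqrt V * \<bar>x k\<bar>))"
      by (intro integrable_mult_right Bochner_Integration.integrable_sum integrable_coordinate(1)[OF _ int_abs])
    show "integrable (product_law K) (\<lambda>x. rad K (\<lambda>s. F (\<lambda>k. s k * x k)))"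
      unfolding rad_def using intF by (intro integrable_divide Bochner_Integration.integrable_sum) auto
  qed (rule ptw)
  also have "\<dots> = rad K (\<lambda>s. \<integral>x. F (\<lambda>k. s k * x k) \<partial>product_law K)"
    by (rule integral_rad[OF intF, symmetric])
  also have "\<dots> \<le> rad K (\<lambda>s. 2 * ?E)" by (intro rad_mono signs)
  also have "\<dots> = 2 * ?E" by (rule rad_const[OF K])
  finally show ?thesis by (simp add: F_def V_def w_def field_simps)
qed

context
  fixes I :: "'r set" and J :: "'c set" and K :: "'k :: countable set" and B :: "'k \<Rightarrow> 'r \<Rightarrow> 'c \<Rightarrow> real"
  assumes fin: "finite I" "finite J" "finite K"
begin

text \<open>The unit vector is fixed before integrating; the supremum over it is taken afterwards,
  outside of the expectation.\<close>

theorem matrix_comb_lower_col: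
  assumes x: "L2_set x J \<le> 1"
  shows "(\<integral>y. \<bar>y\<bar> \<partial>\<mu>) / (2 * sqrt 3) * sqrt (\<Sum>k\<in>K. \<Sum>r\<in>I. (\<Sum>c\<in>J. B k r c * x c)\<^sup>2)
    \<le> (\<integral>z. op_norm I J (matrix_comb K B z) \<partial>product_law K)"
proof -
  have eq: "(\<Sum>k\<in>K. z k * (\<Sum>c\<in>J. B k r c * x c)) = (\<Sum>c\<in>J. matrix_comb K B z r c * x c)" for z r
    by (simp add: matrix_comb_def sum_distrib_left sum_distrib_right mult.assoc) (rule sum.swap)
  have le: "L2_set (\<lambda>r. \<Sum>k\<in>K. z k * (\<Sum>c\<in>J. B k r c * x c)) I \<le> op_norm I J (matrix_comb K B z)" for z
    unfolding eq by (rule op_norm_upper1[OF fin(1,2) x])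
  show ?thesis
    using L2_set_comb_lower[OF fin(3), of "\<lambda>k r. \<Sum>c\<in>J. B k r c * x c" I]
  proof (rule order_trans)
    show "(\<integral>z. L2_set (\<lambda>r. \<Sum>k\<in>K. z k * (\<Sum>c\<in>J. B k r c * x c)) I \<partial>product_law K)
        \<le> (\<integral>z. op_norm I J (matrix_comb K B z) \<partial>product_law K)"
      by (rule integral_mono') (use integrable_op_norm_comb[OF fin] le op_norm_nonneg fin in auto)
  qed
qed

theorem matrix_comb_lower_row:
  assumes u: "L2_set u I \<le> 1"
  shows "(\<integral>y. \<bar>y\<bar> \<partial>\<mu>) / (2 * sqrt 3) * sqrt (\<Sum>k\<in>K. \<Sum>c\<in>J. (\<Sum>r\<in>I. B k r c * u r)\<^sup>2)
    \<le> (\<integral>z. op_norm I J (matrix_comb K B z) \<partial>product_law K)"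
proof -
  have eq: "(\<Sum>k\<in>K. z k * (\<Sum>r\<in>I. B k r c * u r)) = (\<Sum>r\<in>I. matrix_comb K B z r c * u r)" for z c
    by (simp add: matrix_comb_def sum_distrib_left sum_distrib_right mult.assoc) (rule sum.swap)
  have le: "L2_set (\<lambda>c. \<Sum>k\<in>K. z k * (\<Sum>r\<in>I. B k r c * u r)) J \<le> op_norm I J (matrix_comb K B z)" for z
    unfolding eq op_norm_transpose[OF fin(1,2), symmetric] by (rule op_norm_upper1[OF fin(2,1) u])
  show ?thesis
    using L2_set_comb_lower[OF fin(3), of "\<lambda>k c. \<Sum>r\<in>I. B k r c * u r" J]
  proof (rule order_trans)
    show "(\<integral>z. L2_set (\<lambda>c. \<Sum>k\<in>K. z k * (\<Sum>r\<in>I. B k r c * u r)) J \<partial>product_law K)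
        \<le> (\<integral>z. op_norm I J (matrix_comb K B z) \<partial>product_law K)"
      by (rule integral_mono') (use integrable_op_norm_comb[OF fin] le op_norm_nonneg fin in auto)
  qed
qed

end

end

subsection \<open>Integrating out one mode at a time\<close>

lemma op_norm_reindex_le:
  assumes "finite I" "finite J" "finite I'" "finite J'" and f: "bij_betw f I I'" and g: "bij_betw g J J'"
  shows "op_norm I J (\<lambda>r c. B (f r) (g c)) \<le> op_norm I' J' B"
proof (rule op_norm_least[OF assms(1,2)])
  fix x assume x: "L2_set x J \<le> 1"
  define y where "y = (\<lambda>c. x (inv_into J g c))"
  have y: "y (g c) = x c" if "c \<in> J" for c
    using that g by (simp add: y_def bij_betw_def)
  have "(\<Sum>c\<in>J'. (y c)\<^sup>2) = (\<Sum>c\<in>J. (x c)\<^sup>2)"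
    using sum.reindex_bij_betw[OF g, of "\<lambda>c. (y c)\<^sup>2"] y by (simp cong: sum.cong)
  then have "L2_set y J' \<le> 1" using x by (simp add: L2_set_def)
  then have "L2_set (\<lambda>r. \<Sum>c\<in>J'. B r c * y c) I' \<le> op_norm I' J' B"
    by (rule op_norm_upper1[OF assms(3,4)])
  moreover have "(\<Sum>c\<in>J'. B r c * y c) = (\<Sum>c\<in>J. B r (g c) * x c)" for r
    using sum.reindex_bij_betw[OF g, of "\<lambda>c. B r c * y c"] y by (simp cong: sum.cong)
  moreover have "L2_set (\<lambda>r. \<Sum>c\<in>J. B r (g c) * x c) I' = L2_set (\<lambda>r. \<Sum>c\<in>J. B (f r) (g c) * x c) I"
    using sum.reindex_bij_betw[OF f, of "\<lambda>r. (\<Sum>c\<in>J. B r (g c) * x c)\<^sup>2"] by (simp add: L2_set_def)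
  ultimately show "L2_set (\<lambda>r. \<Sum>c\<in>J. B (f r) (g c) * x c) I \<le> op_norm I' J' B" by simp
qed

lemma op_norm_reindex:
  assumes fin: "finite I" "finite J" "finite I'" "finite J'" and f: "bij_betw f I I'" and g: "bij_betw g J J'"
  shows "op_norm I J (\<lambda>r c. B (f r) (g c)) = op_norm I' J' B"
proof (rule antisym[OF op_norm_reindex_le[OF assms]])
  let ?f = "inv_into I f" and ?g = "inv_into J g"
  have "op_norm I' J' B = op_norm I' J' (\<lambda>r c. B (f (?f r)) (g (?g c)))"
    by (rule op_norm_cong) (simp add: bij_betw_inv_into_right[OF f] bij_betw_inv_into_right[OF g])
  also have "\<dots> \<le> op_norm I J (\<lambda>r c. B (f r) (g c))"
    by (rule op_norm_reindex_le[where B = "\<lambda>r c. B (f r) (g c)"]) (use fin f g bij_betw_inv_into in auto)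
  finally show "op_norm I' J' B \<le> op_norm I J (\<lambda>r c. B (f r) (g c))" .
qed

text \<open>The entries are enumerated by natural numbers, so that the norm becomes a convex
  Lipschitz function of countably indexed coordinates. Multi-indices, for which this is used, form
  an uncountable type.\<close>

lemma borel_measurable_op_norm:
  assumes fin: "finite I" "finite J" and M: "\<And>r c. r \<in> I \<Longrightarrow> c \<in> J \<Longrightarrow> (\<lambda>\<omega>. Y \<omega> r c) \<in> borel_measurable M"
  shows "(\<lambda>\<omega>. op_norm I J (Y \<omega>)) \<in> borel_measurable M"
proof -
  define N where "N = card (I \<times> J)"
  obtain h where h: "bij_betw h {0..<N} (I \<times> J)"
    using ex_bij_betw_nat_finite[of "I \<times> J"] fin by (auto simp: N_def)
  define B where "B k r c = (if h k = (r, c) then 1 else 0 :: real)" for k r c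
  define w where "w \<omega> k = Y \<omega> (fst (h k)) (snd (h k))" for \<omega> k
  obtain L where L: "convex_lip L {0..<N} (\<lambda>x. op_norm I J (matrix_comb {0..<N} B x))"
    using op_norm_comb_convex_lip[OF fin, of "{0..<N}" B] by auto
  have "(\<lambda>\<omega>. op_norm I J (matrix_comb {0..<N} B (w \<omega>))) \<in> borel_measurable M"
  proof (rule convex_lip_measurable[OF L])
    fix k assume "k \<in> {0..<N}"
    then have "h k \<in> I \<times> J" using bij_betwE[OF h] by blast
    then show "(\<lambda>\<omega>. w \<omega> k) \<in> borel_measurable M"
      unfolding w_def by (intro M) (simp_all add: mem_Times_iff)
  qed
  moreover have "op_norm I J (matrix_comb {0..<N} B (w \<omega>)) = op_norm I J (Y \<omega>)" for \<omega>
  proof (rule op_norm_cong)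
    fix r c assume rc: "r \<in> I" "c \<in> J"
    have "matrix_comb {0..<N} B (w \<omega>) r c = (\<Sum>k\<in>{0..<N}. (\<lambda>z. if z = (r, c) then Y \<omega> r c else 0) (h k))"
      unfolding matrix_comb_def by (intro sum.cong) (auto simp: B_def w_def)
    also have "\<dots> = (\<Sum>z\<in>I \<times> J. if z = (r, c) then Y \<omega> r c else 0)"
      by (rule sum.reindex_bij_betw[OF h])
    also have "\<dots> = Y \<omega> r c" using fin rc by simp
    finally show "matrix_comb {0..<N} B (w \<omega>) r c = Y \<omega> r c" .
  qed
  ultimately show ?thesis by simp
qed

lemma sum_PiE_insert:
  assumes "t \<notin> P"
  shows "(\<Sum>i\<in>PiE (insert t P) n. f i) = (\<Sum>k\<in>n t. \<Sum>i\<in>PiE P n. f (i(t := k)))"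
proof -
  have inj: "inj_on (\<lambda>(y, g). g(t := y)) (n t \<times> PiE P n)"
    by (rule inj_combinator[OF assms])
  show ?thesis
    unfolding PiE_insert_eq sum.reindex[OF inj]
    by (simp add: sum.cartesian_product case_prod_unfold)
qed

section \<open>Slices and stackings of a partially integrated chaos\<close>

text \<open>The default \<open>undefined\<close> makes this agree with \<open>merge R C\<close> when
  \<open>P\<close> is empty.\<close>

definition glue :: "nat set \<Rightarrow> nat set \<Rightarrow> nat set \<Rightarrow> (nat \<Rightarrow> nat) \<Rightarrow> (nat \<Rightarrow> nat) \<Rightarrow> (nat \<Rightarrow> nat) \<Rightarrow> nat \<Rightarrow> nat" where
  "glue P R C i r c t = (if t \<in> P then i t else if t \<in> R then r t else if t \<in> C then c t else undefined)"

text \<open>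
  The modes in \<open>P\<close> are still random. The other modes have been moved to the rows \<open>R\<close> or to
  the columns \<open>C\<close>: for \<open>P = {}\<close> this is a flattening.
\<close>

definition partial_chaos ::
    "(nat \<Rightarrow> nat set) \<Rightarrow> ((nat \<Rightarrow> nat) \<Rightarrow> real) \<Rightarrow> nat set \<Rightarrow> nat set \<Rightarrow> nat set
      \<Rightarrow> (nat \<times> nat \<Rightarrow> real) \<Rightarrow> (nat \<Rightarrow> nat) \<Rightarrow> (nat \<Rightarrow> nat) \<Rightarrow> real" where
  "partial_chaos n A P R C x r c =
     (\<Sum>i\<in>PiE P n. (\<Prod>t\<in>P. x (t, i t)) * A (glue P R C i r c))"

lemma partial_chaos_cong:
  assumes "\<And>t k. t \<in> P \<Longrightarrow> k \<in> n t \<Longrightarrow> x (t, k) = y (t, k)"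
  shows "partial_chaos n A P R C x = partial_chaos n A P R C y"
  unfolding partial_chaos_def
  by (intro ext sum.cong refl arg_cong2[where f = "(*)"] prod.cong assms) (auto simp: PiE_iff)

lemma partial_chaos_insert:
  assumes P: "finite P" "t \<notin> P" "t \<notin> R" "t \<notin> C"
  shows "partial_chaos n A (insert t P) R C x r c
    = (\<Sum>k\<in>n t. x (t, k) * partial_chaos n A P (insert t R) C x (r(t := k)) c)"
proof -
  have prod: "(\<Prod>s\<in>insert t P. x (s, (i(t := k)) s)) = x (t, k) * (\<Prod>s\<in>P. x (s, i s))" for i k
  proof -
    have "(\<Prod>s\<in>P. x (s, (i(t := k)) s)) = (\<Prod>s\<in>P. x (s, i s))"
      using P by (intro prod.cong) auto
    then show ?thesis using P by simp
  qed
  have glue: "glue (insert t P) R C (i(t := k)) r c = glue P (insert t R) C i (r(t := k)) c" for i k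
    using P by (auto simp: glue_def fun_eq_iff)
  show ?thesis
    unfolding partial_chaos_def sum_PiE_insert[OF P(2)] prod glue
    by (simp add: sum_distrib_left mult.assoc)
qed

text \<open>The index of mode \<open>t\<close> may be read as part of the row or of the column; so
  one family of slices serves both stackings.\<close>

lemma partial_chaos_row_col:
  assumes "t \<notin> P" "t \<notin> R" "t \<notin> C"
  shows "partial_chaos n A P (insert t R) C x (r(t := k)) c = partial_chaos n A P R (insert t C) x r (c(t := k))"
proof -
  have "glue P (insert t R) C i (r(t := k)) c = glue P R (insert t C) i r (c(t := k))" for i
    using assms by (auto simp: glue_def fun_eq_iff)
  then show ?thesis by (simp add: partial_chaos_def)
qed

context
  fixes n :: "nat \<Rightarrow> nat set" and A :: "(nat \<Rightarrow> nat) \<Rightarrow> real" and P R C :: "nat set" and t :: nat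
    and x :: "nat \<times> nat \<Rightarrow> real"
  assumes n: "\<And>t. finite (n t)" and fin: "finite P" "finite R" "finite C"
    and t: "t \<notin> P" "t \<notin> R" "t \<notin> C"
begin

text \<open>The slice at one value of mode \<open>t\<close>, with the other random modes held at
  \<open>x\<close>. It is indexed by the pair of mode and value, to match the coordinates of the
  product law.\<close>

definition mode_matrix :: "nat \<times> nat \<Rightarrow> (nat \<Rightarrow> nat) \<Rightarrow> (nat \<Rightarrow> nat) \<Rightarrow> real" where
  "mode_matrix z r c = partial_chaos n A P (insert t R) C x (r(t := snd z)) c"

lemma partial_chaos_eq_comb:
  "partial_chaos n A (insert t P) R C (merge (Sigma P n) ({t} \<times> n t) (x, y))
    = matrix_comb ({t} \<times> n t) mode_matrix y"
proof (intro ext)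
  fix r c
  let ?z = "merge (Sigma P n) ({t} \<times> n t) (x, y)"
  have x: "partial_chaos n A P (insert t R) C ?z = partial_chaos n A P (insert t R) C x"
    by (rule partial_chaos_cong) (simp add: merge_def)
  have y: "?z (t, k) = y (t, k)" if "k \<in> n t" for k using that t by (simp add: merge_def)
  have "partial_chaos n A (insert t P) R C ?z r c
      = (\<Sum>k\<in>n t. y (t, k) * mode_matrix (t, k) r c)"
    unfolding partial_chaos_insert[OF fin(1) t] x mode_matrix_def using y by (intro sum.cong) auto
  also have "\<dots> = matrix_comb ({t} \<times> n t) mode_matrix y r c"
    unfolding matrix_comb_def
    using sum.cartesian_product[of "\<lambda>s k. y (s, k) * mode_matrix (s, k) r c" "n t" "{t}"]
    by (simp add: case_prod_unfold)
  finally show "partial_chaos n A (insert t P) R C ?z r c = matrix_comb ({t} \<times> n t) mode_matrix y r c" .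
qed

lemma sum_mode_PiE:
  assumes "t \<notin> S"
  shows "(\<Sum>z\<in>{t} \<times> n t. \<Sum>r\<in>PiE S n. g (r(t := snd z))) = (\<Sum>r\<in>PiE (insert t S) n. g r)"
  unfolding sum_PiE_insert[OF assms]
  using sum.cartesian_product[of "\<lambda>s k. \<Sum>r\<in>PiE S n. g (r(t := k))" "n t" "{t}"]
  by (simp add: case_prod_unfold)

lemma finite_PiE_n: "finite S \<Longrightarrow> finite (PiE S n)"
  by (rule finite_PiE) (auto simp: n)

lemma mode_matrix_row:
  "(\<Sum>z\<in>{t} \<times> n t. \<Sum>r\<in>PiE R n. (\<Sum>c\<in>PiE C n. mode_matrix z r c * w c)\<^sup>2)
    = (L2_set (\<lambda>r. \<Sum>c\<in>PiE C n. partial_chaos n A P (insert t R) C x r c * w c) (PiE (insert t R) n))\<^sup>2"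
  unfolding L2_set_power2 mode_matrix_def by (rule sum_mode_PiE[OF t(2)])

lemma mode_matrix_col:
  "(\<Sum>z\<in>{t} \<times> n t. \<Sum>c\<in>PiE C n. (\<Sum>r\<in>PiE R n. mode_matrix z r c * w r)\<^sup>2)
    = (L2_set (\<lambda>c. \<Sum>r\<in>PiE R n. partial_chaos n A P R (insert t C) x r c * w r) (PiE (insert t C) n))\<^sup>2"
  unfolding L2_set_power2 mode_matrix_def partial_chaos_row_col[OF t] by (rule sum_mode_PiE[OF t(3)])

lemma mode_matrix_row_le:
  "(\<Sum>z\<in>{t} \<times> n t. \<Sum>r\<in>PiE R n. (\<Sum>c\<in>PiE C n. mode_matrix z r c * w c)\<^sup>2)
    \<le> (op_norm (PiE (insert t R) n) (PiE C n) (partial_chaos n A P (insert t R) C x))\<^sup>2 * (\<Sum>c\<in>PiE C n. (w c)\<^sup>2)"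
  unfolding mode_matrix_row L2_set_power2[of w, symmetric] power_mult_distrib[symmetric]
  by (intro power_mono op_norm_upper) (use fin finite_PiE_n in auto)

lemma mode_matrix_col_le:
  "(\<Sum>z\<in>{t} \<times> n t. \<Sum>c\<in>PiE C n. (\<Sum>r\<in>PiE R n. mode_matrix z r c * w r)\<^sup>2)
    \<le> (op_norm (PiE R n) (PiE (insert t C) n) (partial_chaos n A P R (insert t C) x))\<^sup>2 * (\<Sum>r\<in>PiE R n. (w r)\<^sup>2)"
proof -
  have fin': "finite (PiE R n)" "finite (PiE (insert t C) n)" using fin finite_PiE_n by auto
  show ?thesis
    unfolding mode_matrix_col L2_set_power2[of w, symmetric] power_mult_distrib[symmetric]
      op_norm_transpose[OF fin', symmetric]
    by (intro power_mono op_norm_upper) (use fin' in auto)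
qed

end

context centered_law
begin

lemma borel_measurable_partial_chaos:
  assumes "finite P" "finite R" "finite C" "\<And>t. finite (n t)"
  shows "(\<lambda>x. op_norm (PiE R n) (PiE C n) (partial_chaos n A P R C x)) \<in> borel_measurable (product_law (Sigma P n))"
proof (rule borel_measurable_op_norm)
  show "(\<lambda>x. partial_chaos n A P R C x r c) \<in> borel_measurable (product_law (Sigma P n))" for r c
    unfolding partial_chaos_def
  proof (intro borel_measurable_sum borel_measurable_times borel_measurable_prod borel_measurable_const)
    fix i t assume "i \<in> PiE P n" "t \<in> P"
    then have "(t, i t) \<in> Sigma P n" by (auto simp: PiE_iff)
    then have "(\<lambda>x. x (t, i t)) \<in> measurable (product_law (Sigma P n)) \<mu>"
      by (rule measurable_component_singleton)
    then show "(\<lambda>x. x (t, i t)) \<in> borel_measurable (product_law (Sigma P n))"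
      by (simp add: measurable_cong_sets[OF refl sets_law])
  qed
qed (use assms in \<open>auto intro!: finite_PiE\<close>)

text \<open>Only the integral over the coordinates of mode \<open>t\<close> is a Bochner integral,
  to which the one-mode bounds apply; the outer one stays extended nonnegative, where Tonelli's
  theorem asks for measurability alone.\<close>

lemma nn_integral_partial_chaos_insert:
  assumes fin: "finite P" "finite R" "finite C" "\<And>t. finite (n t)" and t: "t \<notin> P" "t \<notin> R" "t \<notin> C"
  shows "(\<integral>\<^sup>+x. ennreal (op_norm (PiE R n) (PiE C n) (partial_chaos n A (insert t P) R C x)) \<partial>product_law (Sigma (insert t P) n))
    = (\<integral>\<^sup>+x. ennreal (\<integral>y. op_norm (PiE R n) (PiE C n) (matrix_comb ({t} \<times> n t) (mode_matrix n A P R C t x) y) \<partial>product_law ({t} \<times> n t))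
        \<partial>product_law (Sigma P n))"
proof -
  interpret product_sigma_finite "\<lambda>_. \<mu>" by (rule product_sigma_finite_law)
  have split: "Sigma (insert t P) n = Sigma P n \<union> {t} \<times> n t" by auto
  have finPi: "finite (PiE R n)" "finite (PiE C n)" using fin by (auto intro!: finite_PiE)
  have "(\<integral>\<^sup>+x. ennreal (op_norm (PiE R n) (PiE C n) (partial_chaos n A (insert t P) R C x)) \<partial>product_law (Sigma (insert t P) n))
    = (\<integral>\<^sup>+x. (\<integral>\<^sup>+y. ennreal (op_norm (PiE R n) (PiE C n)
        (partial_chaos n A (insert t P) R C (merge (Sigma P n) ({t} \<times> n t) (x, y)))) \<partial>product_law ({t} \<times> n t)) \<partial>product_law (Sigma P n))"
    unfolding split
  proof (rule product_nn_integral_fold)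
    have "(\<lambda>x. op_norm (PiE R n) (PiE C n) (partial_chaos n A (insert t P) R C x)) \<in> borel_measurable (product_law (Sigma (insert t P) n))"
      by (rule borel_measurable_partial_chaos) (use fin in auto)
    then show "(\<lambda>x. ennreal (op_norm (PiE R n) (PiE C n) (partial_chaos n A (insert t P) R C x))) \<in> borel_measurable (product_law (Sigma P n \<union> {t} \<times> n t))"
      unfolding split by simp
  qed (use fin t in auto)
  also have "\<dots> = (\<integral>\<^sup>+x. ennreal (\<integral>y. op_norm (PiE R n) (PiE C n) (matrix_comb ({t} \<times> n t) (mode_matrix n A P R C t x) y) \<partial>product_law ({t} \<times> n t))
        \<partial>product_law (Sigma P n))"
  proof (rule nn_integral_cong)
    fix x
    have comb: "partial_chaos n A (insert t P) R C (merge (Sigma P n) ({t} \<times> n t) (x, y))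
        = matrix_comb ({t} \<times> n t) (mode_matrix n A P R C t x) y" for y
      by (rule partial_chaos_eq_comb) (use fin t in auto)
    show "(\<integral>\<^sup>+y. ennreal (op_norm (PiE R n) (PiE C n)
        (partial_chaos n A (insert t P) R C (merge (Sigma P n) ({t} \<times> n t) (x, y)))) \<partial>product_law ({t} \<times> n t))
      = ennreal (\<integral>y. op_norm (PiE R n) (PiE C n) (matrix_comb ({t} \<times> n t) (mode_matrix n A P R C t x) y) \<partial>product_law ({t} \<times> n t))"
      unfolding comb
      by (intro nn_integral_eq_integral integrable_op_norm_comb AE_I2 op_norm_nonneg) (use finPi fin in auto)
  qed
  finally show ?thesis .
qed

text \<open>The one-mode bound is a parameter, so that the subgaussian and the \<open>L^p\<close>
  version share this induction. It is used with \<open>v = ?a x + ?b x\<close>, the norms after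
  moving \<open>t\<close> to the rows and to the columns; the induction hypothesis bounds both
  expectations alike, whence the factor 2. \<open>R\<close> and \<open>C\<close> never lose the
  modes in \<open>R0\<close> and \<open>C0\<close>, so the last matrices are among those controlled
  by \<open>\<sigma>\<close>.\<close>

lemma partial_chaos_upper:
  fixes D :: real
  assumes n: "\<And>t. finite (n t)" "\<And>t. n t \<noteq> {}" and D: "D \<ge> 0"
    and one_mode: "\<And>t I J B v. \<lbrakk>t \<in> P0; finite I; finite J; I \<noteq> {}; J \<noteq> {}; 0 \<le> v;
        \<And>x. (\<Sum>k\<in>{t} \<times> n t. \<Sum>r\<in>I. (\<Sum>c\<in>J. B k r c * x c)\<^sup>2) \<le> v\<^sup>2 * (\<Sum>c\<in>J. (x c)\<^sup>2);
        \<And>x. (\<Sum>k\<in>{t} \<times> n t. \<Sum>c\<in>J. (\<Sum>r\<in>I. B k r c * x r)\<^sup>2) \<le> v\<^sup>2 * (\<Sum>r\<in>I. (x r)\<^sup>2)\<rbrakk>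
      \<Longrightarrow> (\<integral>x. op_norm I J (matrix_comb ({t} \<times> n t) (B :: nat \<times> nat \<Rightarrow> (nat \<Rightarrow> nat) \<Rightarrow> (nat \<Rightarrow> nat) \<Rightarrow> real) x) \<partial>product_law ({t} \<times> n t))
          \<le> D * sqrt (ln (card I + card J)) * v"
    and card: "\<And>R C. R \<subseteq> T \<Longrightarrow> C \<subseteq> T \<Longrightarrow> R \<inter> C = {} \<Longrightarrow> R \<noteq> {} \<Longrightarrow> C \<noteq> {} \<Longrightarrow>
        sqrt (ln (card (PiE R n) + card (PiE C n))) \<le> l"
    and \<sigma>: "\<And>R C. R0 \<subseteq> R \<Longrightarrow> C0 \<subseteq> C \<Longrightarrow> R \<inter> C = {} \<Longrightarrow> R \<union> C = T \<Longrightarrow>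
        op_norm (PiE R n) (PiE C n) (partial_chaos n A {} R C (\<lambda>_. 0)) \<le> \<sigma>"
    and T: "finite T" and ne: "R0 \<noteq> {}" "C0 \<noteq> {}"
    and P: "finite P" "P \<subseteq> P0" "R0 \<subseteq> R" "C0 \<subseteq> C" "R \<inter> C = {}" "P \<inter> (R \<union> C) = {}" "P \<union> R \<union> C = T"
  shows "(\<integral>\<^sup>+x. ennreal (op_norm (PiE R n) (PiE C n) (partial_chaos n A P R C x)) \<partial>product_law (Sigma P n))
    \<le> ennreal ((2 * D * l) ^ card P * \<sigma>)"
  using P
proof (induction P arbitrary: R C rule: finite_induct)
  case empty
  interpret P0: prob_space "product_law ({} :: (nat \<times> nat) set)" by (rule prob_space_product_law)
  define g where "g = partial_chaos n A {} R C (\<lambda>_. 0)"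
  have g: "partial_chaos n A {} R C x = g" for x
    unfolding g_def by (rule partial_chaos_cong) auto
  have "(\<integral>\<^sup>+x. ennreal (op_norm (PiE R n) (PiE C n) (partial_chaos n A {} R C x)) \<partial>product_law (Sigma {} n))
      \<le> (\<integral>\<^sup>+x. ennreal \<sigma> \<partial>product_law (Sigma {} n))"
    unfolding g using \<sigma>[of R C] empty by (intro nn_integral_mono ennreal_leI) (auto simp: g_def)
  then show ?case by (simp add: P0.emeasure_space_1)
next
  case (insert t P)
  have sub: "P \<subseteq> T" "R \<subseteq> T" "C \<subseteq> T" using insert.prems by auto
  have fin: "finite P" "finite R" "finite C" using sub T by (auto intro: finite_subset)
  have t: "t \<notin> P" "t \<notin> R" "t \<notin> C" using insert by auto
  have finPi: "finite (PiE S n)" if "finite S" for S using that n by (intro finite_PiE) auto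
  have nePi: "PiE S n \<noteq> {}" for S using n by (simp add: PiE_eq_empty_iff)
  let ?a = "\<lambda>x. op_norm (PiE (insert t R) n) (PiE C n) (partial_chaos n A P (insert t R) C x)"
  let ?b = "\<lambda>x. op_norm (PiE R n) (PiE (insert t C) n) (partial_chaos n A P R (insert t C) x)"
  have ab: "0 \<le> ?a x" "0 \<le> ?b x" for x by (intro op_norm_nonneg finPi; use fin in simp)+
  have l: "0 \<le> l" "sqrt (ln (card (PiE R n) + card (PiE C n))) \<le> l"
  proof -
    show *: "sqrt (ln (card (PiE R n) + card (PiE C n))) \<le> l"
      using insert.prems ne sub by (intro card) auto
    have "card (PiE R n) \<ge> 1" using finPi[OF fin(2)] nePi[of R] by (simp add: Suc_le_eq card_gt_0_iff)
    then have "0 \<le> sqrt (ln (card (PiE R n) + card (PiE C n)))" by simp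
    then show "0 \<le> l" using * by linarith
  qed
  have step: "(\<integral>y. op_norm (PiE R n) (PiE C n) (matrix_comb ({t} \<times> n t) (mode_matrix n A P R C t x) y) \<partial>product_law ({t} \<times> n t))
      \<le> D * l * (?a x + ?b x)" for x
  proof -
    have "(\<integral>y. op_norm (PiE R n) (PiE C n) (matrix_comb ({t} \<times> n t) (mode_matrix n A P R C t x) y) \<partial>product_law ({t} \<times> n t))
        \<le> D * sqrt (ln (card (PiE R n) + card (PiE C n))) * (?a x + ?b x)"
    proof (rule one_mode)
      have sq: "(?a x)\<^sup>2 \<le> (?a x + ?b x)\<^sup>2" "(?b x)\<^sup>2 \<le> (?a x + ?b x)\<^sup>2"
        using ab by (auto intro!: power_mono)
      fix w :: "(nat \<Rightarrow> nat) \<Rightarrow> real"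
      show "(\<Sum>k\<in>{t} \<times> n t. \<Sum>r\<in>PiE R n. (\<Sum>c\<in>PiE C n. mode_matrix n A P R C t x k r c * w c)\<^sup>2)
          \<le> (?a x + ?b x)\<^sup>2 * (\<Sum>c\<in>PiE C n. (w c)\<^sup>2)"
        by (rule order_trans[OF mode_matrix_row_le[where n = n, OF n(1) fin t] mult_right_mono[OF sq(1)]])
          (simp add: sum_nonneg)
      show "(\<Sum>k\<in>{t} \<times> n t. \<Sum>c\<in>PiE C n. (\<Sum>r\<in>PiE R n. mode_matrix n A P R C t x k r c * w r)\<^sup>2)
          \<le> (?a x + ?b x)\<^sup>2 * (\<Sum>r\<in>PiE R n. (w r)\<^sup>2)"
        by (rule order_trans[OF mode_matrix_col_le[where n = n, OF n(1) fin t] mult_right_mono[OF sq(2)]])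
          (simp add: sum_nonneg)
    qed (use insert.prems finPi fin nePi ab in \<open>auto intro: add_nonneg_nonneg\<close>)
    also have "\<dots> \<le> D * l * (?a x + ?b x)"
      using D l ab by (intro mult_right_mono mult_left_mono) (auto intro: add_nonneg_nonneg)
    finally show ?thesis .
  qed
  have meas: "(\<lambda>x. ennreal (?a x)) \<in> borel_measurable (product_law (Sigma P n))"
      "(\<lambda>x. ennreal (?b x)) \<in> borel_measurable (product_law (Sigma P n))"
    using borel_measurable_partial_chaos[of P "insert t R" C n A] borel_measurable_partial_chaos[of P R "insert t C" n A] fin n(1)
    by simp_all
  have IHa: "(\<integral>\<^sup>+x. ennreal (?a x) \<partial>product_law (Sigma P n)) \<le> ennreal ((2 * D * l) ^ card P * \<sigma>)"
    by (rule insert.IH) (use insert.prems insert.hyps in auto)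
  have IHb: "(\<integral>\<^sup>+x. ennreal (?b x) \<partial>product_law (Sigma P n)) \<le> ennreal ((2 * D * l) ^ card P * \<sigma>)"
    by (rule insert.IH) (use insert.prems insert.hyps in auto)
  \<comment> \<open>Moving all random modes to the rows gives one of the flattenings that
    \<open>\<sigma>\<close> bounds.\<close>
  have \<sigma>0: "0 \<le> \<sigma>"
  proof -
    have "0 \<le> op_norm (PiE (T - C) n) (PiE C n) (partial_chaos n A {} (T - C) C (\<lambda>_. 0))"
      by (intro op_norm_nonneg finPi) (use fin T in auto)
    also have "\<dots> \<le> \<sigma>" by (rule \<sigma>) (use insert.prems sub in auto)
    finally show ?thesis .
  qed
  have "(\<integral>\<^sup>+x. ennreal (op_norm (PiE R n) (PiE C n) (partial_chaos n A (insert t P) R C x)) \<partial>product_law (Sigma (insert t P) n))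
      \<le> (\<integral>\<^sup>+x. ennreal (D * l) * (ennreal (?a x) + ennreal (?b x)) \<partial>product_law (Sigma P n))"
    unfolding nn_integral_partial_chaos_insert[OF fin n(1) t]
  proof (rule nn_integral_mono)
    fix x
    have "ennreal (D * l) * (ennreal (?a x) + ennreal (?b x)) = ennreal (D * l * (?a x + ?b x))"
      using ab D l by (simp only: ennreal_plus[symmetric] ennreal_mult[symmetric] mult_nonneg_nonneg add_nonneg_nonneg)
    then show "ennreal (\<integral>y. op_norm (PiE R n) (PiE C n) (matrix_comb ({t} \<times> n t) (mode_matrix n A P R C t x) y) \<partial>product_law ({t} \<times> n t))
        \<le> ennreal (D * l) * (ennreal (?a x) + ennreal (?b x))"
      using ennreal_leI[OF step[of x]] by (simp only:)
  qed
  also have "\<dots> = ennreal (D * l) * ((\<integral>\<^sup>+x. ennreal (?a x) \<partial>product_law (Sigma P n)) + (\<integral>\<^sup>+x. ennreal (?b x) \<partial>product_law (Sigma P n)))"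
    using meas by (subst nn_integral_cmult, simp, subst nn_integral_add, simp_all)
  also have "\<dots> \<le> ennreal (D * l) * (ennreal ((2 * D * l) ^ card P * \<sigma>) + ennreal ((2 * D * l) ^ card P * \<sigma>))"
    by (intro mult_left_mono add_mono IHa IHb) simp
  also have "\<dots> = ennreal (D * l * ((2 * D * l) ^ card P * \<sigma> + (2 * D * l) ^ card P * \<sigma>))"
    using D l \<sigma>0
    by (simp only: ennreal_plus[symmetric] ennreal_mult[symmetric] mult_nonneg_nonneg add_nonneg_nonneg zero_le_power zero_le_numeral)
  also have "\<dots> = ennreal ((2 * D * l) ^ card (insert t P) * \<sigma>)"
    using insert.hyps by (simp add: algebra_simps)
  finally show ?case .
qed

text \<open>The target flattening \<open>R'\<close>, \<open>C'\<close> is fixed in advance and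
  dictates to which side each mode is moved.\<close>

lemma partial_chaos_lower:
  fixes \<kappa> :: real
  defines "\<kappa> \<equiv> (\<integral>y. \<bar>y\<bar> \<partial>\<mu>) / (2 * sqrt 3)"
  assumes n: "\<And>t. finite (n t)" and T: "finite T" and R': "R' \<inter> C' = {}" "R' \<union> C' = T"
    and P: "finite P" "R \<subseteq> R'" "C \<subseteq> C'" "P \<inter> (R \<union> C) = {}" "P \<union> R \<union> C = T"
  shows "ennreal (\<kappa> ^ card P * op_norm (PiE R' n) (PiE C' n) (partial_chaos n A {} R' C' (\<lambda>_. 0)))
    \<le> (\<integral>\<^sup>+x. ennreal (op_norm (PiE R n) (PiE C n) (partial_chaos n A P R C x)) \<partial>product_law (Sigma P n))"
  using P
proof (induction P arbitrary: R C rule: finite_induct)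
  case empty
  interpret P0: prob_space "product_law ({} :: (nat \<times> nat) set)" by (rule prob_space_product_law)
  define g where "g = partial_chaos n A {} R' C' (\<lambda>_. 0)"
  have g: "partial_chaos n A {} R' C' x = g" for x
    unfolding g_def by (rule partial_chaos_cong) auto
  have "R = R'" "C = C'" using empty R' by auto
  then show ?case unfolding g by (simp add: P0.emeasure_space_1 g)
next
  case (insert t P)
  have sub: "P \<subseteq> T" "R \<subseteq> T" "C \<subseteq> T" "t \<in> R' \<or> t \<in> C'" using insert.prems R' by auto
  have fin: "finite P" "finite R" "finite C" using sub T by (auto intro: finite_subset)
  have t: "t \<notin> P" "t \<notin> R" "t \<notin> C" using insert by auto
  have finPi: "finite (PiE S n)" if "finite S" for S using that n by (intro finite_PiE) auto
  have \<kappa>: "0 \<le> \<kappa>" by (simp add: \<kappa>_def)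
  let ?int = "\<lambda>x. \<integral>y. op_norm (PiE R n) (PiE C n) (matrix_comb ({t} \<times> n t) (mode_matrix n A P R C t x) y) \<partial>product_law ({t} \<times> n t)"
  have int0: "0 \<le> ?int x" for x
    by (intro Bochner_Integration.integral_nonneg op_norm_nonneg finPi fin)
  have one: "\<kappa> * a \<le> b \<Longrightarrow> 0 < \<kappa> \<Longrightarrow> a \<le> b / \<kappa>" for a b by (simp add: field_simps)
  obtain R1 C1 where RC: "R1 \<subseteq> R'" "C1 \<subseteq> C'" "P \<inter> (R1 \<union> C1) = {}" "P \<union> R1 \<union> C1 = T"
    and step: "\<And>x. \<kappa> * op_norm (PiE R1 n) (PiE C1 n) (partial_chaos n A P R1 C1 x) \<le> ?int x"
  proof (cases "t \<in> R'")
    case True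
    have "\<kappa> * op_norm (PiE (insert t R) n) (PiE C n) (partial_chaos n A P (insert t R) C x) \<le> ?int x" for x
    \<comment> \<open>The bound holds for each test vector; dividing it by \<open>\<kappa>\<close>
      gives an upper bound on the supremum that is the norm.\<close>
    proof (cases "\<kappa> = 0")
      case False
      then have pos: "0 < \<kappa>" using \<kappa> by simp
      have "op_norm (PiE (insert t R) n) (PiE C n) (partial_chaos n A P (insert t R) C x) \<le> ?int x / \<kappa>"
      proof (rule op_norm_least)
        fix w assume w: "L2_set w (PiE C n) \<le> 1"
        have "\<kappa> * sqrt (\<Sum>z\<in>{t} \<times> n t. \<Sum>r\<in>PiE R n. (\<Sum>c\<in>PiE C n. mode_matrix n A P R C t x z r c * w c)\<^sup>2) \<le> ?int x"
          unfolding \<kappa>_def by (rule matrix_comb_lower_col[OF _ _ _ w]) (use finPi fin n in auto)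
        then show "L2_set (\<lambda>r. \<Sum>c\<in>PiE C n. partial_chaos n A P (insert t R) C x r c * w c) (PiE (insert t R) n) \<le> ?int x / \<kappa>"
          unfolding mode_matrix_row[where n = n, OF n fin t] using pos by (intro one) auto
      qed (use finPi fin in auto)
      then show ?thesis using pos by (simp add: field_simps)
    qed (use int0 in simp)
    then show ?thesis using True insert.prems insert.hyps by (intro that[of "insert t R" C]) auto
  next
    case False
    then have tC: "t \<in> C'" using sub by auto
    have "\<kappa> * op_norm (PiE R n) (PiE (insert t C) n) (partial_chaos n A P R (insert t C) x) \<le> ?int x" for x
    proof (cases "\<kappa> = 0")
      case False
      then have pos: "0 < \<kappa>" using \<kappa> by simp
      have finT: "finite (PiE R n)" "finite (PiE (insert t C) n)" using finPi fin by auto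
      have "op_norm (PiE R n) (PiE (insert t C) n) (partial_chaos n A P R (insert t C) x) \<le> ?int x / \<kappa>"
        unfolding op_norm_transpose[OF finT, symmetric]
      proof (rule op_norm_least[OF finT(2,1)])
        fix w assume w: "L2_set w (PiE R n) \<le> 1"
        have "\<kappa> * sqrt (\<Sum>z\<in>{t} \<times> n t. \<Sum>c\<in>PiE C n. (\<Sum>r\<in>PiE R n. mode_matrix n A P R C t x z r c * w r)\<^sup>2) \<le> ?int x"
          unfolding \<kappa>_def by (rule matrix_comb_lower_row[OF _ _ _ w]) (use finPi fin n in auto)
        then show "L2_set (\<lambda>c. \<Sum>r\<in>PiE R n. partial_chaos n A P R (insert t C) x r c * w r) (PiE (insert t C) n) \<le> ?int x / \<kappa>"
          unfolding mode_matrix_col[where n = n, OF n fin t] using pos by (intro one) auto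
      qed
      then show ?thesis using pos by (simp add: field_simps)
    qed (use int0 in simp)
    then show ?thesis using tC insert.prems insert.hyps by (intro that[of R "insert t C"]) auto
  qed
  have fin1: "finite R1" "finite C1" using RC T by (auto intro: finite_subset)
  have "ennreal (\<kappa> ^ card (insert t P) * op_norm (PiE R' n) (PiE C' n) (partial_chaos n A {} R' C' (\<lambda>_. 0)))
      = ennreal \<kappa> * ennreal (\<kappa> ^ card P * op_norm (PiE R' n) (PiE C' n) (partial_chaos n A {} R' C' (\<lambda>_. 0)))"
    using insert.hyps \<kappa> by (simp add: ennreal_mult'[symmetric] mult.assoc)
  also have "\<dots> \<le> ennreal \<kappa> * (\<integral>\<^sup>+x. ennreal (op_norm (PiE R1 n) (PiE C1 n) (partial_chaos n A P R1 C1 x)) \<partial>product_law (Sigma P n))"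
    by (intro mult_left_mono insert.IH RC) simp
  also have "\<dots> = (\<integral>\<^sup>+x. ennreal \<kappa> * ennreal (op_norm (PiE R1 n) (PiE C1 n) (partial_chaos n A P R1 C1 x)) \<partial>product_law (Sigma P n))"
    using borel_measurable_partial_chaos[OF fin(1) fin1 n] by (intro nn_integral_cmult[symmetric]) simp
  also have "\<dots> \<le> (\<integral>\<^sup>+x. ennreal (?int x) \<partial>product_law (Sigma P n))"
    using step \<kappa> by (intro nn_integral_mono) (simp add: ennreal_mult'[symmetric] ennreal_leI)
  also have "\<dots> = (\<integral>\<^sup>+x. ennreal (op_norm (PiE R n) (PiE C n) (partial_chaos n A (insert t P) R C x)) \<partial>product_law (Sigma (insert t P) n))"
    by (rule nn_integral_partial_chaos_insert[OF fin n t, symmetric])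
  finally show ?case .
qed

end

subsection \<open>The chaos and its flattenings\<close>

context
  fixes q m d1 d2 :: nat and A :: "(nat \<Rightarrow> nat) \<Rightarrow> nat \<Rightarrow> nat \<Rightarrow> real"
  assumes size: "m \<ge> 1" "d1 \<ge> 1" "d2 \<ge> 1"
begin

abbreviation "rng \<equiv> mode_range q m d1 d2"
abbreviation "tensor \<equiv> coeff_tensor q A"

definition flat_norm :: "nat set \<Rightarrow> nat set \<Rightarrow> real" where
  "flat_norm R C = op_norm (PiE R rng) (PiE C rng) (partial_chaos rng tensor {} R C (\<lambda>_. 0))"

lemma finite_rng: "finite (rng t)" and rng_nonempty: "rng t \<noteq> {}"
  using size by (auto simp: mode_range_def)

lemma card_rng: "card (rng t) \<le> max d1 d2 + m"
  by (auto simp: mode_range_def)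

lemma sigma_param_eq:
  "sigma_param q m d1 d2 A =
    Max {flat_norm R C | R C. R \<inter> C = {} \<and> R \<union> C = {1..q + 2} \<and> {q + 1} \<subseteq> R \<and> {q + 2} \<subseteq> C}"
proof -
  have "op_norm (PiE R rng) (PiE C rng) (flattening {1..q + 2} rng tensor R C) = flat_norm R C"
    if "C \<subseteq> {1..q + 2}" "R = {1..q + 2} - C" for R C
    unfolding flat_norm_def
  proof (rule op_norm_cong)
    fix r c assume rc: "r \<in> PiE R rng" "c \<in> PiE C rng"
    have "glue {} R C i r c = merge R C (r, c)" for i
      by (auto simp: glue_def merge_def fun_eq_iff)
    then show "flattening {1..q + 2} rng tensor R C r c = partial_chaos rng tensor {} R C (\<lambda>_. 0) r c"
      using flattening_complement[OF that rc, of tensor] by (simp add: partial_chaos_def)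
  qed
  then have "{op_norm (PiE R rng) (PiE C rng) (flattening {1..q + 2} rng tensor R C) | R C.
          C \<subseteq> {1..q + 2} \<and> R = {1..q + 2} - C \<and> q + 1 \<in> R \<and> q + 2 \<in> C}
      = {flat_norm R C | R C. C \<subseteq> {1..q + 2} \<and> R = {1..q + 2} - C \<and> q + 1 \<in> R \<and> q + 2 \<in> C}"
    by (intro Collect_cong ex_cong1) auto
  moreover have "(C \<subseteq> {1..q + 2} \<and> R = {1..q + 2} - C \<and> q + 1 \<in> R \<and> q + 2 \<in> C)
      \<longleftrightarrow> (R \<inter> C = {} \<and> R \<union> C = {1..q + 2} \<and> {q + 1} \<subseteq> R \<and> {q + 2} \<subseteq> C)" for R C
    by blast
  ultimately show ?thesis unfolding sigma_param_def by (simp only:)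
qed

lemma flat_norm_set:
  defines "F \<equiv> {flat_norm R C | R C. R \<inter> C = {} \<and> R \<union> C = {1..q + 2} \<and> {q + 1} \<subseteq> R \<and> {q + 2} \<subseteq> C}"
  shows "finite F" "F \<noteq> {}"
proof -
  have "F \<subseteq> case_prod flat_norm ` (Pow {1..q + 2} \<times> Pow {1..q + 2})" unfolding F_def by blast
  then show "finite F" by (rule finite_subset) auto
  have "flat_norm {1..q + 1} {q + 2} \<in> F" unfolding F_def
    by (rule CollectI, rule exI[of _ "{1..q + 1}"], rule exI[of _ "{q + 2}"]) auto
  then show "F \<noteq> {}" by auto
qed

lemma flat_norm_le_sigma:
  assumes "{q + 1} \<subseteq> R" "{q + 2} \<subseteq> C" "R \<inter> C = {}" "R \<union> C = {1..q + 2}"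
  shows "flat_norm R C \<le> sigma_param q m d1 d2 A"
  unfolding sigma_param_eq by (rule Max_ge[OF flat_norm_set(1)]) (use assms in blast)

lemma sigma_attained:
  obtains R C where "{q + 1} \<subseteq> R" "{q + 2} \<subseteq> C" "R \<inter> C = {}" "R \<union> C = {1..q + 2}"
    "sigma_param q m d1 d2 A = flat_norm R C"
  using Max_in[OF flat_norm_set] that unfolding sigma_param_eq[symmetric] by blast

lemma sigma_nonneg: "0 \<le> sigma_param q m d1 d2 A"
proof -
  obtain R C where RC: "R \<union> C = {1..q + 2}" "sigma_param q m d1 d2 A = flat_norm R C"
    using sigma_attained by metis
  then have "finite R" "finite C" by (metis finite_Un finite_atLeastAtMost)+
  then show ?thesis unfolding RC flat_norm_def
    by (intro op_norm_nonneg finite_PiE finite_rng)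
qed

text \<open>Disjoint nonempty \<open>R\<close> and \<open>C\<close> each miss a mode, so both index
  sets have at most \<open>?N ^ (q + 1)\<close> elements; their sizes add up to at most
  \<open>?N ^ (q + 2)\<close> because \<open>?N \<ge> 2\<close>.\<close>

lemma card_PiE_bound:
  assumes "R \<subseteq> {1..q + 2}" "C \<subseteq> {1..q + 2}" "R \<inter> C = {}" "R \<noteq> {}" "C \<noteq> {}"
  shows "sqrt (ln (card (PiE R rng) + card (PiE C rng)))
    \<le> sqrt (real (q + 2)) * sqrt (ln (real (max d1 d2 + m)))"
proof -
  let ?N = "max d1 d2 + m"
  have N: "?N \<ge> 2" using size by auto
  have fin: "finite R" "finite C" using assms by (auto intro: finite_subset)
  have le: "card (PiE S rng) \<le> ?N ^ (q + 1)" if S: "finite S" "S \<subset> {1..q + 2}" for S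
  proof -
    have "card S < q + 2" using psubset_card_mono[OF _ S(2)] by simp
    have "card (PiE S rng) = (\<Prod>t\<in>S. card (rng t))" by (rule card_PiE[OF S(1)])
    also have "\<dots> \<le> (\<Prod>t\<in>S. ?N)" by (intro prod_mono) (auto simp: card_rng)
    also have "\<dots> = ?N ^ card S" by simp
    also have "\<dots> \<le> ?N ^ (q + 1)"
      using \<open>card S < q + 2\<close> N by (intro power_increasing) auto
    finally show ?thesis .
  qed
  have "R \<subset> {1..q + 2}" "C \<subset> {1..q + 2}" using assms by auto
  then have "card (PiE R rng) + card (PiE C rng) \<le> ?N ^ (q + 1) + ?N ^ (q + 1)"
    by (intro add_mono le fin)
  also have "\<dots> \<le> ?N ^ (q + 2)" using mult_le_mono1[OF N, of "?N ^ (q + 1)"] by (simp add: mult_2)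
  finally have "real (card (PiE R rng) + card (PiE C rng)) \<le> real ?N ^ (q + 2)"
    by (metis of_nat_mono of_nat_power)
  moreover have "card (PiE R rng) \<ge> 1"
    using finite_PiE[OF fin(1) finite_rng] rng_nonempty
    by (simp add: Suc_le_eq card_gt_0_iff PiE_eq_empty_iff)
  ultimately have "ln (real (card (PiE R rng) + card (PiE C rng))) \<le> ln (real ?N ^ (q + 2))"
    by (subst ln_le_cancel_iff) auto
  also have "\<dots> = real (q + 2) * ln (real ?N)" using N by (subst ln_realpow) auto
  finally show ?thesis by (simp add: real_sqrt_mult[symmetric] del: of_nat_add of_nat_max)
qed

lemma chaos_eq_partial_chaos:
  "op_norm {1..d1} {1..d2} (chaos q m A H \<omega>)
    = op_norm (PiE {q + 1} rng) (PiE {q + 2} rng)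
        (partial_chaos rng tensor {1..q} {q + 1} {q + 2} (\<lambda>z. H (fst z) (snd z) \<omega>))"
proof -
  \<comment> \<open>A row or column number as a multi-index over a single mode.\<close>
  define f where "f s k = (\<lambda>t\<in>{s}. k)" for s k :: nat
  have bij: "bij_betw (f s) (rng s) (PiE {s} rng)" for s
  proof (rule bij_betwI[where g = "\<lambda>i. i s"])
    show "f s \<in> rng s \<rightarrow> PiE {s} rng" by (auto simp: f_def)
    show "(\<lambda>i. i s) \<in> PiE {s} rng \<rightarrow> rng s" by auto
    show "f s (i s) = i" if "i \<in> PiE {s} rng" for i
      using that by (auto simp: f_def fun_eq_iff PiE_iff extensional_def)
  qed (simp add: f_def)
  have rng: "rng (q + 1) = {1..d1}" "rng (q + 2) = {1..d2}" by (simp_all add: mode_range_def)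
  have PiE: "PiE {1..q} (\<lambda>_. {1..m}) = PiE {1..q} rng"
    by (rule PiE_cong) (simp add: mode_range_def)
  have "chaos q m A H \<omega> r s = partial_chaos rng tensor {1..q} {q + 1} {q + 2}
      (\<lambda>z. H (fst z) (snd z) \<omega>) (f (q + 1) r) (f (q + 2) s)" for r s
    unfolding chaos_def partial_chaos_def PiE
  proof (intro sum.cong refl arg_cong2[where f = "(*)"])
    fix i assume "i \<in> PiE {1..q} rng"
    then have "restrict (glue {1..q} {q + 1} {q + 2} i (f (q + 1) r) (f (q + 2) s)) {1..q} = i"
      by (auto simp: glue_def fun_eq_iff PiE_iff extensional_def)
    then show "A i r s = tensor (glue {1..q} {q + 1} {q + 2} i (f (q + 1) r) (f (q + 2) s))"
      by (simp add: coeff_tensor_def) (simp add: glue_def f_def)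
  qed simp
  then have "op_norm {1..d1} {1..d2} (chaos q m A H \<omega>)
      = op_norm (rng (q + 1)) (rng (q + 2)) (\<lambda>r s. partial_chaos rng tensor {1..q} {q + 1} {q + 2}
          (\<lambda>z. H (fst z) (snd z) \<omega>) (f (q + 1) r) (f (q + 2) s))"
    unfolding rng by (intro op_norm_cong) simp
  also have "\<dots> = op_norm (PiE {q + 1} rng) (PiE {q + 2} rng)
        (partial_chaos rng tensor {1..q} {q + 1} {q + 2} (\<lambda>z. H (fst z) (snd z) \<omega>))"
    by (rule op_norm_reindex[OF finite_rng finite_rng _ _ bij bij]) (auto intro!: finite_PiE finite_rng)
  finally show ?thesis .
qed

text \<open>Independence enters here: it makes the joint law of the copies a product of copies of
  the law of \<open>h\<close>.\<close>

lemma nn_integral_chaos: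
  fixes M :: "'w measure"
  assumes M: "prob_space M" "integrable M h" "(\<integral>\<omega>. h \<omega> \<partial>M) = 0" and q: "q \<ge> 1" and iid: "iid_copies M h q m H"
  shows "(\<integral>\<^sup>+\<omega>. ennreal (op_norm {1..d1} {1..d2} (chaos q m A H \<omega>)) \<partial>M)
    = (\<integral>\<^sup>+x. ennreal (op_norm (PiE {q + 1} rng) (PiE {q + 2} rng)
          (partial_chaos rng tensor {1..q} {q + 1} {q + 2} x)) \<partial>Pi\<^sub>M (Sigma {1..q} rng) (\<lambda>_. distr M borel h))"
    and "centered_law (distr M borel h)"
proof -
  interpret prob_space M by fact
  define \<mu> where "\<mu> = distr M borel h"
  define K where "K = Sigma {1..q} rng"
  have h[measurable]: "h \<in> borel_measurable M" using M(2) by simp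
  interpret \<mu>: prob_space \<mu> unfolding \<mu>_def by (rule prob_space_distr[OF h])
  have cl: "centered_law \<mu>"
  proof
    show "sets \<mu> = sets borel" by (simp add: \<mu>_def)
    show "integrable \<mu> (\<lambda>y. y)" using M(2) by (simp add: \<mu>_def integrable_distr_eq)
    show "\<mu>.expectation (\<lambda>y. y) = 0" using M(3) by (simp add: \<mu>_def integral_distr)
  qed
  then show "centered_law (distr M borel h)" by (simp add: \<mu>_def)
  interpret centered_law \<mu> by fact
  have K: "K = {1..q} \<times> {1..m}" by (auto simp: K_def mode_range_def)
  define X where "X = (\<lambda>\<omega>. \<lambda>z\<in>K. H (fst z) (snd z) \<omega>)"
  have ne: "K \<noteq> {}" using q size by (auto simp: K)
  have ind: "indep_vars (\<lambda>_. borel) (\<lambda>z. H (fst z) (snd z)) K"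
    and law: "\<And>t i. (t, i) \<in> K \<Longrightarrow> distr M borel (H t i) = \<mu>"
    using iid by (auto simp: iid_copies_def K case_prod_unfold \<mu>_def)
  have rv: "H (fst z) (snd z) \<in> borel_measurable M" if "z \<in> K" for z
    using ind that by (auto simp: indep_vars_def)
  have X: "X \<in> measurable M (Pi\<^sub>M K (\<lambda>_. borel))"
    unfolding X_def using rv by (intro measurable_restrict) auto
  have "distr M (Pi\<^sub>M K (\<lambda>_. borel)) X = Pi\<^sub>M K (\<lambda>z. distr M borel (H (fst z) (snd z)))"
    using ind rv unfolding X_def by (subst (asm) indep_vars_iff_distr_eq_PiM'[OF ne]) auto
  also have "\<dots> = Pi\<^sub>M K (\<lambda>_. \<mu>)" by (intro PiM_cong) (auto simp: law)
  finally have joint: "distr M (Pi\<^sub>M K (\<lambda>_. borel)) X = product_law K" .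
  let ?F = "\<lambda>x. op_norm (PiE {q + 1} rng) (PiE {q + 2} rng) (partial_chaos rng tensor {1..q} {q + 1} {q + 2} x)"
  have F: "?F \<in> borel_measurable (product_law K)"
    unfolding K_def by (rule borel_measurable_partial_chaos) (auto simp: finite_rng)
  have "(\<integral>\<^sup>+\<omega>. ennreal (op_norm {1..d1} {1..d2} (chaos q m A H \<omega>)) \<partial>M) = (\<integral>\<^sup>+\<omega>. ennreal (?F (X \<omega>)) \<partial>M)"
  proof (rule nn_integral_cong)
    fix \<omega>
    have "partial_chaos rng tensor {1..q} {q + 1} {q + 2} (\<lambda>z. H (fst z) (snd z) \<omega>)
        = partial_chaos rng tensor {1..q} {q + 1} {q + 2} (X \<omega>)"
      by (rule partial_chaos_cong) (simp add: X_def K_def)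
    then show "ennreal (op_norm {1..d1} {1..d2} (chaos q m A H \<omega>)) = ennreal (?F (X \<omega>))"
      unfolding chaos_eq_partial_chaos by (simp only:)
  qed
  also have "\<dots> = (\<integral>\<^sup>+x. ennreal (?F x) \<partial>distr M (Pi\<^sub>M K (\<lambda>_. borel)) X)"
    using F by (intro nn_integral_distr[symmetric] X) (simp add: joint[symmetric])
  finally show "(\<integral>\<^sup>+\<omega>. ennreal (op_norm {1..d1} {1..d2} (chaos q m A H \<omega>)) \<partial>M)
    = (\<integral>\<^sup>+x. ennreal (?F x) \<partial>Pi\<^sub>M (Sigma {1..q} rng) (\<lambda>_. distr M borel h))"
    unfolding joint unfolding K_def \<mu>_def .
qed

end

section \<open>Assembling the two-sided bound\<close>

text \<open>The one-mode bounds need a positive scale \<open>t\<close> above the norm of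
  \<open>h\<close>, while the norm itself may be 0 or infinite. A finite norm is reached by letting
  \<open>t\<close> decrease to it. For an infinite one the right side is infinite unless
  \<open>a = 0\<close>, where \<open>0 * \<infinity> = 0\<close> and \<open>zero\<close> is called
  for.\<close>

lemma ennreal_le_power_limit:
  fixes E X :: ennreal and a :: real
  assumes a: "0 \<le> a" and q: "q \<ge> 1" and zero: "a = 0 \<Longrightarrow> E = 0"
    and le: "\<And>t. 0 < t \<Longrightarrow> X < ennreal t \<Longrightarrow> E \<le> ennreal (a * t ^ q)"
  shows "E \<le> ennreal a * X ^ q"
proof (cases "a = 0")
  case False
  then have pos: "a > 0" using a by simp
  show ?thesis
  proof (cases X)
    case top
    then show ?thesis using pos q by (simp add: ennreal_mult_top power_eq_top_ennreal)
  next
    case (real x)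
    have leE: "E \<le> ennreal (a * t ^ q)" if "t > x" for t
      using that real by (intro le) (auto simp: ennreal_less_iff)
    obtain e where e: "E = ennreal e" "0 \<le> e"
      using leE[of "x + 1"] by (cases E) (auto simp: top_unique)
    have "e \<le> a * t ^ q" if "t > x" for t
      using leE[OF that] e that real(1) a by (simp add: ennreal_le_iff)
    then have "\<forall>\<^sub>F t in at_right x. e \<le> a * t ^ q"
      by (auto simp: eventually_at_filter)
    moreover have "((\<lambda>t. a * t ^ q) \<longlongrightarrow> a * x ^ q) (at_right x)"
      by (intro tendsto_intros)
    ultimately have "e \<le> a * x ^ q"
      by (intro tendsto_lowerbound) auto
    then have "ennreal e \<le> ennreal (a * x ^ q)" by (rule ennreal_leI)
    then show ?thesis using e real a by (simp add: ennreal_mult' ennreal_power)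
  qed
qed (use zero in simp)

context centered_law
begin

lemma chaos_upper:
  fixes D :: real and q m d1 d2 :: nat
  assumes size: "m \<ge> 1" "d1 \<ge> 1" "d2 \<ge> 1" and D: "D \<ge> 0"
    and one_mode: "\<And>K I J B v. \<lbrakk>finite K; card K = m; finite I; finite J; I \<noteq> {}; J \<noteq> {}; 0 \<le> v;
        \<And>x. (\<Sum>k\<in>K. \<Sum>r\<in>I. (\<Sum>c\<in>J. B k r c * x c)\<^sup>2) \<le> v\<^sup>2 * (\<Sum>c\<in>J. (x c)\<^sup>2);
        \<And>x. (\<Sum>k\<in>K. \<Sum>c\<in>J. (\<Sum>r\<in>I. B k r c * x r)\<^sup>2) \<le> v\<^sup>2 * (\<Sum>r\<in>I. (x r)\<^sup>2)\<rbrakk>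
      \<Longrightarrow> (\<integral>x. op_norm I J (matrix_comb K (B :: nat \<times> nat \<Rightarrow> (nat \<Rightarrow> nat) \<Rightarrow> (nat \<Rightarrow> nat) \<Rightarrow> real) x) \<partial>product_law K)
          \<le> D * sqrt (ln (card I + card J)) * v"
  defines "n \<equiv> mode_range q m d1 d2"
  shows "(\<integral>\<^sup>+x. ennreal (op_norm (PiE {q + 1} n) (PiE {q + 2} n)
          (partial_chaos n (coeff_tensor q A) {1..q} {q + 1} {q + 2} x)) \<partial>product_law (Sigma {1..q} n))
    \<le> ennreal ((2 * sqrt (real (q + 2)) * D) ^ q * ln (real (max d1 d2 + m)) powr (real q / 2)
        * sigma_param q m d1 d2 A)"
proof -
  let ?l = "sqrt (real (q + 2)) * sqrt (ln (real (max d1 d2 + m)))"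
  have "(\<integral>\<^sup>+x. ennreal (op_norm (PiE {q + 1} n) (PiE {q + 2} n)
          (partial_chaos n (coeff_tensor q A) {1..q} {q + 1} {q + 2} x)) \<partial>product_law (Sigma {1..q} n))
      \<le> ennreal ((2 * D * ?l) ^ card {1..q} * sigma_param q m d1 d2 A)"
  proof (rule partial_chaos_upper[where T = "{1..q + 2}" and ?P0.0 = "{1..q}" and ?R0.0 = "{q + 1}" and ?C0.0 = "{q + 2}"])
    show "finite (n t)" "n t \<noteq> {}" for t
      unfolding n_def using finite_rng[OF size] rng_nonempty[OF size] by auto
    show "sqrt (ln (card (PiE R n) + card (PiE C n))) \<le> ?l"
      if "R \<subseteq> {1..q + 2}" "C \<subseteq> {1..q + 2}" "R \<inter> C = {}" "R \<noteq> {}" "C \<noteq> {}" for R C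
      unfolding n_def by (rule card_PiE_bound[OF size that])
    show "op_norm (PiE R n) (PiE C n) (partial_chaos n (coeff_tensor q A) {} R C (\<lambda>_. 0)) \<le> sigma_param q m d1 d2 A"
      if "{q + 1} \<subseteq> R" "{q + 2} \<subseteq> C" "R \<inter> C = {}" "R \<union> C = {1..q + 2}" for R C
      using flat_norm_le_sigma[OF size that] unfolding n_def flat_norm_def[OF size] .
    fix t and I J :: "(nat \<Rightarrow> nat) set" and B :: "nat \<times> nat \<Rightarrow> (nat \<Rightarrow> nat) \<Rightarrow> (nat \<Rightarrow> nat) \<Rightarrow> real" and v :: real
    assume t: "t \<in> {1..q}" and IJ: "finite I" "finite J" "I \<noteq> {}" "J \<noteq> {}" "0 \<le> v"
      and rc: "\<And>x. (\<Sum>k\<in>{t} \<times> n t. \<Sum>r\<in>I. (\<Sum>c\<in>J. B k r c * x c)\<^sup>2) \<le> v\<^sup>2 * (\<Sum>c\<in>J. (x c)\<^sup>2)"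
        "\<And>x. (\<Sum>k\<in>{t} \<times> n t. \<Sum>c\<in>J. (\<Sum>r\<in>I. B k r c * x r)\<^sup>2) \<le> v\<^sup>2 * (\<Sum>r\<in>I. (x r)\<^sup>2)"
    have "finite ({t} \<times> n t)" "card ({t} \<times> n t) = m"
      using t by (simp_all add: n_def mode_range_def card_cartesian_product)
    then show "(\<integral>x. op_norm I J (matrix_comb ({t} \<times> n t) B x) \<partial>product_law ({t} \<times> n t))
        \<le> D * sqrt (ln (card I + card J)) * v"
      by (rule one_mode[OF _ _ IJ rc])
  qed (use D in auto)
  also have "(2 * D * ?l) ^ card {1..q}
      = (2 * sqrt (real (q + 2)) * D) ^ q * sqrt (ln (real (max d1 d2 + m))) ^ q"
    by (simp add: power_mult_distrib[symmetric] mult_ac)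
  also have "sqrt (ln (real (max d1 d2 + m))) ^ q = ln (real (max d1 d2 + m)) powr (real q / 2)"
  proof -
    have "0 < ln (real (max d1 d2 + m))" using size by simp
    then show ?thesis by (simp add: powr_half_sqrt[symmetric] powr_realpow[symmetric] powr_powr del: of_nat_add of_nat_max)
  qed
  finally show ?thesis .
qed

lemma chaos_lower:
  fixes q m d1 d2 :: nat
  assumes size: "m \<ge> 1" "d1 \<ge> 1" "d2 \<ge> 1"
  defines "n \<equiv> mode_range q m d1 d2"
  shows "ennreal (((\<integral>y. \<bar>y\<bar> \<partial>\<mu>) / (2 * sqrt 3)) ^ q * sigma_param q m d1 d2 A)
    \<le> (\<integral>\<^sup>+x. ennreal (op_norm (PiE {q + 1} n) (PiE {q + 2} n)
          (partial_chaos n (coeff_tensor q A) {1..q} {q + 1} {q + 2} x)) \<partial>product_law (Sigma {1..q} n))"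
proof -
  obtain R C where RC: "{q + 1} \<subseteq> R" "{q + 2} \<subseteq> C" "R \<inter> C = {}" "R \<union> C = {1..q + 2}"
    and \<sigma>: "sigma_param q m d1 d2 A = flat_norm q m d1 d2 A R C"
    using sigma_attained[OF size] .
  have "ennreal (((\<integral>y. \<bar>y\<bar> \<partial>\<mu>) / (2 * sqrt 3)) ^ card {1..q}
        * op_norm (PiE R n) (PiE C n) (partial_chaos n (coeff_tensor q A) {} R C (\<lambda>_. 0)))
    \<le> (\<integral>\<^sup>+x. ennreal (op_norm (PiE {q + 1} n) (PiE {q + 2} n)
          (partial_chaos n (coeff_tensor q A) {1..q} {q + 1} {q + 2} x)) \<partial>product_law (Sigma {1..q} n))"
    by (rule partial_chaos_lower[where T = "{1..q + 2}"]) (use RC finite_rng[OF size] in \<open>auto simp: n_def\<close>)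
  then show ?thesis unfolding \<sigma> flat_norm_def[OF size] n_def by simp
qed

end

theorem theorem2p4:
  fixes q :: nat
  assumes "q \<ge> 1"
  shows "\<exists>c C :: real. c > 0 \<and> C > 0 \<and>
    (\<forall>(m :: nat) (d1 :: nat) (d2 :: nat)
      (M :: (nat \<times> nat \<Rightarrow> real) measure)
      (h :: (nat \<times> nat \<Rightarrow> real) \<Rightarrow> real)
      (H :: nat \<Rightarrow> nat \<Rightarrow> (nat \<times> nat \<Rightarrow> real) \<Rightarrow> real)
      (A :: (nat \<Rightarrow> nat) \<Rightarrow> nat \<Rightarrow> nat \<Rightarrow> real).
      m \<ge> 1 \<and> d1 \<ge> 1 \<and> d2 \<ge> 1 \<and>
      prob_space M \<and> integrable M h \<and> (\<integral>\<omega>. h \<omega> \<partial>M) = 0 \<and> iid_copies M h q m H \<longrightarrow>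
      (let d = max d1 d2;
           E = (\<integral>\<^sup>+\<omega>. ennreal (op_norm {1..d1} {1..d2} (chaos q m A H \<omega>)) \<partial>M);
           \<sigma> = ennreal (sigma_param q m d1 d2 A);
           L = ennreal (ln (real (d + m)) powr (real q / 2))
       in ennreal c * Lp_norm M 1 h ^ q * \<sigma> \<le> E \<and>
          E \<le> ennreal C * psi2_norm M h ^ q * L * \<sigma> \<and>
          E \<le> ennreal C * Lp_norm M (max 1 (ln (real m))) h ^ q * L * \<sigma>))"
proof -
  \<comment> \<open>In each mode, 2 is lost by inserting signs and \<open>sqrt 3\<close> by the
    fourth moment.\<close>
  define c where "c = (1 / (2 * sqrt 3)) ^ q"
  \<comment> \<open>In each mode, 2 comes from adding the norms of the two stackings and
    \<open>sqrt (q + 2)\<close> from the dimensions of the intermediate matrices.\<close>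
  define C0 where "C0 = 2 * sqrt (real (q + 2))"
  \<comment> \<open>60 covers both one-mode constants: 40 in the subgaussian case and
    \<open>20 * 3\<close> in the \<open>L^p\<close> case.\<close>
  define C where "C = (60 * C0) ^ q"
  have C0: "C0 > 0" by (simp add: C0_def)
  have pos: "c > 0" "C > 0" using C0 by (simp_all add: c_def C_def)
  show ?thesis
  proof (rule exI[of _ c], rule exI[of _ C], intro conjI pos allI impI)
    fix m d1 d2 :: nat and M :: "(nat \<times> nat \<Rightarrow> real) measure" and h :: "(nat \<times> nat \<Rightarrow> real) \<Rightarrow> real"
      and H :: "nat \<Rightarrow> nat \<Rightarrow> (nat \<times> nat \<Rightarrow> real) \<Rightarrow> real"
      and A :: "(nat \<Rightarrow> nat) \<Rightarrow> nat \<Rightarrow> nat \<Rightarrow> real"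
    assume "m \<ge> 1 \<and> d1 \<ge> 1 \<and> d2 \<ge> 1 \<and>
      prob_space M \<and> integrable M h \<and> (\<integral>\<omega>. h \<omega> \<partial>M) = 0 \<and> iid_copies M h q m H"
    then have size: "m \<ge> 1" "d1 \<ge> 1" "d2 \<ge> 1" and M: "prob_space M" "integrable M h" "(\<integral>\<omega>. h \<omega> \<partial>M) = 0"
      and iid: "iid_copies M h q m H" by auto
    define \<sigma> where "\<sigma> = sigma_param q m d1 d2 A"
    define L where "L = ln (real (max d1 d2 + m)) powr (real q / 2)"
    define E where "E = (\<integral>\<^sup>+\<omega>. ennreal (op_norm {1..d1} {1..d2} (chaos q m A H \<omega>)) \<partial>M)"
    define \<mu> where "\<mu> = distr M borel h"
    have hm[measurable]: "h \<in> borel_measurable M" using M(2) by simp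
    interpret centered_law \<mu>
      unfolding \<mu>_def by (rule nn_integral_chaos(2)[OF size M assms iid])
    note E_eq = nn_integral_chaos(1)[OF size M assms iid, of A, folded E_def \<mu>_def]
    have \<sigma>: "0 \<le> \<sigma>" unfolding \<sigma>_def by (rule sigma_nonneg[OF size])
    have L: "0 \<le> L" by (simp add: L_def)
    have upper: "E \<le> ennreal ((C0 ^ q * L * \<sigma>) * D ^ q)"
      if "D \<ge> 0" and one_mode: "\<And>K I J B v. \<lbrakk>finite K; card K = m; finite I; finite J; I \<noteq> {}; J \<noteq> {}; 0 \<le> v;
          \<And>x. (\<Sum>k\<in>K. \<Sum>r\<in>I. (\<Sum>c\<in>J. B k r c * x c)\<^sup>2) \<le> v\<^sup>2 * (\<Sum>c\<in>J. (x c)\<^sup>2);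
          \<And>x. (\<Sum>k\<in>K. \<Sum>c\<in>J. (\<Sum>r\<in>I. B k r c * x r)\<^sup>2) \<le> v\<^sup>2 * (\<Sum>r\<in>I. (x r)\<^sup>2)\<rbrakk>
        \<Longrightarrow> (\<integral>x. op_norm I J (matrix_comb K (B :: nat \<times> nat \<Rightarrow> (nat \<Rightarrow> nat) \<Rightarrow> (nat \<Rightarrow> nat) \<Rightarrow> real) x) \<partial>product_law K)
            \<le> D * sqrt (ln (card I + card J)) * v" for D
      using chaos_upper[OF size that, of q A]
      unfolding E_eq C0_def L_def \<sigma>_def by (simp add: power_mult_distrib mult_ac)
    have Lp: "E \<le> ennreal ((C0 ^ q * L * \<sigma>) * (20 * b) ^ q)"
      if "p \<ge> 1" "b > 0" "integrable M (\<lambda>\<omega>. \<bar>h \<omega>\<bar> powr p)" "m * (\<integral>\<omega>. \<bar>h \<omega>\<bar> powr p \<partial>M) \<le> b powr p" for p b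
    proof (rule upper)
      have p: "integrable \<mu> (\<lambda>y. \<bar>y\<bar> powr p)" "m * (\<integral>y. \<bar>y\<bar> powr p \<partial>\<mu>) \<le> b powr p"
        using that by (simp_all add: \<mu>_def integrable_distr_eq integral_distr)
      fix K and I J :: "(nat \<Rightarrow> nat) set" and B :: "nat \<times> nat \<Rightarrow> (nat \<Rightarrow> nat) \<Rightarrow> (nat \<Rightarrow> nat) \<Rightarrow> real" and v :: real
      assume K: "finite K" "card K = m" and IJ: "finite I" "finite J" "I \<noteq> {}" "J \<noteq> {}" "0 \<le> v"
        and rc: "\<And>x. (\<Sum>k\<in>K. \<Sum>r\<in>I. (\<Sum>c\<in>J. B k r c * x c)\<^sup>2) \<le> v\<^sup>2 * (\<Sum>c\<in>J. (x c)\<^sup>2)"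
          "\<And>x. (\<Sum>k\<in>K. \<Sum>c\<in>J. (\<Sum>r\<in>I. B k r c * x r)\<^sup>2) \<le> v\<^sup>2 * (\<Sum>r\<in>I. (x r)\<^sup>2)"
      show "(\<integral>x. op_norm I J (matrix_comb K B x) \<partial>product_law K)
          \<le> 20 * b * sqrt (ln (card I + card J)) * v"
        by (rule Lp_Khintchine[OF IJ(1,2) K(1) IJ(3-5) rc that(1,2) p(1)]) (use p(2) K(2) in simp)
    qed (use that in simp)
    \<comment> \<open>A vanishing constant forces \<open>E = 0\<close> even if the norm of
      \<open>h\<close> is infinite, by the bound with \<open>p = 1\<close>, which is available
      because \<open>h\<close> is integrable. The added 1 keeps the scale positive.\<close>
    have E0: "E = 0" if "C0 ^ q * L * \<sigma> * a = 0" "a > 0" for a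
    proof -
      have "E \<le> ennreal ((C0 ^ q * L * \<sigma>) * (20 * (m * (\<integral>\<omega>. \<bar>h \<omega>\<bar> \<partial>M) + 1)) ^ q)"
        by (rule Lp[of 1]) (use M(2) in \<open>auto intro: add_nonneg_pos\<close>)
      also have "C0 ^ q * L * \<sigma> = 0" using that by auto
      finally show ?thesis by simp
    qed
    have psi2: "E \<le> ennreal (C0 ^ q * L * \<sigma> * 40 ^ q) * psi2_norm M h ^ q"
    proof (rule ennreal_le_power_limit[OF _ assms])
      fix t :: real assume t: "0 < t" "psi2_norm M h < ennreal t"
      then obtain s where s: "s > 0" "(\<integral>\<^sup>+\<omega>. ennreal (exp ((h \<omega>)\<^sup>2 / s\<^sup>2)) \<partial>M) \<le> 2" "s < t"
        unfolding psi2_norm_def Inf_less_iff by (auto simp: ennreal_less_iff)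
      then have psi2: "(\<integral>\<^sup>+y. ennreal (exp (y\<^sup>2 / s\<^sup>2)) \<partial>\<mu>) \<le> 2"
        unfolding \<mu>_def by (subst nn_integral_distr) auto
      have "E \<le> ennreal ((C0 ^ q * L * \<sigma>) * (40 * s) ^ q)"
      proof (rule upper)
        fix K and I J :: "(nat \<Rightarrow> nat) set" and B :: "nat \<times> nat \<Rightarrow> (nat \<Rightarrow> nat) \<Rightarrow> (nat \<Rightarrow> nat) \<Rightarrow> real" and v :: real
        assume K: "finite K" "card K = m" and IJ: "finite I" "finite J" "I \<noteq> {}" "J \<noteq> {}" "0 \<le> v"
          and rc: "\<And>x. (\<Sum>k\<in>K. \<Sum>r\<in>I. (\<Sum>c\<in>J. B k r c * x c)\<^sup>2) \<le> v\<^sup>2 * (\<Sum>c\<in>J. (x c)\<^sup>2)"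
            "\<And>x. (\<Sum>k\<in>K. \<Sum>c\<in>J. (\<Sum>r\<in>I. B k r c * x r)\<^sup>2) \<le> v\<^sup>2 * (\<Sum>r\<in>I. (x r)\<^sup>2)"
        show "(\<integral>x. op_norm I J (matrix_comb K B x) \<partial>product_law K)
            \<le> 40 * s * sqrt (ln (card I + card J)) * v"
          by (rule subgaussian_Khintchine[OF IJ(1,2) K(1) IJ(3-5) rc s(1) psi2])
      qed (use s in simp)
      also have "\<dots> \<le> ennreal ((C0 ^ q * L * \<sigma>) * (40 * t) ^ q)"
        using s t C0 L \<sigma> by (intro ennreal_leI mult_left_mono power_mono) auto
      finally show "E \<le> ennreal (C0 ^ q * L * \<sigma> * 40 ^ q * t ^ q)"
        by (simp add: power_mult_distrib mult_ac)
    qed (use C0 L \<sigma> E0 in auto)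
    have Llog: "E \<le> ennreal (C0 ^ q * L * \<sigma> * 60 ^ q) * Lp_norm M (max 1 (ln (real m))) h ^ q"
    proof (rule ennreal_le_power_limit[OF _ assms])
      define p where "p = max 1 (ln (real m))"
      have p: "p \<ge> 1" "ln (real m) \<le> p" by (simp_all add: p_def)
      fix t :: real assume t: "0 < t" "Lp_norm M (max 1 (ln (real m))) h < ennreal t"
      then have int: "integrable M (\<lambda>\<omega>. \<bar>h \<omega>\<bar> powr p)"
        and norm: "(\<integral>\<omega>. \<bar>h \<omega>\<bar> powr p \<partial>M) powr (1 / p) < t"
        unfolding p_def[symmetric] by (auto simp: Lp_norm_def ennreal_less_iff split: if_splits)
      have I0: "0 \<le> (\<integral>\<omega>. \<bar>h \<omega>\<bar> powr p \<partial>M)" by simp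
      have "(\<integral>\<omega>. \<bar>h \<omega>\<bar> powr p \<partial>M) = ((\<integral>\<omega>. \<bar>h \<omega>\<bar> powr p \<partial>M) powr (1 / p)) powr p"
        using p I0 by (simp add: powr_powr)
      also have "\<dots> \<le> t powr p" using p norm by (intro powr_mono2) auto
      finally have It: "(\<integral>\<omega>. \<bar>h \<omega>\<bar> powr p \<partial>M) \<le> t powr p" .
      \<comment> \<open>This is what the exponent is chosen for: \<open>m \<le> 3 powr p\<close>, so
        the number of variables is absorbed in the scale \<open>3 * t\<close>.\<close>
      have "real m = exp (ln (real m))" using size by simp
      also have "\<dots> \<le> exp p" using p by simp
      also have "\<dots> = exp 1 powr p" by (simp add: powr_def)
      also have "\<dots> \<le> 3 powr p" using exp_le p by (intro powr_mono2) auto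
      finally have "m * (\<integral>\<omega>. \<bar>h \<omega>\<bar> powr p \<partial>M) \<le> 3 powr p * t powr p"
        using It I0 by (intro mult_mono) auto
      also have "\<dots> = (3 * t) powr p" using t by (simp add: powr_mult)
      finally have "E \<le> ennreal ((C0 ^ q * L * \<sigma>) * (20 * (3 * t)) ^ q)"
        using t by (intro Lp[OF p(1) _ int]) auto
      then show "E \<le> ennreal (C0 ^ q * L * \<sigma> * 60 ^ q * t ^ q)"
      proof -
        have "(20 * (3 * t)) ^ q = 60 ^ q * t ^ q" by (subst power_mult_distrib[symmetric]) simp
        then show ?thesis
          using \<open>E \<le> ennreal ((C0 ^ q * L * \<sigma>) * (20 * (3 * t)) ^ q)\<close> by (simp only: mult.assoc)
      qed
    qed (use C0 L \<sigma> E0 in auto)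
    have const: "ennreal (C0 ^ q * L * \<sigma> * a ^ q) * X \<le> ennreal C * X * ennreal L * ennreal \<sigma>"
      if "0 \<le> a" "a \<le> 60" for a X
    proof -
      have "ennreal (C0 ^ q * L * \<sigma> * a ^ q) \<le> ennreal (C * L * \<sigma>)"
      proof (rule ennreal_leI)
        have "a ^ q * C0 ^ q \<le> 60 ^ q * C0 ^ q"
          using that C0 by (intro mult_right_mono power_mono) auto
        then have "(a ^ q * C0 ^ q) * (L * \<sigma>) \<le> (60 ^ q * C0 ^ q) * (L * \<sigma>)"
          by (rule mult_right_mono) (use L \<sigma> in simp)
        then show "C0 ^ q * L * \<sigma> * a ^ q \<le> C * L * \<sigma>"
          by (simp add: C_def power_mult_distrib mult_ac)
      qed
      also have "\<dots> = ennreal C * ennreal L * ennreal \<sigma>"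
        using pos L \<sigma> by (simp add: ennreal_mult)
      finally show ?thesis
        by (metis (no_types, lifting) mult.assoc mult.commute mult_right_mono zero_le)
    qed
    have lower: "ennreal c * Lp_norm M 1 h ^ q * ennreal \<sigma> \<le> E"
    proof -
      define N where "N = (\<integral>\<omega>. \<bar>h \<omega>\<bar> \<partial>M)"
      have N: "0 \<le> N" by (simp add: N_def)
      have "Lp_norm M 1 h = ennreal N" using M(2) N by (simp add: Lp_norm_def N_def)
      then have "ennreal c * Lp_norm M 1 h ^ q * ennreal \<sigma> = ennreal (c * N ^ q * \<sigma>)"
        using pos N \<sigma> by (simp add: ennreal_mult ennreal_power)
      also have "c * N ^ q * \<sigma> = (N / (2 * sqrt 3)) ^ q * \<sigma>"
        by (simp add: c_def power_divide)
      also have "N = (\<integral>y. \<bar>y\<bar> \<partial>\<mu>)" by (simp add: N_def \<mu>_def integral_distr)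
      also have "ennreal (((\<integral>y. \<bar>y\<bar> \<partial>\<mu>) / (2 * sqrt 3)) ^ q * \<sigma>) \<le> E"
        unfolding E_eq \<sigma>_def by (rule chaos_lower[OF size])
      finally show ?thesis .
    qed
    show "let d = max d1 d2;
           E = (\<integral>\<^sup>+\<omega>. ennreal (op_norm {1..d1} {1..d2} (chaos q m A H \<omega>)) \<partial>M);
           \<sigma> = ennreal (sigma_param q m d1 d2 A);
           L = ennreal (ln (real (d + m)) powr (real q / 2))
       in ennreal c * Lp_norm M 1 h ^ q * \<sigma> \<le> E \<and>
          E \<le> ennreal C * psi2_norm M h ^ q * L * \<sigma> \<and>
          E \<le> ennreal C * Lp_norm M (max 1 (ln (real m))) h ^ q * L * \<sigma>"
      unfolding Let_def E_def[symmetric] \<sigma>_def[symmetric] L_def[symmetric]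
      using lower order_trans[OF psi2 const] order_trans[OF Llog const] by simp
  qed
qed

end
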